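(* For every $\delta\ge1$ there is an integer $n_1(\delta)\le8\delta+30$ such that $|\mathcal{R}_{\delta,n}|$ agrees with a polynomial in $n$ for all $n\ge n_1(\delta)$. Explicitly, for $n\ge3$, $$|\mathcal{R}_{\delta,n}|=\sum_{\sigma\in\Sigma_\delta}\ \sum_{(T,x_T,F)}\binom{n-L-t-1}{|F|-1},$$ where, for each $\sigma$ (of length $s$) with $h=\delta-\delta_0$, the inner sum runs over the finitely many triples consisting of a set $T\subseteq\{1,\dots,s\}$, a vector $x_T\in\mathbb{Z}_{\ge1}^{T}$ with $Q(x_T,0)=h$ and $\sum_{i\in T}x_i=t\le2h$ (here $(x_T,0)$ is $x_T$ extended by $0$ outside $T$), and a set $F$ of positions $i\notin T$ with $a_i=0$ and $N(i)\cap(T\cup F)=\varnothing$, such that every $i\in T$ has $a_i\ge1$ or a neighbour in $T\cup F$. For $F=\varnothing$ the binomial coefficient is to be read as $1$ if $n=L+t$ and $0$ otherwise; for $F\neq\varnothing$ it is read as $0$ when $n-L-t-1<0$. The degree of the polynomial is $\max|F|-1$ over the triples occurring.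
   Context: Permutations are written in one-line notation $\pi=\pi_1\cdots\pi_n$, and $\operatorname{inv}(\pi)$ is the number of pairs $i<j$ with $\pi_i>\pi_j$. A permutation avoids $1324$ if there are no indices $i_1<i_2<i_3<i_4$ with $\pi_{i_1}<\pi_{i_3}<\pi_{i_2}<\pi_{i_4}$. $\mathrm{Av}_n^k(1324)$ is the set of $1324$-avoiding permutations of length $n$ with exactly $k$ inversions. A permutation of length $n$ is decomposable if for some $1\le j<n$ its first $j$ entries are exactly $\{1,\dots,j\}$; otherwise it is indecomposable. $\pi\setminus x$ is obtained by deleting the entry $x$ and standardizing. An indecomposable $\pi$ of length $n$ is almost decomposable if at least one of $\pi\setminus 1$, $\pi\setminus n$, $\pi\setminus\pi_1$, $\pi\setminus\pi_n$ (deleting the smallest, largest, first, last entry) is decomposable. The set of residuals at defect $\delta$ is $$\mathcal{R}_{\delta,n}=\{\pi\in\mathrm{Av}_n^{2n-7+\delta}(1324):\ \pi\text{ is indecomposable and not almost decomposable}\}.$$ $\sigma$ is reduced if $\sigma_{i+1}\ne\sigma_i+1$ for all $i$. For $b\in\mathbb{Z}_{\ge1}^s$, $\sigma[b]$ is the inflation replacing the $i$th entry of $\sigma$ by an increasing run of $b_i$ entries (consecutive positions and values). $\Sigma_\delta$ is the set of reduced $\sigma$ (necessarily indecomposable, $1324$-avoiding, of length $\ge2$) such that $\sigma[b]\in\mathcal{R}_{\delta,n}$ for some $b$ and some $n\ge3$; it is finite. The inversion graph of $\sigma$ has the positions as vertices and the pairs in $\mathrm{Inv}(\sigma)=\{(i,j):i<j,\sigma_i>\sigma_j\}$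 as edges; $N(i)$ is the neighbourhood of $i$ in it, and "neighbour" refers to it. For reduced indecomposable $1324$-avoiding $\sigma$ of length $s\ge2$ let $I(\sigma)=\{1,s,\sigma^{-1}(1),\sigma^{-1}(s)\}$ and $D(\sigma)=\{i\in I(\sigma):\sigma\setminus i\text{ (delete position }i\text{, standardize) is decomposable, or }s=2\}$. Put $\ell_i=2$ if $i\in D(\sigma)$ and $\ell_i=1$ otherwise, $L=\sum_i\ell_i$, $\delta_0=\delta(\sigma[\ell])$ where $\delta(\tau)=\operatorname{inv}(\tau)-2|\tau|+7$, $a_i=\sum_{j\in N(i)}\ell_j-2$ (these are $\ge0$), and $$Q(x)=\sum_{i=1}^s a_ix_i+\sum_{(i,j)\in\mathrm{Inv}(\sigma)}x_ix_j .$$ *)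

theory Defs
  imports "HOL-Combinatorics.Multiset_Permutations"
    "HOL-Computational_Algebra.Polynomial"
begin

text \<open>
  A permutation of length \<open>n\<close> is its one-line notation, a list in
  \<open>permutations_of_set {1..n}\<close>.  Entries are the values \<open>1, \<dots>, n\<close>; positions are
  list indices, hence \<open>0, \<dots>, n - 1\<close> where the mathematics writes \<open>1, \<dots>, n\<close>.
\<close>

definition is_perm :: "nat list \<Rightarrow> bool" where
  "is_perm \<pi> \<longleftrightarrow> \<pi> \<in> permutations_of_set {1..length \<pi>}"

definition Inv :: "nat list \<Rightarrow> (nat \<times> nat) set" where
  "Inv \<pi> = {(i, j). i < j \<and> j < length \<pi> \<and> \<pi> ! i > \<pi> ! j}"

definition inversions :: "nat list \<Rightarrow> nat" where
  "inversions \<pi> = card (Inv \<pi>)"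

definition avoids_1324 :: "nat list \<Rightarrow> bool" where
  "avoids_1324 \<pi> \<longleftrightarrow>
     \<not> (\<exists>i1 i2 i3 i4. i1 < i2 \<and> i2 < i3 \<and> i3 < i4 \<and> i4 < length \<pi> \<and>
           \<pi> ! i1 < \<pi> ! i3 \<and> \<pi> ! i3 < \<pi> ! i2 \<and> \<pi> ! i2 < \<pi> ! i4)"

text \<open>The number of inversions is an integer parameter because \<open>2n - 7 + \<delta>\<close> may be negative.\<close>

definition Av_1324 :: "nat \<Rightarrow> int \<Rightarrow> nat list set" where
  "Av_1324 n k =
     {\<pi> \<in> permutations_of_set {1..n}. avoids_1324 \<pi> \<and> int (inversions \<pi>) = k}"

definition decomposable :: "nat list \<Rightarrow> bool" where
  "decomposable \<pi> \<longleftrightarrow> (\<exists>j. 1 \<le> j \<and> j < length \<pi> \<and> set (take j \<pi>) = {1..j})"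

abbreviation indecomposable :: "nat list \<Rightarrow> bool" where
  "indecomposable \<pi> \<equiv> \<not> decomposable \<pi>"

definition standardize :: "nat list \<Rightarrow> nat list" where
  "standardize w = map (\<lambda>x. card {y \<in> set w. y \<le> x}) w"

text \<open>\<open>del_entry \<pi> x\<close> deletes the entry with \<^emph>\<open>value\<close> \<open>x\<close>.\<close>

definition del_entry :: "nat list \<Rightarrow> nat \<Rightarrow> nat list" where
  "del_entry \<pi> x = standardize (removeAll x \<pi>)"

definition almost_decomposable :: "nat list \<Rightarrow> bool" where
  "almost_decomposable \<pi> \<longleftrightarrow> indecomposable \<pi> \<and>
     (decomposable (del_entry \<pi> 1) \<or> decomposable (del_entry \<pi> (length \<pi>)) \<or>
      decomposable (del_entry \<pi> (hd \<pi>)) \<or> decomposable (del_entry \<pi> (last \<pi>)))"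

definition residuals :: "int \<Rightarrow> nat \<Rightarrow> nat list set" where
  "residuals \<delta> n =
     {\<pi> \<in> Av_1324 n (2 * int n - 7 + \<delta>). indecomposable \<pi> \<and> \<not> almost_decomposable \<pi>}"

definition reduced :: "nat list \<Rightarrow> bool" where
  "reduced \<sigma> \<longleftrightarrow> (\<forall>i. Suc i < length \<sigma> \<longrightarrow> \<sigma> ! Suc i \<noteq> \<sigma> ! i + 1)"

text \<open>
  In \<open>\<sigma>[b]\<close>, the run replacing \<open>\<sigma> ! i\<close> consists of the \<open>b i\<close> values following the total
  size of the runs that replace smaller entries.  Only the values of \<open>b\<close> on the positions
  of \<open>\<sigma>\<close> matter.
\<close>

definition inflate :: "nat list \<Rightarrow> (nat \<Rightarrow> nat) \<Rightarrow> nat list" where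
  "inflate \<sigma> b =
     concat (map (\<lambda>i. map (\<lambda>k. (\<Sum>j | j < length \<sigma> \<and> \<sigma> ! j < \<sigma> ! i. b j) + k) [1..<Suc (b i)])
                 [0..<length \<sigma>])"

definition Sigma_set :: "int \<Rightarrow> nat list set" where
  "Sigma_set \<delta> =
     {\<sigma>. is_perm \<sigma> \<and> reduced \<sigma> \<and>
         (\<exists>b n. (\<forall>i<length \<sigma>. b i \<ge> 1) \<and> n \<ge> 3 \<and> inflate \<sigma> b \<in> residuals \<delta> n)}"

definition nbrs :: "nat list \<Rightarrow> nat \<Rightarrow> nat set" where
  "nbrs \<sigma> i = {j. (i, j) \<in> Inv \<sigma> \<or> (j, i) \<in> Inv \<sigma>}"

text \<open>The first and last positions, and the positions of the smallest and largest entries.\<close>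

definition I_set :: "nat list \<Rightarrow> nat set" where
  "I_set \<sigma> =
     {i. i < length \<sigma> \<and> (i = 0 \<or> i = length \<sigma> - 1 \<or> \<sigma> ! i = 1 \<or> \<sigma> ! i = length \<sigma>)}"

definition D_set :: "nat list \<Rightarrow> nat set" where
  "D_set \<sigma> = {i \<in> I_set \<sigma>. decomposable (del_entry \<sigma> (\<sigma> ! i)) \<or> length \<sigma> = 2}"

definition ell :: "nat list \<Rightarrow> nat \<Rightarrow> nat" where
  "ell \<sigma> i = (if i \<in> D_set \<sigma> then 2 else 1)"

definition L_total :: "nat list \<Rightarrow> nat" where
  "L_total \<sigma> = (\<Sum>i<length \<sigma>. ell \<sigma> i)"

definition defect :: "nat list \<Rightarrow> int" where
  "defect \<tau> = int (inversions \<tau>) - 2 * int (length \<tau>) + 7"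

definition defect0 :: "nat list \<Rightarrow> int" where
  "defect0 \<sigma> = defect (inflate \<sigma> (ell \<sigma>))"

definition a_coeff :: "nat list \<Rightarrow> nat \<Rightarrow> int" where
  "a_coeff \<sigma> i = (\<Sum>j\<in>nbrs \<sigma> i. int (ell \<sigma> j)) - 2"

definition Q_form :: "nat list \<Rightarrow> (nat \<Rightarrow> nat) \<Rightarrow> int" where
  "Q_form \<sigma> x =
     (\<Sum>i<length \<sigma>. a_coeff \<sigma> i * int (x i)) + (\<Sum>(i, j)\<in>Inv \<sigma>. int (x i) * int (x j))"

definition zero_ext :: "nat set \<Rightarrow> (nat \<Rightarrow> nat) \<Rightarrow> nat \<Rightarrow> nat" where
  "zero_ext T x i = (if i \<in> T then x i else 0)"

text \<open>
  The triples \<open>(T, x\<^sub>T, F)\<close>.  A vector indexed by \<open>T\<close> is an extensional function, so that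
  it is determined by its values on \<open>T\<close> and each triple is counted once.  The bound
  \<open>t \<le> 2h\<close> on the sum of \<open>x\<^sub>T\<close> is not imposed; it is a consequence of the other
  conditions when \<open>\<sigma> \<in> Sigma_set \<delta>\<close>.
\<close>

definition triples :: "int \<Rightarrow> nat list \<Rightarrow> (nat set \<times> (nat \<Rightarrow> nat) \<times> nat set) set" where
  "triples \<delta> \<sigma> =
     {(T, x, F).
        T \<subseteq> {..<length \<sigma>} \<and> x \<in> (\<Pi>\<^sub>E i\<in>T. {1..}) \<and>
        Q_form \<sigma> (zero_ext T x) = \<delta> - defect0 \<sigma> \<and>
        F \<subseteq> {..<length \<sigma>} - T \<and>
        (\<forall>i\<in>F. a_coeff \<sigma> i = 0 \<and> nbrs \<sigma> i \<inter> (T \<union> F) = {}) \<and>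
        (\<forall>i\<in>T. a_coeff \<sigma> i \<ge> 1 \<or> nbrs \<sigma> i \<inter> (T \<union> F) \<noteq> {})}"

text \<open>
  The binomial coefficient \<open>(n - L - t - 1) choose (|F| - 1)\<close>, with \<open>m = L + t\<close> and
  \<open>f = |F|\<close>, under its two conventions.
\<close>

definition binom_term :: "nat \<Rightarrow> nat \<Rightarrow> nat \<Rightarrow> nat" where
  "binom_term n m f =
     (if f = 0 then (if n = m then 1 else 0)
      else if n < m + 1 then 0
      else (n - m - 1) choose (f - 1))"

end

theory Submission
  imports Defs
begin

text \<open>
  Every permutation is \<open>\<sigma>[b]\<close> for exactly one reduced \<open>\<sigma>\<close> and one \<open>b\<close>: the maximal runs
  of entries that are consecutive in position and in value are collapsed to single entries.
  Pattern avoidance and indecomposability of \<open>\<sigma>[b]\<close> depend on \<open>\<sigma>\<close> only, and deleting an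
  extreme entry of \<open>\<sigma>[b]\<close> can disconnect the inversion graph only if its run has length 1.
  Hence, from length 3 on, \<open>\<sigma>[b]\<close> is neither decomposable nor almost decomposable iff
  \<open>\<sigma>\<close> is indecomposable of length at least 2 and \<open>b \<ge> \<ell>\<close>.  With
  \<open>b = \<ell> + x\<close> the defect is \<open>\<delta>\<^sub>0 + Q(x)\<close>, so residuals correspond to pairs of a reduced \<open>\<sigma>\<close> and a solution \<open>x \<ge> 0\<close> of
  \<open>Q(x) = \<delta> - \<delta>\<^sub>0\<close> with prescribed sum (\<open>bij_betw_residuals\<close>).

  The coefficients \<open>a\<^sub>i\<close> are nonnegative: if a position has a single neighbour, then
  avoidance of 1324 makes that neighbour one of the four extreme positions, and deleting it
  isolates the first one (\<open>sole_nbr_in_D_set\<close>).  In a solution \<open>x\<close>, let \<open>F\<close> be the set of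
  the positions of the support that have \<open>a\<^sub>i = 0\<close> and no neighbour in the support.  They do
  not contribute to \<open>Q\<close>, so their values form an arbitrary composition of what remains of
  \<open>n\<close>, which gives the binomial coefficient (\<open>card_excesses\<close>).  Each of the other positions
  of the support contributes at least \<open>x\<^sub>i\<close> to \<open>2 Q(x)\<close>; therefore \<open>t \<le> 2h\<close>.

  What remains is to bound \<open>\<sigma>\<close>, namely \<open>L \<le> 2 \<delta>\<^sub>0 + 32\<close> (\<open>L_total_le\<close>).  The
  key point is that in a reduced 1324-avoider different positions have different
  neighbourhoods (\<open>reduced_no_twins\<close>).  Call the at most four extreme positions hubs.  Every
  other position is adjacent to a hub.  It contributes its hub edges and half of its other
  edges to the number of inversions of \<open>\<sigma>[\<ell>]\<close>, and a contribution of at least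
  \<open>5/2\<close> is enough.  A
  position with a smaller contribution has all its neighbours among the hubs, or it has only
  one hub neighbour and at most two other neighbours.  Distinct neighbourhoods bound the number
  of the former by a constant.  For the latter, the positions with the same single hub
  neighbour form an increasing sequence along which the neighbourhoods vary monotonically, so
  again there is only a constant number of them (\<open>card_first_only_le\<close>,
  \<open>card_first_only_le_if_distinct\<close>).  Thus the number of inversions is at least
  \<open>5 L / 2\<close> up to a constant, while \<open>\<delta>\<^sub>0\<close> is that number minus \<open>2 L - 7\<close>.

  The bounds give \<open>L + t \<le> 2\<delta> + 32 < 8\<delta> + 30\<close>.  For \<open>n > L + t\<close> the summands
  with \<open>F = {}\<close> vanish, and the others are polynomials in \<open>n\<close> of degree \<open>|F| - 1\<close>
  with positive leading coefficients, so no cancellation lowers the degree of the sum.  A set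
  \<open>F \<noteq> {}\<close> does occur for every \<open>\<delta> \<ge> 1\<close>: the permutation 24153 provides one.
\<close>

section \<open>Permutations, standardization and decomposability\<close>

lemma is_permD:
  assumes "is_perm \<pi>"
  shows "distinct \<pi>" "set \<pi> = {1..length \<pi>}"
  using assms by (auto simp: is_perm_def permutations_of_set_def)

lemma is_permI: "distinct \<pi> \<Longrightarrow> set \<pi> = {1..length \<pi>} \<Longrightarrow> is_perm \<pi>"
  by (auto simp: is_perm_def permutations_of_set_def)

lemma is_perm_nth_eq_iff:
  assumes "is_perm \<pi>" "i < length \<pi>" "j < length \<pi>"
  shows "\<pi> ! i = \<pi> ! j \<longleftrightarrow> i = j"
  using assms by (simp add: is_permD nth_eq_iff_index_eq)

lemma is_perm_nth_bounds:
  assumes "is_perm \<pi>" "i < length \<pi>"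
  shows "1 \<le> \<pi> ! i" "\<pi> ! i \<le> length \<pi>"
  using is_permD[OF assms(1)] assms(2) nth_mem[of i \<pi>] by auto

lemma is_perm_obtain_position:
  assumes "is_perm \<pi>" "1 \<le> x" "x \<le> length \<pi>"
  obtains i where "i < length \<pi>" "\<pi> ! i = x"
  using is_permD[OF assms(1)] assms(2,3) by (metis atLeastAtMost_iff in_set_conv_nth)

lemma is_perm_nth_rank:
  assumes "is_perm \<pi>" "q < length \<pi>"
  shows "\<pi> ! q = Suc (card {r. r < length \<pi> \<and> \<pi> ! r < \<pi> ! q})"
proof -
  have "(!) \<pi> ` {r. r < length \<pi> \<and> \<pi> ! r < \<pi> ! q} = {x \<in> set \<pi>. x < \<pi> ! q}"
    by (auto simp: in_set_conv_nth)
  also have "\<dots> = {1..<\<pi> ! q}"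
    using is_perm_nth_bounds[OF assms] is_permD[OF assms(1)] by auto
  finally have "card {1..<\<pi> ! q} = card ((!) \<pi> ` {r. r < length \<pi> \<and> \<pi> ! r < \<pi> ! q})" by simp
  also have "\<dots> = card {r. r < length \<pi> \<and> \<pi> ! r < \<pi> ! q}"
    by (rule card_image) (use is_perm_nth_eq_iff[OF assms(1)] in \<open>auto simp: inj_on_def\<close>)
  finally show ?thesis using is_perm_nth_bounds[OF assms] by simp
qed

lemma is_perm_eqI:
  assumes "is_perm \<pi>" "is_perm \<rho>" "length \<pi> = length \<rho>"
    and "\<And>i j. i < length \<pi> \<Longrightarrow> j < length \<pi> \<Longrightarrow> \<pi> ! i < \<pi> ! j \<longleftrightarrow> \<rho> ! i < \<rho> ! j"
  shows "\<pi> = \<rho>"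
proof (rule nth_equalityI)
  fix q assume q: "q < length \<pi>"
  have "{r. r < length \<pi> \<and> \<pi> ! r < \<pi> ! q} = {r. r < length \<rho> \<and> \<rho> ! r < \<rho> ! q}"
    using assms(3,4) q by auto
  then show "\<pi> ! q = \<rho> ! q"
    using is_perm_nth_rank[OF assms(1) q] is_perm_nth_rank[OF assms(2)] q assms(3) by simp
qed (use assms in simp)

lemma standardize_less_iff:
  fixes w :: "nat list"
  assumes "x \<in> set w" "y \<in> set w"
  shows "card {z \<in> set w. z \<le> x} < card {z \<in> set w. z \<le> y} \<longleftrightarrow> x < y"
proof -
  have mono: "card {z \<in> set w. z \<le> x} < card {z \<in> set w. z \<le> y}"
    if "x < y" "y \<in> set w" for x y :: nat
  proof (rule psubset_card_mono)
    have "y \<in> {z \<in> set w. z \<le> y}" "y \<notin> {z \<in> set w. z \<le> x}" using that by auto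
    moreover have "{z \<in> set w. z \<le> x} \<subseteq> {z \<in> set w. z \<le> y}" using that by auto
    ultimately show "{z \<in> set w. z \<le> x} \<subset> {z \<in> set w. z \<le> y}" by blast
  qed simp
  show ?thesis
    using mono[of x y] mono[of y x] assms by (cases x y rule: linorder_cases) auto
qed

lemma length_standardize [simp]: "length (standardize w) = length w"
  by (simp add: standardize_def)

lemma standardize_nth_less_iff:
  assumes "i < length w" "j < length w"
  shows "standardize w ! i < standardize w ! j \<longleftrightarrow> w ! i < w ! j"
  using assms standardize_less_iff[of "w ! i" w "w ! j"] by (simp add: standardize_def)

lemma is_perm_standardize:
  assumes "distinct w"
  shows "is_perm (standardize w)"
proof (rule is_permI)
  have inj: "inj_on (\<lambda>x. card {z \<in> set w. z \<le> x}) (set w)"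
  proof (rule inj_onI)
    fix x y assume "x \<in> set w" "y \<in> set w" "card {z \<in> set w. z \<le> x} = card {z \<in> set w. z \<le> y}"
    then show "x = y"
      using standardize_less_iff[of x w y] standardize_less_iff[of y w x] by simp
  qed
  then show dist: "distinct (standardize w)"
    using assms by (simp add: standardize_def distinct_map)
  have "card {z \<in> set w. z \<le> x} \<in> {1..length w}" if "x \<in> set w" for x
  proof -
    have "card {z \<in> set w. z \<le> x} \<le> card (set w)" by (rule card_mono) auto
    moreover have "card {z \<in> set w. z \<le> x} > 0" using that by (auto simp: card_gt_0_iff)
    ultimately show ?thesis using distinct_card[OF assms] by auto
  qed
  then have "set (standardize w) \<subseteq> {1..length w}" by (auto simp: standardize_def)
  moreover have "card (set (standardize w)) = card {1..length w}"
    using distinct_card[OF dist] by simp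
  ultimately show "set (standardize w) = {1..length (standardize w)}"
    by (simp add: card_subset_eq)
qed

text \<open>
  Decomposability relative to a set of positions, stated through the order of positions and of
  values only.  In this form deleting an entry just removes a position from \<open>S\<close>, without
  standardizing.
\<close>

definition decomp_on :: "nat list \<Rightarrow> nat set \<Rightarrow> bool" where
  "decomp_on \<pi> S \<longleftrightarrow> (\<exists>A B. A \<noteq> {} \<and> B \<noteq> {} \<and> A \<union> B = S \<and>
     (\<forall>a\<in>A. \<forall>b\<in>B. a < b \<and> \<pi> ! a < \<pi> ! b))"

text \<open>
  An initial segment whose values lie below all later values is closed downwards in
  \<open>{1..n}\<close>, so its values are \<open>{1..j}\<close> for its length \<open>j\<close>.
\<close>

lemma decomposable_iff_split:
  assumes "is_perm \<rho>"
  shows "decomposable \<rho> \<longleftrightarrow>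
    (\<exists>u v. u \<noteq> [] \<and> v \<noteq> [] \<and> \<rho> = u @ v \<and> (\<forall>a\<in>set u. \<forall>b\<in>set v. a < b))"
proof
  assume "decomposable \<rho>"
  then obtain j where j: "1 \<le> j" "j < length \<rho>" "set (take j \<rho>) = {1..j}"
    by (auto simp: decomposable_def)
  have "a < b" if "a \<in> set (take j \<rho>)" "b \<in> set (drop j \<rho>)" for a b
  proof -
    have "set (take j \<rho>) \<inter> set (drop j \<rho>) = {}"
      using is_permD(1)[OF assms] by (metis append_take_drop_id distinct_append)
    moreover have "1 \<le> b" using that(2) is_permD[OF assms] by (auto dest: in_set_dropD)
    ultimately show ?thesis using that j(3) by force
  qed
  then show "\<exists>u v. u \<noteq> [] \<and> v \<noteq> [] \<and> \<rho> = u @ v \<and> (\<forall>a\<in>set u. \<forall>b\<in>set v. a < b)"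
    using j by (intro exI[of _ "take j \<rho>"] exI[of _ "drop j \<rho>"]) auto
next
  assume "\<exists>u v. u \<noteq> [] \<and> v \<noteq> [] \<and> \<rho> = u @ v \<and> (\<forall>a\<in>set u. \<forall>b\<in>set v. a < b)"
  then obtain u v where uv: "u \<noteq> []" "v \<noteq> []" "\<rho> = u @ v" "\<forall>a\<in>set u. \<forall>b\<in>set v. a < b"
    by blast
  have dist: "distinct u" and set_uv: "set u \<union> set v = {1..length \<rho>}"
    using is_permD[OF assms] uv(3) by auto
  have down: "y \<in> set u" if "x \<in> set u" "1 \<le> y" "y \<le> x" for x y
    using that uv(4) set_uv by (metis Un_iff atLeastAtMost_iff leD le_trans)
  have "set u = {1..Max (set u)}"
  proof (intro equalityI subsetI)
    fix y assume "y \<in> set u" then show "y \<in> {1..Max (set u)}" using set_uv by auto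
  next
    fix y assume "y \<in> {1..Max (set u)}"
    then show "y \<in> set u" using down[of "Max (set u)" y] uv(1) by auto
  qed
  moreover from this have "Max (set u) = length u"
    using distinct_card[OF dist] by (metis card_atLeastAtMost diff_Suc_1)
  ultimately have seg: "set u = {1..length u}" by simp
  have "length u < length \<rho>" "1 \<le> length u" using uv(1-3) by (auto simp: Suc_le_eq)
  moreover have "set (take (length u) \<rho>) = {1..length u}" using seg uv(3) by simp
  ultimately show "decomposable \<rho>"
    unfolding decomposable_def by blast
qed

lemma filter_eq_append_obtain:
  assumes "filter P \<pi> = u @ v"
  obtains us vs where "\<pi> = us @ vs" "u = filter P us" "v = filter P vs"
proof -
  have "\<exists>us vs. \<pi> = us @ vs \<and> u = filter P us \<and> v = filter P vs"
    using assms
  proof (induction \<pi> arbitrary: u)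
    case (Cons x \<pi>)
    show ?case
    proof (cases "P x \<and> u = []")
      case True
      then show ?thesis using Cons.prems by (intro exI[of _ "[]"] exI[of _ "x # \<pi>"]) auto
    next
      case False
      then have "filter P \<pi> = (if P x then tl u else u) @ v"
        using Cons.prems by (cases u) auto
      then obtain us vs where "\<pi> = us @ vs" "(if P x then tl u else u) = filter P us" "v = filter P vs"
        using Cons.IH by blast
      then show ?thesis using False Cons.prems
        by (intro exI[of _ "x # us"] exI[of _ vs]) (cases u; auto split: if_splits)
    qed
  qed simp
  then show ?thesis using that by blast
qed

lemma filter_split_iff_decomp_on:
  "(\<exists>u v. u \<noteq> [] \<and> v \<noteq> [] \<and> filter P \<pi> = u @ v \<and> (\<forall>a\<in>set u. \<forall>b\<in>set v. a < b)) \<longleftrightarrow>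
   decomp_on \<pi> {q. q < length \<pi> \<and> P (\<pi> ! q)}"
proof
  assume "\<exists>u v. u \<noteq> [] \<and> v \<noteq> [] \<and> filter P \<pi> = u @ v \<and> (\<forall>a\<in>set u. \<forall>b\<in>set v. a < b)"
  then obtain u v where uv: "u \<noteq> []" "v \<noteq> []" "filter P \<pi> = u @ v" "\<forall>a\<in>set u. \<forall>b\<in>set v. a < b"
    by blast
  from uv(3) obtain us vs where s: "\<pi> = us @ vs" "u = filter P us" "v = filter P vs"
    by (metis filter_eq_append_obtain)
  let ?A = "{q. q < length us \<and> P (us ! q)}"
  let ?B = "{q. length us \<le> q \<and> q < length \<pi> \<and> P (\<pi> ! q)}"
  have "?A \<noteq> {}" using uv(1) s(2) by (auto simp: filter_empty_conv in_set_conv_nth)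
  moreover have "?B \<noteq> {}"
  proof -
    obtain k where "k < length vs" "P (vs ! k)"
      using uv(2) s(3) by (auto simp: filter_empty_conv in_set_conv_nth)
    then have "length us + k \<in> ?B" using s(1) by (simp add: nth_append)
    then show ?thesis by blast
  qed
  moreover have "?A \<union> ?B = {q. q < length \<pi> \<and> P (\<pi> ! q)}"
    using s(1) by (auto simp: nth_append split: if_splits)
  moreover have "\<forall>a\<in>?A. \<forall>b\<in>?B. a < b \<and> \<pi> ! a < \<pi> ! b"
  proof (intro ballI)
    fix a b assume ab: "a \<in> ?A" "b \<in> ?B"
    have "\<pi> ! a \<in> set u" using ab(1) s(1,2) by (auto simp: nth_append)
    moreover have "\<pi> ! b \<in> set v" using ab(2) s(1,3) by (auto simp: nth_append)
    ultimately show "a < b \<and> \<pi> ! a < \<pi> ! b" using uv(4) ab by auto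
  qed
  ultimately show "decomp_on \<pi> {q. q < length \<pi> \<and> P (\<pi> ! q)}"
    unfolding decomp_on_def by (intro exI[of _ ?A] exI[of _ ?B] conjI)
next
  assume "decomp_on \<pi> {q. q < length \<pi> \<and> P (\<pi> ! q)}"
  then obtain A B where AB: "A \<noteq> {}" "B \<noteq> {}" "A \<union> B = {q. q < length \<pi> \<and> P (\<pi> ! q)}"
      "\<forall>a\<in>A. \<forall>b\<in>B. a < b \<and> \<pi> ! a < \<pi> ! b"
    unfolding decomp_on_def by (elim exE conjE)
  define j where "j = Min B"
  have finB: "finite B" by (rule finite_subset[of _ "{q. q < length \<pi> \<and> P (\<pi> ! q)}"]) (use AB in auto)
  have jB: "j \<in> B" and jmin: "\<And>b. b \<in> B \<Longrightarrow> j \<le> b"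
    using finB AB(2) by (auto simp: j_def)
  have Aj: "a < j" if "a \<in> A" for a using AB(4) that jB by simp
  let ?u = "filter P (take j \<pi>)" and ?v = "filter P (drop j \<pi>)"
  have jlen: "j < length \<pi>" using jB AB(3) by auto
  have setu: "x \<in> set ?u \<Longrightarrow> \<exists>a\<in>A. x = \<pi> ! a" for x
  proof -
    assume "x \<in> set ?u"
    then obtain a where a: "a < j" "a < length \<pi>" "x = \<pi> ! a" "P x"
      by (auto simp: in_set_conv_nth)
    then have "a \<in> A \<union> B" using AB(3) by simp
    then show ?thesis using a jmin[of a] by auto
  qed
  have setv: "x \<in> set ?v \<Longrightarrow> \<exists>b\<in>B. x = \<pi> ! b" for x
  proof -
    assume "x \<in> set ?v"
    then obtain k where "k < length \<pi> - j" "x = \<pi> ! (j + k)" "P x"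
      by (auto simp: in_set_conv_nth)
    moreover from this have "j + k \<in> A \<union> B" using AB(3) by simp
    ultimately show ?thesis using Aj[of "j + k"] by auto
  qed
  have "?u \<noteq> []"
  proof -
    obtain a where a: "a \<in> A" using AB(1) by blast
    then have "a < length \<pi>" "P (\<pi> ! a)" using AB(3) by auto
    then have "\<pi> ! a \<in> set ?u" using Aj[OF a] by (auto simp: in_set_conv_nth)
    then show ?thesis by (metis empty_iff empty_set)
  qed
  moreover have "?v \<noteq> []"
  proof -
    have "P (\<pi> ! j)" using jB AB(3) by auto
    then have "\<pi> ! j \<in> set ?v" using jlen by (auto simp: in_set_conv_nth intro!: exI[of _ 0])
    then show ?thesis by (metis empty_iff empty_set)
  qed
  moreover have "filter P \<pi> = ?u @ ?v" by (metis append_take_drop_id filter_append)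
  moreover have "\<forall>a\<in>set ?u. \<forall>b\<in>set ?v. a < b" using setu setv AB(4) by blast
  ultimately show "\<exists>u v. u \<noteq> [] \<and> v \<noteq> [] \<and> filter P \<pi> = u @ v \<and> (\<forall>a\<in>set u. \<forall>b\<in>set v. a < b)"
    by blast
qed

lemma decomposable_iff_decomp_on:
  assumes "is_perm \<pi>"
  shows "decomposable \<pi> \<longleftrightarrow> decomp_on \<pi> {..<length \<pi>}"
  using decomposable_iff_split[OF assms] filter_split_iff_decomp_on[of "\<lambda>_. True" \<pi>]
  by (simp add: lessThan_def)

lemma decomposable_standardize_iff_split:
  assumes "distinct w"
  shows "decomposable (standardize w) \<longleftrightarrow>
    (\<exists>u v. u \<noteq> [] \<and> v \<noteq> [] \<and> w = u @ v \<and> (\<forall>a\<in>set u. \<forall>b\<in>set v. a < b))"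
    (is "_ \<longleftrightarrow> ?thesis_rhs")
proof -
  let ?r = "\<lambda>x. card {y \<in> set w. y \<le> x}"
  have less: "?r a < ?r b \<longleftrightarrow> a < b" if "w = u @ v" "a \<in> set u" "b \<in> set v" for a b u v
    using standardize_less_iff[of a w b] that by simp
  have "(\<exists>u v. u \<noteq> [] \<and> v \<noteq> [] \<and> map ?r w = u @ v \<and> (\<forall>a\<in>set u. \<forall>b\<in>set v. a < b)) \<longleftrightarrow>
        (\<exists>u v. u \<noteq> [] \<and> v \<noteq> [] \<and> w = u @ v \<and> (\<forall>a\<in>set u. \<forall>b\<in>set v. ?r a < ?r b))"
    (is "?L \<longleftrightarrow> ?R")
  proof
    assume ?L
    then obtain u v where "u \<noteq> []" "v \<noteq> []" "map ?r w = u @ v" "\<forall>a\<in>set u. \<forall>b\<in>set v. a < b"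
      by blast
    moreover from this obtain u' v' where "w = u' @ v'" "map ?r u' = u" "map ?r v' = v"
      unfolding map_eq_append_conv by blast
    ultimately show ?R by (intro exI[of _ u'] exI[of _ v']) (auto simp del: set_append)
  next
    assume ?R
    then obtain u v where "u \<noteq> []" "v \<noteq> []" "w = u @ v" "\<forall>a\<in>set u. \<forall>b\<in>set v. ?r a < ?r b"
      by blast
    then show ?L by (intro exI[of _ "map ?r u"] exI[of _ "map ?r v"]) auto
  qed
  also have "\<dots> \<longleftrightarrow> (\<exists>u v. u \<noteq> [] \<and> v \<noteq> [] \<and> w = u @ v \<and> (\<forall>a\<in>set u. \<forall>b\<in>set v. a < b))"
    by (intro ex_cong1 conj_cong refl ball_cong; rule less; assumption)
  finally have "decomposable (map ?r w) \<longleftrightarrow> ?thesis_rhs"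
    if "decomposable (map ?r w) \<longleftrightarrow>
      (\<exists>u v. u \<noteq> [] \<and> v \<noteq> [] \<and> map ?r w = u @ v \<and> (\<forall>a\<in>set u. \<forall>b\<in>set v. a < b))"
    by (rule trans[OF that])
  from this[OF decomposable_iff_split[OF is_perm_standardize[OF assms], unfolded standardize_def]]
  show ?thesis unfolding standardize_def .
qed

lemma decomposable_del_entry_iff:
  assumes "is_perm \<pi>" "q < length \<pi>"
  shows "decomposable (del_entry \<pi> (\<pi> ! q)) \<longleftrightarrow> decomp_on \<pi> ({..<length \<pi>} - {q})"
proof -
  have "{r. r < length \<pi> \<and> \<pi> ! q \<noteq> \<pi> ! r} = {..<length \<pi>} - {q}"
    using is_perm_nth_eq_iff[OF assms(1)] assms(2) by auto
  then show ?thesis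
    using decomposable_standardize_iff_split[of "removeAll (\<pi> ! q) \<pi>"] is_permD(1)[OF assms(1)]
      filter_split_iff_decomp_on[of "\<lambda>x. \<pi> ! q \<noteq> x" \<pi>]
    by (simp add: del_entry_def distinct_removeAll removeAll_filter_not_eq)
qed

section \<open>Permutations as inflations of reduced permutations\<close>

lemma finite_Inv [simp]: "finite (Inv \<tau>)"
  by (rule finite_subset[of _ "{..<length \<tau>} \<times> {..<length \<tau>}"]) (auto simp: Inv_def)

text \<open>
  The relation between \<open>\<pi> = \<sigma>[b]\<close> and \<open>\<sigma>\<close> without offsets: \<open>g\<close> maps a position of
  \<open>\<pi>\<close> to the position of \<open>\<sigma>\<close> whose run contains it.  The fibre of \<open>g\<close> over \<open>i\<close> is
  that run, and \<open>b i\<close> is its size (see \<open>eq_inflate\<close>).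
\<close>

locale run_collapse =
  fixes g :: "nat \<Rightarrow> nat" and \<pi> \<sigma> :: "nat list"
  assumes perm: "is_perm \<pi>" and perm': "is_perm \<sigma>"
    and onto: "g ` {..<length \<pi>} = {..<length \<sigma>}"
    and mono: "\<And>q r. r < length \<pi> \<Longrightarrow> q < r \<Longrightarrow> g q \<le> g r"
    and order: "\<And>q r. q < length \<pi> \<Longrightarrow> r < length \<pi> \<Longrightarrow> g q \<noteq> g r \<Longrightarrow>
      \<pi> ! q < \<pi> ! r \<longleftrightarrow> \<sigma> ! g q < \<sigma> ! g r"
    and run: "\<And>q r. r < length \<pi> \<Longrightarrow> q < r \<Longrightarrow> g q = g r \<Longrightarrow> \<pi> ! q < \<pi> ! r"
begin

definition fibre :: "nat \<Rightarrow> nat set" where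
  "fibre i = {q. q < length \<pi> \<and> g q = i}"

lemma g_less: "q < length \<pi> \<Longrightarrow> g q < length \<sigma>"
  using onto by blast

lemma obtain_preimage:
  assumes "i < length \<sigma>" obtains q where "q < length \<pi>" "g q = i"
  using assms onto by (metis imageE lessThan_iff)

lemma finite_fibre [simp]: "finite (fibre i)"
  by (simp add: fibre_def)

lemma card_fibre_pos: "i < length \<sigma> \<Longrightarrow> 1 \<le> card (fibre i)"
proof -
  assume "i < length \<sigma>"
  then obtain q where "q < length \<pi>" "g q = i" by (rule obtain_preimage)
  then have "fibre i \<noteq> {}" by (auto simp: fibre_def)
  then show ?thesis by (simp add: Suc_le_eq card_gt_0_iff)
qed

lemma less_if_g_less: "q < length \<pi> \<Longrightarrow> g q < g r \<Longrightarrow> q < r"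
  using mono[of q r] by (cases q r rule: linorder_cases) auto

lemma Inv_iff: "(q, r) \<in> Inv \<pi> \<longleftrightarrow> q < length \<pi> \<and> r < length \<pi> \<and> (g q, g r) \<in> Inv \<sigma>"
proof (cases "q < length \<pi> \<and> r < length \<pi>")
  case True
  show ?thesis
  proof (cases "g q = g r")
    case True
    then show ?thesis using run[of r q] by (auto simp: Inv_def)
  next
    case False
    then have "q < r \<longleftrightarrow> g q < g r"
      using True less_if_g_less[of q r] less_if_g_less[of r q] by force
    then show ?thesis
      using True False order[of r q] g_less[of r] by (auto simp: Inv_def)
  qed
qed (auto simp: Inv_def)

lemma Inv_eq: "Inv \<pi> = (\<Union>(i, j)\<in>Inv \<sigma>. fibre i \<times> fibre j)"
proof (intro set_eqI)
  fix x show "x \<in> Inv \<pi> \<longleftrightarrow> x \<in> (\<Union>(i, j)\<in>Inv \<sigma>. fibre i \<times> fibre j)"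
    using Inv_iff[of "fst x" "snd x"] by (cases x) (auto simp: fibre_def)
qed

lemma length_eq: "length \<pi> = (\<Sum>i<length \<sigma>. card (fibre i))"
proof -
  have "{..<length \<pi>} = (\<Union>i<length \<sigma>. fibre i)" using g_less by (auto simp: fibre_def)
  then have "length \<pi> = card (\<Union>i<length \<sigma>. fibre i)" by (metis card_lessThan)
  also have "\<dots> = (\<Sum>i<length \<sigma>. card (fibre i))"
    by (rule card_UN_disjoint) (auto simp: fibre_def)
  finally show ?thesis .
qed

lemma inversions_eq: "inversions \<pi> = (\<Sum>(i, j)\<in>Inv \<sigma>. card (fibre i) * card (fibre j))"
proof -
  have "inversions \<pi> = (\<Sum>x\<in>Inv \<sigma>. card (case x of (i, j) \<Rightarrow> fibre i \<times> fibre j))"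
    unfolding inversions_def Inv_eq
    by (rule card_UN_disjoint) (auto simp: finite_Inv fibre_def)
  also have "\<dots> = (\<Sum>(i, j)\<in>Inv \<sigma>. card (fibre i) * card (fibre j))"
    by (rule sum.cong) (auto simp: card_cartesian_product)
  finally show ?thesis .
qed

lemma value_convex:
  assumes "q < length \<pi>" "r < length \<pi>" "t < length \<pi>" "g q = g t"
    "\<pi> ! q < \<pi> ! r" "\<pi> ! r < \<pi> ! t"
  shows "g r = g q" "q < r" "r < t"
proof -
  show 1: "g r = g q" 
  proof (rule ccontr)
    assume "g r \<noteq> g q"
    then have "\<sigma> ! g q < \<sigma> ! g r" "\<sigma> ! g r < \<sigma> ! g q"
      using order[of q r] order[of r t] assms by auto
    then show False by simp
  qed
  have "\<not> r < q" using run[OF assms(1)] 1 assms(5) less_asym by blast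
  moreover have "r \<noteq> q" using assms(5) by blast
  ultimately show "q < r" by simp
  have "\<not> t < r" using run[OF assms(2), of t] 1 assms(4,6) by auto
  moreover have "r \<noteq> t" using assms(6) by blast
  ultimately show "r < t" by simp
qed

lemma avoids_iff: "avoids_1324 \<pi> \<longleftrightarrow> avoids_1324 \<sigma>"
proof
  assume av: "avoids_1324 \<pi>"
  show "avoids_1324 \<sigma>"
    unfolding avoids_1324_def
  proof (intro notI, elim exE conjE)
    fix a b c d assume h: "a < b" "b < c" "c < d" "d < length \<sigma>"
      "\<sigma> ! a < \<sigma> ! c" "\<sigma> ! c < \<sigma> ! b" "\<sigma> ! b < \<sigma> ! d"
    obtain a' where a': "a' < length \<pi>" "g a' = a" using obtain_preimage[of a] h by auto
    obtain b' where b': "b' < length \<pi>" "g b' = b" using obtain_preimage[of b] h by auto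
    obtain c' where c': "c' < length \<pi>" "g c' = c" using obtain_preimage[of c] h by auto
    obtain d' where d': "d' < length \<pi>" "g d' = d" using obtain_preimage[of d] h by auto
    have "a' < b'" "b' < c'" "c' < d'"
      using a' b' c' d' h less_if_g_less[of a' b'] less_if_g_less[of b' c'] less_if_g_less[of c' d'] by auto
    moreover have "\<pi> ! a' < \<pi> ! c'" "\<pi> ! c' < \<pi> ! b'" "\<pi> ! b' < \<pi> ! d'"
      using a' b' c' d' h order[of a' c'] order[of c' b'] order[of b' d'] by auto
    ultimately show False using av d'(1) unfolding avoids_1324_def by blast
  qed
next
  assume av: "avoids_1324 \<sigma>"
  show "avoids_1324 \<pi>"
    unfolding avoids_1324_def
  proof (intro notI, elim exE conjE)
    fix a b c d assume h: "a < b" "b < c" "c < d" "d < length \<pi>"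
      "\<pi> ! a < \<pi> ! c" "\<pi> ! c < \<pi> ! b" "\<pi> ! b < \<pi> ! d"
    have lt: "a < length \<pi>" "b < length \<pi>" "c < length \<pi>" "d < length \<pi>" using h by auto
    have bc: "g b \<noteq> g c" using run[of c b] h lt by auto
    \<comment> \<open>A run is an interval of positions and of values. If it contained one of the four pairs
      below, it would contain the entry of the pattern lying between them in value (pairs
      \<open>a, b\<close> and \<open>c, d\<close>) or in position (pairs \<open>a, c\<close> and \<open>b, d\<close>), hence both \<open>b\<close> and \<open>c\<close>.\<close>
    have ab: "g a \<noteq> g b" using value_convex(1)[of a c b] bc h lt by auto
    have ac: "g a \<noteq> g c" using mono[of b a] mono[of c b] bc h lt by (metis le_antisym)
    have cd: "g c \<noteq> g d" using value_convex(1)[of c b d] bc h lt by auto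
    have bd: "g b \<noteq> g d" using mono[of c b] mono[of d c] bc h lt by (metis le_antisym)
    have "g a < g b" "g b < g c" "g c < g d"
      using mono[of b a] mono[of c b] mono[of d c] ab bc cd h lt by (auto simp: le_less)
    moreover have "\<sigma> ! g a < \<sigma> ! g c" "\<sigma> ! g c < \<sigma> ! g b" "\<sigma> ! g b < \<sigma> ! g d"
      using order[of a c] order[of c b] order[of b d] ac bc bd h lt by auto
    ultimately show False using av g_less[OF lt(4)] unfolding avoids_1324_def by blast
  qed
qed

lemma decomp_on_iff:
  assumes S: "S \<subseteq> {..<length \<pi>}" and two: "2 \<le> card (g ` S)"
  shows "decomp_on \<pi> S \<longleftrightarrow> decomp_on \<sigma> (g ` S)"
proof
  assume "decomp_on \<sigma> (g ` S)"
  then obtain A B where AB: "A \<noteq> {}" "B \<noteq> {}" "A \<union> B = g ` S"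
      "\<forall>a\<in>A. \<forall>b\<in>B. a < b \<and> \<sigma> ! a < \<sigma> ! b"
    unfolding decomp_on_def by (elim exE conjE)
  let ?A = "{q \<in> S. g q \<in> A}" and ?B = "{q \<in> S. g q \<in> B}"
  have "g ` ?A = A" "g ` ?B = B" using AB(3) by auto
  then have "?A \<noteq> {}" "?B \<noteq> {}" using AB(1,2) by (metis image_empty)+
  moreover have "?A \<union> ?B = S" using AB(3) by blast
  moreover have "\<forall>a\<in>?A. \<forall>b\<in>?B. a < b \<and> \<pi> ! a < \<pi> ! b"
  proof (intro ballI)
    fix a b assume ab: "a \<in> ?A" "b \<in> ?B"
    then have lt: "a < length \<pi>" "b < length \<pi>" using S by auto
    have "g a < g b" "\<sigma> ! g a < \<sigma> ! g b" using AB(4) ab by auto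
    then show "a < b \<and> \<pi> ! a < \<pi> ! b" using less_if_g_less[OF lt(1)] order[OF lt] by simp
  qed
  ultimately show "decomp_on \<pi> S" unfolding decomp_on_def by (intro exI[of _ ?A] exI[of _ ?B] conjI)
next
  assume "decomp_on \<pi> S"
  then obtain A B where AB: "A \<noteq> {}" "B \<noteq> {}" "A \<union> B = S"
      "\<forall>a\<in>A. \<forall>b\<in>B. a < b \<and> \<pi> ! a < \<pi> ! b"
    unfolding decomp_on_def by (elim exE conjE)
  have less: "g a < g b \<and> \<sigma> ! g a < \<sigma> ! g b" if "a \<in> A" "b \<in> B" "g a \<noteq> g b" for a b
    using that AB(3,4) S mono[of b a] order[of a b] by (auto simp: le_less subset_iff)
  have "\<exists>i. g ` A \<inter> g ` B \<subseteq> {i}"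
  proof (cases "g ` A \<inter> g ` B = {}")
    case False
    then obtain i where "i \<in> g ` A \<inter> g ` B" by blast
    then obtain a b where i: "i = g a" "i = g b" "a \<in> A" "b \<in> B" by blast
    have "g a' = i" if "a' \<in> A" "b' \<in> B" "g a' = g b'" for a' b'
    proof (rule ccontr)
      assume "g a' \<noteq> i"
      then have "g a < g b'" "g a' < g b" using that i less[of a b'] less[of a' b] by auto
      then show False using that(3) i(1,2) by simp
    qed
    then show ?thesis by (intro exI[of _ i]) blast
  qed auto
  then obtain i where i: "g ` A \<inter> g ` B \<subseteq> {i}" by blast
  have U: "g ` S = g ` A \<union> g ` B" using AB(3) by blast
  \<comment> \<open>A cut of the large permutation may pass through one run; the whole run then goes to
    a side on which another run is present.\<close>
  have split: "decomp_on \<sigma> (g ` S)"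
    if XY: "X \<noteq> {}" "Y \<noteq> {}" "X \<union> Y = g ` S" "X \<subseteq> g ` A" "Y \<subseteq> g ` B" "X \<inter> Y = {}" for X Y
  proof -
    have "\<forall>x\<in>X. \<forall>y\<in>Y. x < y \<and> \<sigma> ! x < \<sigma> ! y"
    proof (intro ballI)
      fix x y assume xy: "x \<in> X" "y \<in> Y"
      obtain a where a: "a \<in> A" "x = g a" using XY(4) xy(1) by auto
      obtain b where b: "b \<in> B" "y = g b" using XY(5) xy(2) by auto
      have "x \<noteq> y" using XY(6) xy by auto
      then show "x < y \<and> \<sigma> ! x < \<sigma> ! y" using less[of a b] a b by simp
    qed
    then show ?thesis using XY(1-3) unfolding decomp_on_def by blast
  qed
  show "decomp_on \<sigma> (g ` S)"
  proof (cases "g ` A \<subseteq> {i}")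
    case False
    then have "g ` A - g ` B \<noteq> {}" using i by blast
    then show ?thesis using AB(2) U by (intro split[of "g ` A - g ` B" "g ` B"]) auto
  next
    case True
    have "g ` B - g ` A \<noteq> {}"
    proof
      assume "g ` B - g ` A = {}"
      then have "g ` S \<subseteq> {i}" using True unfolding U by (intro Un_least) (auto simp only: Diff_eq_empty_iff)
      then have "card (g ` S) \<le> card {i}" by (rule card_mono[rotated]) simp
      then show False using two by simp
    qed
    then show ?thesis using AB(1) U by (intro split[of "g ` A" "g ` B - g ` A"]) auto
  qed
qed

text \<open>
  The position of an entry is the total size of the runs to its left plus its rank within its
  own run; \<open>value_eq\<close> is the analogue for values.  Together they are the defining formula of
  \<open>inflate\<close>.
\<close>

lemma position_eq:
  assumes "q < length \<pi>"
  shows "q = (\<Sum>j<g q. card (fibre j)) + card {r \<in> fibre (g q). r < q}"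
proof -
  have "{..<q} = (\<Union>j<g q. fibre j) \<union> {r \<in> fibre (g q). r < q}"
  proof (intro set_eqI)
    fix r show "r \<in> {..<q} \<longleftrightarrow> r \<in> (\<Union>j<g q. fibre j) \<union> {r \<in> fibre (g q). r < q}"
      using assms mono[of q r] less_if_g_less[of r q]
      by (cases "g r" "g q" rule: linorder_cases) (auto simp: fibre_def)
  qed
  then have "q = card ((\<Union>j<g q. fibre j) \<union> {r \<in> fibre (g q). r < q})" by (metis card_lessThan)
  also have "\<dots> = card (\<Union>j<g q. fibre j) + card {r \<in> fibre (g q). r < q}"
    by (rule card_Un_disjoint) (auto simp: fibre_def)
  also have "card (\<Union>j<g q. fibre j) = (\<Sum>j<g q. card (fibre j))"
    by (rule card_UN_disjoint) (auto simp: fibre_def)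
  finally show ?thesis .
qed

lemma value_eq:
  assumes "q < length \<pi>"
  shows "\<pi> ! q = (\<Sum>j | j < length \<sigma> \<and> \<sigma> ! j < \<sigma> ! g q. card (fibre j))
    + Suc (card {r \<in> fibre (g q). r < q})"
proof -
  have "{r. r < length \<pi> \<and> \<pi> ! r < \<pi> ! q} =
      (\<Union>j\<in>{j. j < length \<sigma> \<and> \<sigma> ! j < \<sigma> ! g q}. fibre j) \<union> {r \<in> fibre (g q). r < q}"
    (is "?L = ?R")
  proof (intro set_eqI)
    fix r show "r \<in> ?L \<longleftrightarrow> r \<in> ?R"
    proof (cases "r < length \<pi> \<and> g r = g q")
      case True
      then show ?thesis using assms run[of q r] run[of r q]
        by (cases r q rule: linorder_cases) (auto simp: fibre_def)
    next
      case False
      then show ?thesis using assms order[of r q] g_less[of r] by (auto simp: fibre_def)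
    qed
  qed
  moreover have "card ?R =
      card (\<Union>j\<in>{j. j < length \<sigma> \<and> \<sigma> ! j < \<sigma> ! g q}. fibre j) + card {r \<in> fibre (g q). r < q}"
    by (rule card_Un_disjoint) (auto simp: fibre_def)
  ultimately have "card ?L =
      card (\<Union>j\<in>{j. j < length \<sigma> \<and> \<sigma> ! j < \<sigma> ! g q}. fibre j) + card {r \<in> fibre (g q). r < q}"
    by simp
  also have "card (\<Union>j\<in>{j. j < length \<sigma> \<and> \<sigma> ! j < \<sigma> ! g q}. fibre j) =
      (\<Sum>j | j < length \<sigma> \<and> \<sigma> ! j < \<sigma> ! g q. card (fibre j))"
    by (rule card_UN_disjoint) (auto simp: fibre_def)
  finally show ?thesis using is_perm_nth_rank[OF perm assms] by simp
qed

text \<open>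
  Since \<open>\<sigma>\<close> is reduced, the fibres of \<open>g\<close> are the maximal runs of \<open>\<pi>\<close>; so \<open>g\<close> is
  determined by \<open>\<pi>\<close>, which gives uniqueness below.
\<close>

lemma succ_in_run_iff:
  assumes red: "reduced \<sigma>" and q: "Suc q < length \<pi>"
  shows "g (Suc q) = g q \<longleftrightarrow> \<pi> ! Suc q = Suc (\<pi> ! q)"
proof
  assume eq: "g (Suc q) = g q"
  then have less: "\<pi> ! q < \<pi> ! Suc q" using run[OF q, of q] by simp
  show "\<pi> ! Suc q = Suc (\<pi> ! q)"
  proof (rule ccontr)
    assume "\<pi> ! Suc q \<noteq> Suc (\<pi> ! q)"
    then have gap: "Suc (\<pi> ! q) < \<pi> ! Suc q" using less by simp
    then obtain r where r: "r < length \<pi>" "\<pi> ! r = Suc (\<pi> ! q)"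
      using is_perm_obtain_position[OF perm, of "Suc (\<pi> ! q)"] is_perm_nth_bounds(2)[OF perm q] by auto
    show False using value_convex(2,3)[of q r "Suc q"] r q gap eq by simp
  qed
next
  assume succ: "\<pi> ! Suc q = Suc (\<pi> ! q)"
  show "g (Suc q) = g q"
  proof (rule ccontr)
    assume ne: "g (Suc q) \<noteq> g q"
    have lt: "q < length \<pi>" using q by simp
    have less: "g q < g (Suc q)" using mono[OF q, of q] ne by simp
    have "g (Suc q) = Suc (g q)"
    proof (rule ccontr)
      assume "g (Suc q) \<noteq> Suc (g q)"
      then have "Suc (g q) < g (Suc q)" using less by simp
      moreover from this obtain r where "r < length \<pi>" "g r = Suc (g q)"
        using obtain_preimage[of "Suc (g q)"] g_less[OF q] by auto
      ultimately show False using less_if_g_less[of q r] less_if_g_less[of r "Suc q"] lt by auto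
    qed
    then have "\<sigma> ! g (Suc q) \<noteq> \<sigma> ! g q + 1" using red g_less[OF q] by (simp add: reduced_def)
    moreover have up: "\<sigma> ! g q < \<sigma> ! g (Suc q)" using order[OF lt q] ne succ by simp
    ultimately have gap: "Suc (\<sigma> ! g q) < \<sigma> ! g (Suc q)" by simp
    then obtain i where i: "i < length \<sigma>" "\<sigma> ! i = Suc (\<sigma> ! g q)"
      using is_perm_obtain_position[OF perm', of "Suc (\<sigma> ! g q)"]
        is_perm_nth_bounds(2)[OF perm' g_less[OF q]] by auto
    obtain r where r: "r < length \<pi>" "g r = i" using obtain_preimage[OF i(1)] .
    have "g q \<noteq> g r" "g r \<noteq> g (Suc q)" using r i gap by auto
    then have "\<pi> ! q < \<pi> ! r" "\<pi> ! r < \<pi> ! Suc q"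
      using order[OF lt r(1)] order[OF r(1) q] r i gap by auto
    then show False using succ by simp
  qed
qed

lemma g_eq_count:
  assumes red: "reduced \<sigma>" and "q < length \<pi>"
  shows "g q = card {r. r < q \<and> \<pi> ! Suc r \<noteq> Suc (\<pi> ! r)}"
  using assms(2)
proof (induction q)
  case 0
  obtain r where r: "r < length \<pi>" "g r = 0"
    using obtain_preimage[of 0] g_less[OF 0] by (metis gr_implies_not0 not_gr_zero)
  have "g 0 \<le> g r" using mono[of r 0] r by (cases r) auto
  then show ?case using r by simp
next
  case (Suc q)
  have IH: "g q = card {r. r < q \<and> \<pi> ! Suc r \<noteq> Suc (\<pi> ! r)}" using Suc by simp
  have step: "g (Suc q) = (if \<pi> ! Suc q = Suc (\<pi> ! q) then g q else Suc (g q))"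
  proof (cases "\<pi> ! Suc q = Suc (\<pi> ! q)")
    case True
    then show ?thesis using succ_in_run_iff[OF red Suc.prems] by simp
  next
    case False
    have less: "g q < g (Suc q)"
      using mono[OF Suc.prems, of q] succ_in_run_iff[OF red Suc.prems] False by simp
    have "\<not> Suc (g q) < g (Suc q)"
    proof
      assume "Suc (g q) < g (Suc q)"
      moreover from this obtain r where "r < length \<pi>" "g r = Suc (g q)"
        using obtain_preimage[of "Suc (g q)"] g_less[OF Suc.prems] by auto
      ultimately show False using less_if_g_less[of q r] less_if_g_less[of r "Suc q"] Suc.prems by auto
    qed
    then show ?thesis using less False by simp
  qed
  have set_eq: "{r. r < Suc q \<and> \<pi> ! Suc r \<noteq> Suc (\<pi> ! r)} =
      (if \<pi> ! Suc q = Suc (\<pi> ! q) then {} else {q}) \<union> {r. r < q \<and> \<pi> ! Suc r \<noteq> Suc (\<pi> ! r)}"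
    by (auto simp: less_Suc_eq)
  show ?case unfolding set_eq step using IH by simp
qed

end

lemma run_collapse_unique:
  assumes "run_collapse g \<pi> \<sigma>" "run_collapse g' \<pi> \<sigma>'" "reduced \<sigma>" "reduced \<sigma>'"
  shows "\<sigma> = \<sigma>'" "\<And>q. q < length \<pi> \<Longrightarrow> g q = g' q"
proof -
  interpret A: run_collapse g \<pi> \<sigma> by fact
  interpret B: run_collapse g' \<pi> \<sigma>' by fact
  show geq: "g q = g' q" if "q < length \<pi>" for q
    using A.g_eq_count[OF assms(3) that] B.g_eq_count[OF assms(4) that] by simp
  then have "g ` {..<length \<pi>} = g' ` {..<length \<pi>}" by (intro image_cong) auto
  then have len: "length \<sigma> = length \<sigma>'" using A.onto B.onto by simp
  show "\<sigma> = \<sigma>'"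
  proof (rule is_perm_eqI[OF A.perm' B.perm' len])
    fix i j assume ij: "i < length \<sigma>" "j < length \<sigma>"
    obtain q where q: "q < length \<pi>" "g q = i" using A.obtain_preimage[OF ij(1)] .
    obtain r where r: "r < length \<pi>" "g r = j" using A.obtain_preimage[OF ij(2)] .
    show "\<sigma> ! i < \<sigma> ! j \<longleftrightarrow> \<sigma>' ! i < \<sigma>' ! j"
      using A.order[OF q(1) r(1)] B.order[OF q(1) r(1)] geq[OF q(1)] geq[OF r(1)] q r
      by (cases "i = j") auto
  qed
qed

lemma nth_concat_map_upt:
  assumes "i < s" "k < length (f i)"
  shows "concat (map f [0..<s]) ! ((\<Sum>j<i. length (f j)) + k) = f i ! k"
  using assms
proof (induction s)
  case (Suc s)
  have len: "length (concat (map f [0..<s])) = (\<Sum>j<s. length (f j))"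
    by (simp add: length_concat sum_list_sum_nth lessThan_atLeast0)
  show ?case
  proof (cases "i = s")
    case True
    then show ?thesis using len by (simp add: nth_append)
  next
    case False
    then have i: "i < s" using Suc.prems by simp
    have "(\<Sum>j<i. length (f j)) + k < (\<Sum>j<Suc i. length (f j))" using Suc.prems by simp
    also have "\<dots> \<le> (\<Sum>j<s. length (f j))" using i by (intro sum_mono2) auto
    finally show ?thesis using Suc.IH[OF i Suc.prems(2)] len by (simp add: nth_append)
  qed
qed simp

lemma length_inflate: "length (inflate \<sigma> b) = (\<Sum>i<length \<sigma>. b i)"
  by (simp add: inflate_def length_concat sum_list_sum_nth lessThan_atLeast0 del: upt_Suc)

lemma inflate_nth:
  assumes "i < length \<sigma>" "k < b i"
  shows "inflate \<sigma> b ! ((\<Sum>j<i. b j) + k) = (\<Sum>j | j < length \<sigma> \<and> \<sigma> ! j < \<sigma> ! i. b j) + Suc k"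
proof -
  let ?f = "\<lambda>i. map (\<lambda>k. (\<Sum>j | j < length \<sigma> \<and> \<sigma> ! j < \<sigma> ! i. b j) + k) [1..<Suc (b i)]"
  have "inflate \<sigma> b ! ((\<Sum>j<i. length (?f j)) + k) = ?f i ! k"
    unfolding inflate_def using assms by (intro nth_concat_map_upt) auto
  then show ?thesis using assms by (simp del: upt_Suc)
qed

lemma (in run_collapse) eq_inflate:
  assumes "\<And>i. i < length \<sigma> \<Longrightarrow> b i = card (fibre i)"
  shows "\<pi> = inflate \<sigma> b"
proof (rule nth_equalityI)
  show "length \<pi> = length (inflate \<sigma> b)" using assms length_eq by (simp add: length_inflate)
  fix q assume q: "q < length \<pi>"
  let ?k = "card {r \<in> fibre (g q). r < q}"
  have "{r \<in> fibre (g q). r < q} \<subset> fibre (g q)" using q by (auto simp: fibre_def)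
  then have k: "?k < b (g q)" using assms[OF g_less[OF q]] by (simp add: psubset_card_mono)
  have "q = (\<Sum>j<g q. b j) + ?k"
    using position_eq[OF q] assms g_less[OF q] by simp
  moreover have "\<pi> ! q = (\<Sum>j | j < length \<sigma> \<and> \<sigma> ! j < \<sigma> ! g q. b j) + Suc ?k"
    using value_eq[OF q] assms by simp
  ultimately show "\<pi> ! q = inflate \<sigma> b ! q"
    using inflate_nth[of "g q" \<sigma> ?k b] g_less[OF q] k by simp
qed

lemma obtain_run_position:
  fixes b :: "nat \<Rightarrow> nat"
  assumes "q < (\<Sum>i<s. b i)"
  obtains i k where "i < s" "k < b i" "q = (\<Sum>j<i. b j) + k"
proof -
  have "\<exists>i<s. \<exists>k<b i. q = (\<Sum>j<i. b j) + k"
    using assms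
  proof (induction s)
    case (Suc s)
    show ?case
    proof (cases "q < (\<Sum>i<s. b i)")
      case True
      then show ?thesis using Suc.IH less_SucI by blast
    next
      case False
      then show ?thesis using Suc.prems
        by (intro exI[of _ s] conjI exI[of _ "q - (\<Sum>i<s. b i)"]) auto
    qed
  qed simp
  then show ?thesis using that by blast
qed

text \<open>
  The runs, sorted by a key, occupy consecutive intervals.  With the position as key this compares
  positions in an inflation, with \<open>\<sigma> ! i\<close> as key it compares values.
\<close>

lemma offset_less:
  fixes key b :: "nat \<Rightarrow> nat"
  assumes "i < s" "key i < key i'" "k < b i"
  shows "(\<Sum>j | j < s \<and> key j < key i. b j) + k < (\<Sum>j | j < s \<and> key j < key i'. b j) + k'"
proof -
  have "(\<Sum>j | j < s \<and> key j < key i. b j) + b i = (\<Sum>j\<in>insert i {j. j < s \<and> key j < key i}. b j)"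
    by simp
  also have "\<dots> \<le> (\<Sum>j | j < s \<and> key j < key i'. b j)"
    using assms by (intro sum_mono2) auto
  finally show ?thesis using assms(3) by simp
qed

lemma inflate_collapse:
  assumes perm: "is_perm \<sigma>" and pos: "\<And>i. i < length \<sigma> \<Longrightarrow> 1 \<le> b i"
  obtains g where "run_collapse g (inflate \<sigma> b) \<sigma>"
    "\<And>i. i < length \<sigma> \<Longrightarrow> card {q. q < length (inflate \<sigma> b) \<and> g q = i} = b i"
proof -
  let ?s = "length \<sigma>" and ?\<pi> = "inflate \<sigma> b"
  let ?off = "\<lambda>i. \<Sum>j<i. b j"
  let ?voff = "\<lambda>i. \<Sum>j | j < ?s \<and> \<sigma> ! j < \<sigma> ! i. b j"
  have off_less: "?off i + k < ?off i' + k'" if "i < i'" "i' < ?s" "k < b i" for i i' k k'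
  proof -
    have "{j. j < ?s \<and> j < i} = {..<i}" "{j. j < ?s \<and> j < i'} = {..<i'}" using that by auto
    then show ?thesis using offset_less[of i ?s "\<lambda>j. j" i' k b k'] that by simp
  qed
  have voff_less: "?voff i + k < ?voff i' + k'" if "\<sigma> ! i < \<sigma> ! i'" "i < ?s" "k < b i" for i i' k k'
    using offset_less[of i ?s "(!) \<sigma>" i' k b k'] that by simp
  have "\<forall>q. \<exists>i. q < length ?\<pi> \<longrightarrow> i < ?s \<and> (\<exists>k<b i. q = ?off i + k)"
    using obtain_run_position[of _ b ?s] unfolding length_inflate by metis
  then obtain g where g: "\<And>q. q < length ?\<pi> \<Longrightarrow> g q < ?s \<and> (\<exists>k<b (g q). q = ?off (g q) + k)"
    by metis
  define kk where "kk q = q - ?off (g q)" for q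
  have k: "kk q < b (g q)" "q = ?off (g q) + kk q" "?\<pi> ! q = ?voff (g q) + Suc (kk q)"
    if q: "q < length ?\<pi>" for q
  proof -
    obtain k where k: "k < b (g q)" "q = ?off (g q) + k"
      using g[OF q] by blast
    then have "kk q = k" unfolding kk_def by simp
    then show "kk q < b (g q)" "q = ?off (g q) + kk q" "?\<pi> ! q = ?voff (g q) + Suc (kk q)"
      using k inflate_nth[of "g q" \<sigma> k b] g[OF q] by auto
  qed
  have lenle: "?off i + k < length ?\<pi>" if "i < ?s" "k < b i" for i k
  proof -
    have "?off i + k < ?off (Suc i)" using that by simp
    also have "\<dots> \<le> length ?\<pi>" unfolding length_inflate using that by (intro sum_mono2) auto
    finally show ?thesis .
  qed
  have geq: "g (?off i + k) = i" if "i < ?s" "k < b i" for i k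
  proof -
    let ?q = "?off i + k"
    have q: "?q < length ?\<pi>" using lenle that by simp
    have gs: "g ?q < ?s" using g[OF q] by simp
    show ?thesis
    proof (cases "g ?q" i rule: linorder_cases)
      case less
      then show ?thesis using off_less[of "g ?q" i "kk ?q" k] k(1,2)[OF q] that by simp
    next
      case greater
      then show ?thesis using off_less[of i "g ?q" k "kk ?q"] k(1,2)[OF q] that gs by simp
    qed
  qed
  have value_less: "?\<pi> ! q < ?\<pi> ! r" if "q < length ?\<pi>" "r < length ?\<pi>" "\<sigma> ! g q < \<sigma> ! g r" for q r
    using voff_less[of "g q" "g r" "kk q" "kk r"] k(3)[OF that(1)] k(3)[OF that(2)] k(1)[OF that(1)]
      g[OF that(1)] that(3) by simp
  have ord: "?\<pi> ! q < ?\<pi> ! r \<longleftrightarrow> \<sigma> ! g q < \<sigma> ! g r"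
    if "q < length ?\<pi>" "r < length ?\<pi>" "g q \<noteq> g r" for q r
    using value_less[OF that(1,2)] value_less[OF that(2,1)] that g[OF that(1)] g[OF that(2)]
      is_perm_nth_eq_iff[OF perm, of "g q" "g r"]
    by (cases "\<sigma> ! g q" "\<sigma> ! g r" rule: linorder_cases) auto
  have in_run: "?\<pi> ! q < ?\<pi> ! r" if "r < length ?\<pi>" "q < r" "g q = g r" for q r
  proof -
    have "kk q < kk r" using k(2)[of q] k(2)[of r] that by simp
    then show ?thesis using k(3)[of q] k(3)[of r] that by simp
  qed
  have gmono: "g q \<le> g r" if "r < length ?\<pi>" "q < r" for q r
    using off_less[of "g r" "g q" "kk r" "kk q"] k(1,2)[of q] k(1,2)[of r] g[of q] that
    by (cases "g q \<le> g r") auto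
  have dist: "distinct ?\<pi>"
    unfolding distinct_conv_nth
  proof (intro allI impI)
    fix q r assume h: "q < length ?\<pi>" "r < length ?\<pi>" "q \<noteq> r"
    show "?\<pi> ! q \<noteq> ?\<pi> ! r"
    proof (cases "g q = g r")
      case True
      then show ?thesis using in_run[of q r] in_run[of r q] h by (cases q r rule: linorder_cases) auto
    next
      case False
      then show ?thesis
        using value_less[OF h(1,2)] value_less[OF h(2,1)] g[OF h(1)] g[OF h(2)]
          is_perm_nth_eq_iff[OF perm, of "g q" "g r"]
        by (cases "\<sigma> ! g q" "\<sigma> ! g r" rule: linorder_cases) auto
    qed
  qed
  have "?\<pi> ! q \<in> {1..length ?\<pi>}" if q: "q < length ?\<pi>" for q
  proof -
    have "?voff (g q) + b (g q) = (\<Sum>j\<in>insert (g q) {j. j < ?s \<and> \<sigma> ! j < \<sigma> ! g q}. b j)" by simp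
    also have "\<dots> \<le> length ?\<pi>" unfolding length_inflate using g[OF q] by (intro sum_mono2) auto
    finally show ?thesis using k(1,3)[OF q] by simp
  qed
  then have "set ?\<pi> \<subseteq> {1..length ?\<pi>}" by (auto simp: in_set_conv_nth)
  then have perm_infl: "is_perm ?\<pi>"
    using dist by (intro is_permI card_subset_eq) (auto simp: distinct_card)
  have "g ` {..<length ?\<pi>} = {..<?s}"
  proof (intro equalityI subsetI)
    fix i assume "i \<in> {..<?s}"
    then have "g (?off i + 0) = i" "?off i + 0 < length ?\<pi>"
      using geq[of i 0] lenle[of i 0] pos[of i] by auto
    then show "i \<in> g ` {..<length ?\<pi>}" by (metis imageI lessThan_iff)
  qed (use g in auto)
  then have col: "run_collapse g ?\<pi> \<sigma>"
    using perm perm_infl gmono ord in_run by unfold_locales auto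
  have "card {q. q < length ?\<pi> \<and> g q = i} = b i" if i: "i < ?s" for i
  proof -
    have "{q. q < length ?\<pi> \<and> g q = i} = (\<lambda>k. ?off i + k) ` {..<b i}"
      (is "?L = ?R")
    proof (intro equalityI subsetI)
      fix q assume "q \<in> ?L"
      then show "q \<in> ?R" using k(1,2)[of q] by (intro image_eqI[of _ _ "kk q"]) auto
    qed (use geq[OF i] lenle[OF i] in auto)
    then show ?thesis by (simp add: card_image)
  qed
  with col show ?thesis by (rule that)
qed

text \<open>
  The runs of \<open>\<pi>\<close> are numbered by counting the breaks to the left of a position, and
  \<open>\<sigma>\<close> is the standardization of their first entries.
\<close>

lemma obtain_reduced_collapse:
  assumes perm: "is_perm \<pi>"
  obtains g \<sigma> where "run_collapse g \<pi> \<sigma>" "reduced \<sigma>"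
proof -
  define g where "g q = card {r. r < q \<and> \<pi> ! Suc r \<noteq> Suc (\<pi> ! r)}" for q
  define n where "n = length \<pi>"
  define s where "s = (if n = 0 then 0 else Suc (g (n - 1)))"
  define st where "st i = (LEAST q. g q = i)" for i
  define \<sigma> where "\<sigma> = standardize (map (\<lambda>i. \<pi> ! st i) [0..<s])"
  have g0: "g 0 = 0" by (simp add: g_def)
  have gSuc: "g (Suc q) = (if \<pi> ! Suc q = Suc (\<pi> ! q) then g q else Suc (g q))" for q
  proof -
    have "{r. r < Suc q \<and> \<pi> ! Suc r \<noteq> Suc (\<pi> ! r)} =
      (if \<pi> ! Suc q = Suc (\<pi> ! q) then {} else {q}) \<union> {r. r < q \<and> \<pi> ! Suc r \<noteq> Suc (\<pi> ! r)}"
      by (auto simp: less_Suc_eq)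
    then show ?thesis unfolding g_def by simp
  qed
  have mono: "g q \<le> g r" if "q \<le> r" for q r
    using that by (induction r rule: dec_induct) (auto simp: gSuc)
  have ex: "\<exists>q. q < n \<and> g q = i" if "i < s" for i
  proof -
    have "i \<le> g m \<Longrightarrow> \<exists>q\<le>m. g q = i" for m
      by (induction m) (auto simp: g0 gSuc le_Suc_eq split: if_splits)
    from this[of "n - 1"] that obtain q where "q \<le> n - 1" "g q = i" "n \<noteq> 0"
      by (auto simp: s_def split: if_splits)
    then show ?thesis by (intro exI[of _ q]) auto
  qed
  have st: "st i < n" "g (st i) = i" if i: "i < s" for i
  proof -
    obtain q where q: "q < n" "g q = i" using ex[OF i] by blast
    show "g (st i) = i" unfolding st_def by (rule LeastI[of _ q]) (rule q)
    show "st i < n" using Least_le[of "\<lambda>q. g q = i" q] q unfolding st_def by simp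
  qed
  have stle: "st (g q) \<le> q" for q unfolding st_def by (rule Least_le) simp
  have gs: "g q < s" if "q < n" for q
  proof -
    have "g q \<le> g (n - 1)" by (rule mono) (use that in simp)
    then show ?thesis using that by (simp add: s_def)
  qed
  have gst: "g (st (g q)) = g q" if "q < n" for q using st gs that by blast
  have inj: "\<pi> ! q = \<pi> ! r \<longleftrightarrow> q = r" if "q < n" "r < n" for q r
    using is_perm_nth_eq_iff[OF perm] that by (simp add: n_def)
  have same_run: "\<pi> ! r = \<pi> ! q + (r - q)" if "q \<le> r" "g q = g r" for q r
    using that
  proof (induction r rule: dec_induct)
    case (step r)
    have gr: "g r = g q" using mono[of q r] mono[of r "Suc r"] step by simp
    have "\<pi> ! Suc r = Suc (\<pi> ! r)"
      using gSuc[of r] gr step.prems by (metis n_not_Suc_n)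
    then show ?case using step.IH[OF gr[symmetric]] step.hyps by simp
  qed simp
  have cmp: "\<pi> ! q < \<pi> ! t \<longleftrightarrow> \<pi> ! r < \<pi> ! t"
    if "q \<le> r" "g q = g r" "r < n" "t < n" "g t \<noteq> g q" for q r t
    using that
  proof (induction r rule: dec_induct)
    case (step r)
    have gr: "g r = g q" using mono[of q r] mono[of r "Suc r"] step by simp
    then have "\<pi> ! Suc r = Suc (\<pi> ! r)" using gSuc[of r] step.prems(1) by (metis n_not_Suc_n)
    moreover have "\<pi> ! t \<noteq> \<pi> ! Suc r" using inj[of t "Suc r"] step.prems by auto
    ultimately have "\<pi> ! r < \<pi> ! t \<longleftrightarrow> \<pi> ! Suc r < \<pi> ! t" by auto
    then show ?case using step.IH gr step.prems by simp
  qed simp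
  have ord: "\<pi> ! q < \<pi> ! r \<longleftrightarrow> \<pi> ! st (g q) < \<pi> ! st (g r)" if "q < n" "r < n" "g q \<noteq> g r" for q r
  proof -
    have 1: "\<pi> ! st (g q) < \<pi> ! r \<longleftrightarrow> \<pi> ! q < \<pi> ! r"
      using cmp[of "st (g q)" q r] stle gst that by simp
    have 2: "\<pi> ! st (g r) < \<pi> ! st (g q) \<longleftrightarrow> \<pi> ! r < \<pi> ! st (g q)"
      using cmp[of "st (g r)" r "st (g q)"] stle gst that st(1)[OF gs] by simp
    have "st (g q) \<noteq> r" "st (g r) \<noteq> st (g q)" using gst that by metis+
    then show ?thesis using 1 2 inj[of "st (g q)" r] inj[of "st (g r)" "st (g q)"] st(1)[OF gs] that
      by (metis linorder_neq_iff less_asym)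
  qed
  have "distinct (map (\<lambda>i. \<pi> ! st i) [0..<s])"
    using inj st by (auto simp: distinct_map inj_on_def) metis
  then have perm': "is_perm \<sigma>" unfolding \<sigma>_def by (rule is_perm_standardize)
  have len: "length \<sigma> = s" by (simp add: \<sigma>_def)
  have \<sigma>less: "\<sigma> ! i < \<sigma> ! j \<longleftrightarrow> \<pi> ! st i < \<pi> ! st j" if "i < s" "j < s" for i j
    using standardize_nth_less_iff[of i "map (\<lambda>i. \<pi> ! st i) [0..<s]" j] that by (simp add: \<sigma>_def)
  have "g ` {..<n} = {..<s}" using ex gs by (auto simp: image_iff)
  then have col: "run_collapse g \<pi> \<sigma>"
  proof unfold_locales
    show "\<pi> ! q < \<pi> ! r" if "r < length \<pi>" "q < r" "g q = g r" for q r
      using same_run[of q r] that by simp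
    show "\<pi> ! q < \<pi> ! r \<longleftrightarrow> \<sigma> ! g q < \<sigma> ! g r" if "q < length \<pi>" "r < length \<pi>" "g q \<noteq> g r" for q r
      using ord \<sigma>less gs that by (simp add: n_def)
  qed (use perm perm' mono len n_def in auto)
  interpret run_collapse g \<pi> \<sigma> by (fact col)
  have "reduced \<sigma>"
    unfolding reduced_def
  proof (intro allI impI notI)
    fix i assume i: "Suc i < length \<sigma>" "\<sigma> ! Suc i = \<sigma> ! i + 1"
    have si: "Suc i < s" "i < s" using i len by auto
    define t where "t = st (Suc i)"
    have t: "t < n" "g t = Suc i" using st[OF si(1)] by (auto simp: t_def)
    then obtain q where q: "t = Suc q" using g0 by (cases t) auto
    have "g q \<noteq> Suc i" using stle[of q] q unfolding t_def by (metis Suc_n_not_le_n)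
    then have gq: "g q = i" "\<pi> ! t \<noteq> Suc (\<pi> ! q)" using gSuc[of q] t(2) q by (auto split: if_splits)
    have qn: "q < length \<pi>" "t < length \<pi>" using q t(1) n_def by auto
    have "\<pi> ! q < \<pi> ! t" using order[of q t] qn gq t(2) i by simp
    then have gap: "Suc (\<pi> ! q) < \<pi> ! t" using gq(2) by simp
    then obtain r where r: "r < length \<pi>" "\<pi> ! r = Suc (\<pi> ! q)"
      using is_perm_obtain_position[OF perm, of "Suc (\<pi> ! q)"] is_perm_nth_bounds(2)[OF perm qn(2)] by auto
    consider "g r = i" | "g r = Suc i" | "g r \<noteq> i" "g r \<noteq> Suc i" by blast
    then show False
    proof cases
      case 1
      then have "r < t" using less_if_g_less[of r t] r t(2) by simp
      then have "r \<le> q" using q by simp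
      then show False using same_run[of r q] 1 gq(1) r(2) by simp
    next
      case 2
      then have "q < r" using less_if_g_less[of q r] qn gq(1) by simp
      then have "t \<le> r" using q by simp
      then show False using same_run[of t r] 2 t(2) r(2) gap by simp
    next
      case 3
      then have "\<sigma> ! i < \<sigma> ! g r" "\<sigma> ! g r < \<sigma> ! Suc i"
        using order[of q r] order[of r t] qn r gap gq(1) t(2) by auto
      then show False using i(2) by simp
    qed
  qed
  with col show ?thesis by (rule that)
qed

section \<open>The inversion graph and the minimal inflation\<close>

lemma nbrs_iff: "j \<in> nbrs \<sigma> i \<longleftrightarrow>
    (i < j \<and> j < length \<sigma> \<and> \<sigma> ! j < \<sigma> ! i) \<or> (j < i \<and> i < length \<sigma> \<and> \<sigma> ! i < \<sigma> ! j)"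
  by (auto simp: nbrs_def Inv_def)

lemma nbrs_sym: "j \<in> nbrs \<sigma> i \<longleftrightarrow> i \<in> nbrs \<sigma> j"
  by (auto simp: nbrs_def)

lemma nbrs_subset: "nbrs \<sigma> i \<subseteq> {..<length \<sigma>}"
  by (auto simp: nbrs_iff)

lemma nbrs_irrefl: "i \<notin> nbrs \<sigma> i"
  by (auto simp: nbrs_iff)

lemma finite_nbrs [simp]: "finite (nbrs \<sigma> i)"
  using nbrs_subset finite_lessThan by (rule finite_subset)

text \<open>
  Every edge of the inversion graph is met once from each of its two ends.
\<close>

lemma sum_nbrs_eq_sum_Inv:
  fixes f :: "nat \<Rightarrow> nat \<Rightarrow> 'a :: comm_monoid_add"
  shows "(\<Sum>i<length \<sigma>. \<Sum>j\<in>nbrs \<sigma> i. f i j) = (\<Sum>(i, j)\<in>Inv \<sigma>. f i j + f j i)"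
proof -
  have "(\<Sum>i<length \<sigma>. \<Sum>j\<in>nbrs \<sigma> i. f i j) = (\<Sum>(i, j)\<in>Sigma {..<length \<sigma>} (nbrs \<sigma>). f i j)"
    by (rule sum.Sigma) auto
  also have "Sigma {..<length \<sigma>} (nbrs \<sigma>) = Inv \<sigma> \<union> prod.swap ` Inv \<sigma>"
    by (auto simp: nbrs_def Inv_def image_iff)
  also have "(\<Sum>(i, j)\<in>Inv \<sigma> \<union> prod.swap ` Inv \<sigma>. f i j) =
      (\<Sum>(i, j)\<in>Inv \<sigma>. f i j) + (\<Sum>(i, j)\<in>prod.swap ` Inv \<sigma>. f i j)"
    by (rule sum.union_disjoint) (simp, simp, auto simp: Inv_def)
  also have "(\<Sum>(i, j)\<in>prod.swap ` Inv \<sigma>. f i j) = (\<Sum>(i, j)\<in>Inv \<sigma>. f j i)"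
    by (subst sum.reindex) (auto intro!: sum.cong)
  finally show ?thesis by (simp add: sum.distrib[symmetric] case_prod_unfold)
qed

text \<open>
  An isolated position splits the others into those to the lower left and those to the upper
  right of it.
\<close>

lemma decomp_on_if_isolated:
  assumes "is_perm \<sigma>" "S \<subseteq> {..<length \<sigma>}" "i \<in> S" "S \<noteq> {i}" "nbrs \<sigma> i \<inter> S = {}"
  shows "decomp_on \<sigma> S"
proof -
  have up: "\<sigma> ! k < \<sigma> ! i" if k: "k \<in> S" "k < i" for k
  proof -
    have "k \<notin> nbrs \<sigma> i" "k < length \<sigma>" "i < length \<sigma>" using k assms(2,3,5) by auto
    then show ?thesis using k(2) is_perm_nth_eq_iff[OF assms(1), of k i] by (simp add: nbrs_iff)
  qed
  have down: "\<sigma> ! i < \<sigma> ! k" if k: "k \<in> S" "i < k" for k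
  proof -
    have "k \<notin> nbrs \<sigma> i" "k < length \<sigma>" "i < length \<sigma>" using k assms(2,3,5) by auto
    then show ?thesis using k(2) is_perm_nth_eq_iff[OF assms(1), of k i] by (simp add: nbrs_iff)
  qed
  let ?A = "{k \<in> S. k < i}" and ?B = "{k \<in> S. i < k}"
  show ?thesis
  proof (cases "?A = {}")
    case False
    have "\<forall>a\<in>?A. \<forall>b\<in>insert i ?B. a < b \<and> \<sigma> ! a < \<sigma> ! b"
    proof (intro ballI)
      fix a b assume ab: "a \<in> ?A" "b \<in> insert i ?B"
      then have "\<sigma> ! a < \<sigma> ! i" "b = i \<or> \<sigma> ! i < \<sigma> ! b" using up down by auto
      then show "a < b \<and> \<sigma> ! a < \<sigma> ! b" using ab by auto
    qed
    moreover have "?A \<union> insert i ?B = S" using assms(3) by auto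
    ultimately show ?thesis unfolding decomp_on_def using False
      by (intro exI[of _ ?A] exI[of _ "insert i ?B"] conjI) (assumption | rule insert_not_empty)+
  next
    case True
    have "?B \<noteq> {}"
    proof
      assume B: "?B = {}"
      have "S \<subseteq> {i}"
      proof
        fix k assume "k \<in> S"
        then have "k \<notin> ?A \<Longrightarrow> k \<notin> ?B \<Longrightarrow> k = i" by simp
        then show "k \<in> {i}" using True B by simp
      qed
      then show False using assms(3,4) by blast
    qed
    moreover have "\<forall>a\<in>{i}. \<forall>b\<in>?B. a < b \<and> \<sigma> ! a < \<sigma> ! b" using down by auto
    moreover have "{i} \<union> ?B = S" using assms(3) True by auto
    ultimately show ?thesis unfolding decomp_on_def
      by (intro exI[of _ "{i}"] exI[of _ ?B] conjI) (assumption | rule insert_not_empty)+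
  qed
qed

definition indecomposable_avoider :: "nat list \<Rightarrow> bool" where
  "indecomposable_avoider \<sigma> \<longleftrightarrow>
     is_perm \<sigma> \<and> 2 \<le> length \<sigma> \<and> indecomposable \<sigma> \<and> avoids_1324 \<sigma>"

lemma I_set_eq:
  assumes "is_perm \<pi>" "0 < length \<pi>"
    and "qm < length \<pi>" "\<pi> ! qm = 1" "qM < length \<pi>" "\<pi> ! qM = length \<pi>"
  shows "I_set \<pi> = {0, length \<pi> - 1, qm, qM}"
proof -
  have "\<pi> ! i = 1 \<longleftrightarrow> i = qm" "\<pi> ! i = length \<pi> \<longleftrightarrow> i = qM" if "i < length \<pi>" for i
    using is_perm_nth_eq_iff[OF assms(1) that assms(3)] is_perm_nth_eq_iff[OF assms(1) that assms(5)]
      assms(4,6) by simp_all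
  then show ?thesis using assms(2-) unfolding I_set_def by auto
qed

lemma D_set_iff:
  assumes "is_perm \<sigma>"
  shows "i \<in> D_set \<sigma> \<longleftrightarrow> i \<in> I_set \<sigma> \<and> (decomp_on \<sigma> ({..<length \<sigma>} - {i}) \<or> length \<sigma> = 2)"
  using decomposable_del_entry_iff[OF assms, of i] by (auto simp: D_set_def I_set_def)

lemma ell_pos: "1 \<le> ell \<sigma> i" and ell_le_2: "ell \<sigma> i \<le> 2"
  by (simp_all add: ell_def)

lemma nbrs_nonempty:
  assumes "indecomposable_avoider \<sigma>" "i < length \<sigma>"
  shows "nbrs \<sigma> i \<noteq> {}"
proof
  assume "nbrs \<sigma> i = {}"
  moreover have "{..<length \<sigma>} \<noteq> {i}"
  proof
    assume "{..<length \<sigma>} = {i}"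
    then have "card {..<length \<sigma>} = 1" by simp
    then show False using assms(1) by (simp add: indecomposable_avoider_def)
  qed
  ultimately have "decomp_on \<sigma> {..<length \<sigma>}"
    using assms by (intro decomp_on_if_isolated[of _ _ i]) (auto simp: indecomposable_avoider_def)
  then show False
    using assms(1) decomposable_iff_decomp_on by (auto simp: indecomposable_avoider_def)
qed

lemma avoidsD:
  assumes "avoids_1324 \<sigma>" "a < b" "b < c" "c < d" "d < length \<sigma>"
    "\<sigma> ! a < \<sigma> ! c" "\<sigma> ! c < \<sigma> ! b" "\<sigma> ! b < \<sigma> ! d"
  shows False
  using assms unfolding avoids_1324_def by blast

text \<open>
  Let \<open>j\<close> be the only neighbour of \<open>i\<close>.  All other entries lie to the lower left or to the
  upper right of \<open>i\<close>, so if \<open>j\<close> is not extreme then there is an entry to the lower left of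
  both and one to the upper right of both, which complete \<open>i, j\<close> to a 1324.  Deleting \<open>j\<close>
  isolates \<open>i\<close>.
\<close>

lemma sole_nbr_in_D_set:
  assumes iav: "indecomposable_avoider \<sigma>" and i: "i < length \<sigma>" and N: "nbrs \<sigma> i = {j}"
  shows "j \<in> D_set \<sigma>"
proof -
  let ?s = "length \<sigma>"
  have perm: "is_perm \<sigma>" and av: "avoids_1324 \<sigma>" and s2: "2 \<le> ?s"
    using iav by (auto simp: indecomposable_avoider_def)
  have j: "j < ?s" "j \<noteq> i" using N nbrs_subset nbrs_irrefl by blast+
  have other: "k < i \<longleftrightarrow> \<sigma> ! k < \<sigma> ! i" if "k < ?s" "k \<noteq> j" for k
  proof -
    have "k \<notin> nbrs \<sigma> i" using N that by blast
    then show ?thesis using that(1) i is_perm_nth_eq_iff[OF perm that(1) i]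
      by (cases k i rule: linorder_cases) (auto simp: nbrs_iff)
  qed
  obtain m where m: "m < ?s" "\<sigma> ! m = 1" using is_perm_obtain_position[OF perm, of 1] s2 by auto
  obtain M where M: "M < ?s" "\<sigma> ! M = ?s" using is_perm_obtain_position[OF perm, of ?s] s2 by auto
  have jI: "j \<in> I_set \<sigma>"
  proof (rule ccontr)
    assume "j \<notin> I_set \<sigma>"
    then have h: "0 \<noteq> j" "?s - 1 \<noteq> j" "m \<noteq> j" "M \<noteq> j" using j m M by (auto simp: I_set_def)
    have min: "\<sigma> ! m < \<sigma> ! j"
      using is_perm_nth_bounds(1)[OF perm j(1)] is_perm_nth_eq_iff[OF perm m(1) j(1)] h m(2) by auto
    have max: "\<sigma> ! j < \<sigma> ! M"
      using is_perm_nth_bounds(2)[OF perm j(1)] is_perm_nth_eq_iff[OF perm M(1) j(1)] h M(2) by auto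
    have "j \<in> nbrs \<sigma> i" using N by simp
    then consider "j < i" "\<sigma> ! i < \<sigma> ! j" | "i < j" "\<sigma> ! j < \<sigma> ! i" by (auto simp: nbrs_iff)
    then show False
    proof cases
      case 1
      have "0 < j" using h by simp
      moreover have "\<sigma> ! 0 < \<sigma> ! i" using other[of 0] 1 h j by force
      moreover have "i < M"
      proof -
        have "\<sigma> ! i < \<sigma> ! M" using 1(2) max by simp
        then show ?thesis using other[OF M(1)] h(4) by (cases i M rule: linorder_cases) auto
      qed
      ultimately show False using avoidsD[OF av, of 0 j i M] 1 M max by simp
    next
      case 2
      have "j < ?s - 1" using h j by simp
      moreover have "\<sigma> ! i < \<sigma> ! (?s - 1)"
        using other[of "?s - 1"] 2 h j is_perm_nth_eq_iff[OF perm i, of "?s - 1"] by force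
      moreover have "m < i"
      proof -
        have "\<sigma> ! m < \<sigma> ! i" using 2(2) min by simp
        then show ?thesis using other[OF m(1)] h(3) by simp
      qed
      ultimately show False using avoidsD[OF av, of m i j "?s - 1"] 2 min diff_less[of 1 ?s] s2 by linarith
    qed
  qed
  moreover have "decomp_on \<sigma> ({..<?s} - {j})" if "?s \<noteq> 2"
  proof (rule decomp_on_if_isolated[OF perm, of _ i])
    show "{..<?s} - {j} \<noteq> {i}"
    proof
      assume "{..<?s} - {j} = {i}"
      then have "card ({..<?s} - {j}) = 1" by simp
      then show False using that s2 j(1) by simp
    qed
  qed (use i j N in auto)
  ultimately show ?thesis using D_set_iff[OF perm] by blast
qed

text \<open>
  The weights \<open>\<ell>\<close> are made for this: a position with a single neighbour sees weight 2
  there.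
\<close>

lemma a_coeff_nonneg:
  assumes iav: "indecomposable_avoider \<sigma>" and i: "i < length \<sigma>"
  shows "0 \<le> a_coeff \<sigma> i"
proof -
  have "2 \<le> (\<Sum>j\<in>nbrs \<sigma> i. ell \<sigma> j)"
  proof (cases "card (nbrs \<sigma> i) = 1")
    case True
    then obtain j where "nbrs \<sigma> i = {j}" by (auto simp: card_1_singleton_iff)
    then show ?thesis using sole_nbr_in_D_set[OF iav i] by (simp add: ell_def)
  next
    case False
    then have "2 \<le> card (nbrs \<sigma> i)" using nbrs_nonempty[OF iav i]
      by (metis One_nat_def Suc_1 Suc_leI card_gt_0_iff finite_nbrs le_neq_implies_less)
    also have "\<dots> \<le> (\<Sum>j\<in>nbrs \<sigma> i. ell \<sigma> j)"
      using sum_mono[of "nbrs \<sigma> i" "\<lambda>_. 1" "ell \<sigma>"] ell_pos by simp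
    finally show ?thesis .
  qed
  then show ?thesis unfolding a_coeff_def by (simp flip: of_nat_sum)
qed

context run_collapse
begin

lemma decomposable_if_one_run:
  assumes "S \<subseteq> fibre i" "2 \<le> card S"
  shows "decomp_on \<pi> S"
proof -
  have fin: "finite S" by (rule finite_subset[OF assms(1)]) simp
  have ne: "S \<noteq> {}" using assms(2) by auto
  let ?m = "Min S"
  have m: "?m \<in> S" "\<And>x. x \<in> S \<Longrightarrow> ?m \<le> x" using fin ne by auto
  have "S - {?m} \<noteq> {}"
  proof
    assume "S - {?m} = {}"
    then have "S = {?m}" using ne by blast
    then have "card S = 1" by (metis is_singletonI is_singleton_altdef)
    then show False using assms(2) by simp
  qed
  moreover have "\<forall>a\<in>{?m}. \<forall>b\<in>S - {?m}. a < b \<and> \<pi> ! a < \<pi> ! b"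
  proof (intro ballI)
    fix a b assume ab: "a \<in> {?m}" "b \<in> S - {?m}"
    then have "a < b" using m(2)[of b] by auto
    moreover have "b < length \<pi>" "g a = g b" using ab m(1) assms(1) by (auto simp: fibre_def)
    ultimately show "a < b \<and> \<pi> ! a < \<pi> ! b" using run by simp
  qed
  ultimately show ?thesis unfolding decomp_on_def using m(1)
    by (intro exI[of _ "{?m}"] exI[of _ "S - {?m}"]) auto
qed

lemma decomposable_iff:
  assumes "2 \<le> length \<pi>"
  shows "decomposable \<pi> \<longleftrightarrow> decomposable \<sigma> \<or> length \<sigma> < 2"
proof (cases "2 \<le> length \<sigma>")
  case True
  then show ?thesis
    using decomp_on_iff[of "{..<length \<pi>}"] onto decomposable_iff_decomp_on[OF perm]
      decomposable_iff_decomp_on[OF perm'] by simp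
next
  case False
  have "{..<length \<pi>} \<subseteq> fibre 0" using False g_less by (fastforce simp: fibre_def)
  then have "decomp_on \<pi> {..<length \<pi>}" using assms by (intro decomposable_if_one_run) auto
  then show ?thesis using False decomposable_iff_decomp_on[OF perm] by simp
qed

text \<open>
  If the run of \<open>q\<close> has another entry, deleting \<open>q\<close> leaves all runs present.  Otherwise it
  deletes the position \<open>g q\<close> from \<open>\<sigma>\<close>.  For \<open>\<sigma> = 21\<close> a single run of length at
  least 2 remains, which is decomposable; this is why \<open>D_set\<close> treats length 2 separately.
\<close>

lemma decomposable_del_entry_iff_run:
  assumes n: "3 \<le> length \<pi>" and s: "2 \<le> length \<sigma>" and ind: "indecomposable \<sigma>"
    and q: "q < length \<pi>" and qI: "g q \<in> I_set \<sigma>"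
  shows "decomposable (del_entry \<pi> (\<pi> ! q)) \<longleftrightarrow> card (fibre (g q)) = 1 \<and> g q \<in> D_set \<sigma>"
proof -
  let ?S = "{..<length \<pi>} - {q}"
  have eq: "decomposable (del_entry \<pi> (\<pi> ! q)) \<longleftrightarrow> decomp_on \<pi> ?S"
    by (rule decomposable_del_entry_iff[OF perm q])
  have qf: "q \<in> fibre (g q)" using q by (simp add: fibre_def)
  show ?thesis
  proof (cases "card (fibre (g q)) = 1")
    case False
    have "g ` ?S = {..<length \<sigma>}"
    proof -
      have "fibre (g q) \<noteq> {q}" using False by auto
      then obtain r where "r \<in> fibre (g q)" "r \<noteq> q" using qf by blast
      then have "r \<in> ?S" "g r = g q" by (auto simp: fibre_def)
      then have "g q \<in> g ` ?S" by (metis imageI)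
      then have "g ` ?S = g ` {..<length \<pi>}" by auto
      then show ?thesis using onto by simp
    qed
    then have "\<not> decomp_on \<pi> ?S"
      using decomp_on_iff[of ?S] s ind decomposable_iff_decomp_on[OF perm'] by simp
    then show ?thesis using eq False by simp
  next
    case True
    then have fib: "fibre (g q) = {q}" using qf by (auto simp: card_1_singleton_iff)
    have img: "g ` ?S = {..<length \<sigma>} - {g q}"
      using onto fib by (auto simp: fibre_def image_iff)
    show ?thesis
    proof (cases "length \<sigma> = 2")
      case False
      then have "decomp_on \<pi> ?S \<longleftrightarrow> decomp_on \<sigma> ({..<length \<sigma>} - {g q})"
        using decomp_on_iff[of ?S] img s g_less[OF q] by simp
      then show ?thesis using eq True False D_set_iff[OF perm', of "g q"] qI by simp
    next
      case two: True
      define i where "i = 1 - g q"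
      have "g q < 2" using g_less[OF q] two by simp
      then have "{..<length \<sigma>} - {g q} \<subseteq> {i}" using two by (auto simp: i_def)
      then have "?S \<subseteq> fibre i" using img by (auto simp: fibre_def)
      then have "decomp_on \<pi> ?S" using n q by (intro decomposable_if_one_run) auto
      then show ?thesis using eq True two D_set_iff[OF perm', of "g q"] qI by simp
    qed
  qed
qed

lemma image_I_set:
  assumes "0 < length \<pi>"
  shows "g ` I_set \<pi> = I_set \<sigma>"
proof -
  have s: "0 < length \<sigma>" using g_less[OF assms] by (rule order.strict_trans1[rotated]) simp
  let ?n = "length \<pi>" and ?s = "length \<sigma>"
  obtain r0 where r0: "r0 < ?n" "g r0 = 0" using obtain_preimage[OF s] .
  obtain r1 where r1: "r1 < ?n" "g r1 = ?s - 1" using obtain_preimage[of "?s - 1"] s by auto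
  have first: "g 0 = 0" using mono[of r0 0] r0 by (cases "r0 = 0") auto
  have last: "g (?n - 1) = ?s - 1"
  proof (cases "r1 = ?n - 1")
    case False
    then have "g r1 \<le> g (?n - 1)" using mono[of "?n - 1" r1] r1(1) by simp
    then show ?thesis using g_less[of "?n - 1"] r1(2) assms by simp
  qed (use r1 in simp)
  have smallest: "\<sigma> ! g q = 1" if q: "q < ?n" "\<pi> ! q = 1" for q
  proof (rule ccontr)
    assume ne: "\<sigma> ! g q \<noteq> 1"
    obtain i where i: "i < ?s" "\<sigma> ! i = 1" using is_perm_obtain_position[OF perm', of 1] s by auto
    obtain r where r: "r < ?n" "g r = i" using obtain_preimage[OF i(1)] .
    have "\<sigma> ! g r < \<sigma> ! g q" using r i ne is_perm_nth_bounds(1)[OF perm' g_less[OF q(1)]] by simp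
    moreover from this have "g r \<noteq> g q" by auto
    ultimately have "\<pi> ! r < \<pi> ! q" using order[OF r(1) q(1)] by simp
    then show False using q(2) is_perm_nth_bounds(1)[OF perm r(1)] by simp
  qed
  have largest: "\<sigma> ! g q = ?s" if q: "q < ?n" "\<pi> ! q = ?n" for q
  proof (rule ccontr)
    assume ne: "\<sigma> ! g q \<noteq> ?s"
    obtain i where i: "i < ?s" "\<sigma> ! i = ?s" using is_perm_obtain_position[OF perm', of ?s] s by auto
    obtain r where r: "r < ?n" "g r = i" using obtain_preimage[OF i(1)] .
    have "\<sigma> ! g q < \<sigma> ! g r" using r i ne is_perm_nth_bounds(2)[OF perm' g_less[OF q(1)]] by simp
    moreover from this have "g q \<noteq> g r" by auto
    ultimately have "\<pi> ! q < \<pi> ! r" using order[OF q(1) r(1)] by simp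
    then show False using q(2) is_perm_nth_bounds(2)[OF perm r(1)] by simp
  qed
  obtain qm where qm: "qm < ?n" "\<pi> ! qm = 1" using is_perm_obtain_position[OF perm, of 1] assms by auto
  obtain qM where qM: "qM < ?n" "\<pi> ! qM = ?n" using is_perm_obtain_position[OF perm, of ?n] assms by auto
  have I\<pi>: "I_set \<pi> = {0, ?n - 1, qm, qM}"
    using I_set_eq[OF perm assms qm qM] .
  have "I_set \<sigma> = {0, ?s - 1, g qm, g qM}"
    using I_set_eq[OF perm' s g_less[OF qm(1)] smallest[OF qm] g_less[OF qM(1)] largest[OF qM]] .
  then show ?thesis unfolding I\<pi> using first last by simp
qed

text \<open>
  The reason for the lower bound \<open>\<ell>\<close>: by \<open>decomposable_del_entry_iff_run\<close>, an inflation
  of an indecomposable \<open>\<sigma>\<close> is not almost decomposable iff its runs over \<open>D_set \<sigma>\<close> have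
  at least two entries.
\<close>

lemma mem_residuals_iff:
  assumes n: "3 \<le> length \<pi>"
  shows "\<pi> \<in> residuals \<delta> (length \<pi>) \<longleftrightarrow>
    indecomposable_avoider \<sigma> \<and> (\<forall>i<length \<sigma>. ell \<sigma> i \<le> card (fibre i)) \<and> defect \<pi> = \<delta>"
proof -
  have "\<pi> \<in> residuals \<delta> (length \<pi>) \<longleftrightarrow>
      avoids_1324 \<pi> \<and> defect \<pi> = \<delta> \<and> indecomposable \<pi> \<and> \<not> almost_decomposable \<pi>"
    using perm by (auto simp: residuals_def Av_1324_def is_perm_def defect_def)
  moreover have "\<not> almost_decomposable \<pi> \<longleftrightarrow> (\<forall>i<length \<sigma>. ell \<sigma> i \<le> card (fibre i))"
    if ind: "indecomposable \<sigma>" "2 \<le> length \<sigma>"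
  proof -
    have ne: "\<pi> \<noteq> []" using n by auto
    have "almost_decomposable \<pi> \<longleftrightarrow> (\<exists>q\<in>I_set \<pi>. decomposable (del_entry \<pi> (\<pi> ! q)))"
    proof -
      obtain qm where qm: "qm < length \<pi>" "\<pi> ! qm = 1" using is_perm_obtain_position[OF perm, of 1] n by auto
      obtain qM where qM: "qM < length \<pi>" "\<pi> ! qM = length \<pi>"
        using is_perm_obtain_position[OF perm, of "length \<pi>"] n by auto
      have I\<pi>: "I_set \<pi> = {0, length \<pi> - 1, qm, qM}"
        using I_set_eq[OF perm _ qm qM] ne by simp
      show ?thesis
        unfolding almost_decomposable_def I\<pi> using qm(2) qM(2) decomposable_iff n ind
        by (auto simp: hd_conv_nth[OF ne] last_conv_nth[OF ne])
    qed
    also have "\<dots> \<longleftrightarrow> (\<exists>q\<in>I_set \<pi>. card (fibre (g q)) = 1 \<and> g q \<in> D_set \<sigma>)"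
    proof (rule bex_cong[OF refl])
      fix q assume q: "q \<in> I_set \<pi>"
      then have "q < length \<pi>" by (simp add: I_set_def)
      moreover have "g ` I_set \<pi> = I_set \<sigma>" by (rule image_I_set) (use n in linarith)
      then have "g q \<in> I_set \<sigma>" using q by (metis imageI)
      ultimately show "decomposable (del_entry \<pi> (\<pi> ! q)) \<longleftrightarrow> card (fibre (g q)) = 1 \<and> g q \<in> D_set \<sigma>"
        using decomposable_del_entry_iff_run n ind by simp
    qed
    also have "\<dots> \<longleftrightarrow> (\<exists>i\<in>g ` I_set \<pi>. card (fibre i) = 1 \<and> i \<in> D_set \<sigma>)"
      by blast
    also have "g ` I_set \<pi> = I_set \<sigma>" by (rule image_I_set) (use n in linarith)
    finally have "almost_decomposable \<pi> \<longleftrightarrow> (\<exists>i\<in>D_set \<sigma>. card (fibre i) = 1)"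
      by (auto simp: D_set_def)
    moreover have "D_set \<sigma> \<subseteq> {..<length \<sigma>}" by (auto simp: D_set_def I_set_def)
    ultimately show ?thesis
      using card_fibre_pos by (fastforce simp: ell_def)
  qed
  ultimately show ?thesis
    using decomposable_iff avoids_iff perm' n by (auto simp: indecomposable_avoider_def not_less)
qed

end

section \<open>Residuals as inflations\<close>

lemma inversions_inflate:
  assumes "is_perm \<sigma>" "\<And>i. i < length \<sigma> \<Longrightarrow> 1 \<le> b i"
  shows "inversions (inflate \<sigma> b) = (\<Sum>(i, j)\<in>Inv \<sigma>. b i * b j)"
proof -
  obtain g where g: "run_collapse g (inflate \<sigma> b) \<sigma>"
    "\<And>i. i < length \<sigma> \<Longrightarrow> card {q. q < length (inflate \<sigma> b) \<and> g q = i} = b i"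
    using inflate_collapse[of \<sigma> b] assms by blast
  interpret run_collapse g "inflate \<sigma> b" \<sigma> by (fact g)
  show ?thesis unfolding inversions_eq
    by (rule sum.cong) (use g(2) in \<open>auto simp: fibre_def Inv_def\<close>)
qed

lemma defect_inflate:
  assumes "is_perm \<sigma>"
  shows "defect (inflate \<sigma> (\<lambda>i. ell \<sigma> i + x i)) = defect0 \<sigma> + Q_form \<sigma> x"
proof -
  have inv: "int (inversions (inflate \<sigma> (\<lambda>i. ell \<sigma> i + x i))) =
      (\<Sum>(i, j)\<in>Inv \<sigma>. int (ell \<sigma> i + x i) * int (ell \<sigma> j + x j))" for x
    using inversions_inflate[OF assms, of "\<lambda>i. ell \<sigma> i + x i"] ell_pos
    by (simp add: case_prod_unfold trans_le_add1)
  have linear: "(\<Sum>i<length \<sigma>. a_coeff \<sigma> i * int (x i)) =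
      (\<Sum>(i, j)\<in>Inv \<sigma>. int (x i) * int (ell \<sigma> j) + int (x j) * int (ell \<sigma> i)) - 2 * (\<Sum>i<length \<sigma>. int (x i))"
  proof -
    have "(\<Sum>i<length \<sigma>. a_coeff \<sigma> i * int (x i)) =
        (\<Sum>i<length \<sigma>. (\<Sum>j\<in>nbrs \<sigma> i. int (x i) * int (ell \<sigma> j)) - 2 * int (x i))"
      unfolding a_coeff_def by (intro sum.cong refl) (simp add: algebra_simps sum_distrib_left)
    then show ?thesis
      using sum_nbrs_eq_sum_Inv[of "\<lambda>i j. int (x i) * int (ell \<sigma> j)" \<sigma>]
      by (simp add: sum_subtractf sum_distrib_left)
  qed
  have "(\<Sum>(i, j)\<in>Inv \<sigma>. int (ell \<sigma> i + x i) * int (ell \<sigma> j + x j)) =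
      (\<Sum>(i, j)\<in>Inv \<sigma>. int (ell \<sigma> i) * int (ell \<sigma> j)) +
      (\<Sum>(i, j)\<in>Inv \<sigma>. int (x i) * int (ell \<sigma> j) + int (x j) * int (ell \<sigma> i)) +
      (\<Sum>(i, j)\<in>Inv \<sigma>. int (x i) * int (x j))"
    unfolding sum.distrib[symmetric] by (intro sum.cong refl) (auto simp: algebra_simps)
  then show ?thesis
    using inv[of x] inv[of "\<lambda>_. 0"] linear
    by (simp add: defect_def defect0_def Q_form_def length_inflate sum.distrib)
qed

lemma mem_residuals_inflate_iff:
  assumes "is_perm \<sigma>" "\<And>i. i < length \<sigma> \<Longrightarrow> 1 \<le> b i" "3 \<le> n"
  shows "inflate \<sigma> b \<in> residuals \<delta> n \<longleftrightarrow>
    indecomposable_avoider \<sigma> \<and> (\<forall>i<length \<sigma>. ell \<sigma> i \<le> b i) \<and>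
    defect (inflate \<sigma> b) = \<delta> \<and> (\<Sum>i<length \<sigma>. b i) = n"
proof (cases "length (inflate \<sigma> b) = n")
  case True
  obtain g where g: "run_collapse g (inflate \<sigma> b) \<sigma>"
    "\<And>i. i < length \<sigma> \<Longrightarrow> card {q. q < length (inflate \<sigma> b) \<and> g q = i} = b i"
    using inflate_collapse[of \<sigma> b] assms by blast
  interpret run_collapse g "inflate \<sigma> b" \<sigma> by (fact g)
  show ?thesis
    using mem_residuals_iff[of \<delta>] True assms(3) g(2) by (auto simp: fibre_def length_inflate)
next
  case False
  then have "inflate \<sigma> b \<notin> residuals \<delta> n"
    by (auto simp: residuals_def Av_1324_def permutations_of_set_def dest: distinct_card)
  then show ?thesis using False by (simp add: length_inflate)
qed

lemma inflate_cong:
  assumes "\<And>i. i < length \<sigma> \<Longrightarrow> b i = c i"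
  shows "inflate \<sigma> b = inflate \<sigma> c"
proof -
  have "(\<Sum>j | j < length \<sigma> \<and> \<sigma> ! j < \<sigma> ! i. b j) = (\<Sum>j | j < length \<sigma> \<and> \<sigma> ! j < \<sigma> ! i. c j)" for i
    by (rule sum.cong) (use assms in auto)
  then show ?thesis
    unfolding inflate_def using assms by (intro arg_cong[of _ _ concat] map_cong refl) auto
qed

text \<open>
  The vectors \<open>x = b - \<ell>\<close> of the inflations of \<open>\<sigma>\<close> that are residuals of length
  \<open>n\<close> (for indecomposable 1324-avoiding \<open>\<sigma>\<close> and \<open>n \<ge> 3\<close>).
\<close>

definition excesses :: "int \<Rightarrow> nat \<Rightarrow> nat list \<Rightarrow> (nat \<Rightarrow> nat) set" where
  "excesses \<delta> n \<sigma> = {x \<in> (\<Pi>\<^sub>E i\<in>{..<length \<sigma>}. UNIV).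
     Q_form \<sigma> x = \<delta> - defect0 \<sigma> \<and> L_total \<sigma> + (\<Sum>i<length \<sigma>. x i) = n}"

lemma inflate_mem_residuals_iff:
  assumes "is_perm \<sigma>" "3 \<le> n"
  shows "inflate \<sigma> (\<lambda>i. ell \<sigma> i + x i) \<in> residuals \<delta> n \<longleftrightarrow>
    indecomposable_avoider \<sigma> \<and> Q_form \<sigma> x = \<delta> - defect0 \<sigma> \<and> L_total \<sigma> + (\<Sum>i<length \<sigma>. x i) = n"
  using mem_residuals_inflate_iff[OF assms(1) _ assms(2), of "\<lambda>i. ell \<sigma> i + x i" \<delta>] ell_pos
    defect_inflate[OF assms(1), of x]
  by (auto simp: trans_le_add1 L_total_def sum.distrib)

lemma Sigma_setD:
  assumes "\<sigma> \<in> Sigma_set \<delta>"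
  shows "indecomposable_avoider \<sigma>" "reduced \<sigma>"
  using assms mem_residuals_inflate_iff by (auto simp: Sigma_set_def)

lemma Sigma_setI:
  assumes "is_perm \<sigma>" "reduced \<sigma>" "3 \<le> n" "inflate \<sigma> (\<lambda>i. ell \<sigma> i + x i) \<in> residuals \<delta> n"
  shows "\<sigma> \<in> Sigma_set \<delta>"
proof -
  have "\<forall>i<length \<sigma>. 1 \<le> ell \<sigma> i + x i" using ell_pos by (simp add: trans_le_add1)
  then show ?thesis using assms unfolding Sigma_set_def
    by (intro CollectI conjI exI[of _ "\<lambda>i. ell \<sigma> i + x i"] exI[of _ n]) auto
qed

text \<open>
  Surjectivity is the existence of a reduced collapse, injectivity its uniqueness.
\<close>

lemma bij_betw_residuals:
  assumes n: "3 \<le> n"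
  shows "bij_betw (\<lambda>(\<sigma>, x). inflate \<sigma> (\<lambda>i. ell \<sigma> i + x i))
    (SIGMA \<sigma>:Sigma_set \<delta>. excesses \<delta> n \<sigma>) (residuals \<delta> n)"
proof (rule bij_betw_imageI)
  show "inj_on (\<lambda>(\<sigma>, x). inflate \<sigma> (\<lambda>i. ell \<sigma> i + x i)) (SIGMA \<sigma>:Sigma_set \<delta>. excesses \<delta> n \<sigma>)"
  proof (rule inj_onI, clarify)
    fix \<sigma> x \<sigma>' x'
    assume mem: "\<sigma> \<in> Sigma_set \<delta>" "x \<in> excesses \<delta> n \<sigma>" "\<sigma>' \<in> Sigma_set \<delta>" "x' \<in> excesses \<delta> n \<sigma>'"
      and eq: "inflate \<sigma> (\<lambda>i. ell \<sigma> i + x i) = inflate \<sigma>' (\<lambda>i. ell \<sigma>' i + x' i)"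
    have perms: "is_perm \<sigma>" "is_perm \<sigma>'" using mem by (auto simp: Sigma_set_def)
    have pos: "1 \<le> ell \<tau> i + y i" for \<tau> i and y :: "nat \<Rightarrow> nat" using ell_pos[of \<tau> i] by simp
    obtain g where g: "run_collapse g (inflate \<sigma> (\<lambda>i. ell \<sigma> i + x i)) \<sigma>"
      "\<And>i. i < length \<sigma> \<Longrightarrow>
        card {q. q < length (inflate \<sigma> (\<lambda>i. ell \<sigma> i + x i)) \<and> g q = i} = ell \<sigma> i + x i"
      using inflate_collapse[OF perms(1), of "\<lambda>i. ell \<sigma> i + x i"] pos by blast
    obtain g' where g': "run_collapse g' (inflate \<sigma>' (\<lambda>i. ell \<sigma>' i + x' i)) \<sigma>'"
      "\<And>i. i < length \<sigma>' \<Longrightarrow>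
        card {q. q < length (inflate \<sigma>' (\<lambda>i. ell \<sigma>' i + x' i)) \<and> g' q = i} = ell \<sigma>' i + x' i"
      using inflate_collapse[OF perms(2), of "\<lambda>i. ell \<sigma>' i + x' i"] pos by blast
    note unique = run_collapse_unique[OF g(1) g'(1)[folded eq] Sigma_setD(2)[OF mem(1)]
        Sigma_setD(2)[OF mem(3)]]
    have "x = x'"
    proof (rule PiE_ext)
      show "x \<in> (\<Pi>\<^sub>E i\<in>{..<length \<sigma>}. UNIV)" "x' \<in> (\<Pi>\<^sub>E i\<in>{..<length \<sigma>}. UNIV)"
        using mem(2,4) unique(1) by (auto simp: excesses_def)
      fix i assume i: "i \<in> {..<length \<sigma>}"
      have "{q. q < length (inflate \<sigma> (\<lambda>i. ell \<sigma> i + x i)) \<and> g q = i} =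
          {q. q < length (inflate \<sigma>' (\<lambda>i. ell \<sigma>' i + x' i)) \<and> g' q = i}"
        unfolding eq[symmetric] using unique(2) by (intro Collect_cong conj_cong refl) auto
      then show "x i = x' i" using g(2)[of i] g'(2)[of i] i unique(1) by simp
    qed
    then show "\<sigma> = \<sigma>' \<and> x = x'" using unique(1) by simp
  qed
  show "(\<lambda>(\<sigma>, x). inflate \<sigma> (\<lambda>i. ell \<sigma> i + x i)) ` (SIGMA \<sigma>:Sigma_set \<delta>. excesses \<delta> n \<sigma>) = residuals \<delta> n"
  proof (intro equalityI subsetI)
    fix \<pi> assume "\<pi> \<in> (\<lambda>(\<sigma>, x). inflate \<sigma> (\<lambda>i. ell \<sigma> i + x i)) ` (SIGMA \<sigma>:Sigma_set \<delta>. excesses \<delta> n \<sigma>)"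
    then obtain \<sigma> x where "\<sigma> \<in> Sigma_set \<delta>" "x \<in> excesses \<delta> n \<sigma>" "\<pi> = inflate \<sigma> (\<lambda>i. ell \<sigma> i + x i)"
      by auto
    then show "\<pi> \<in> residuals \<delta> n"
      using inflate_mem_residuals_iff[OF _ n, of \<sigma> x \<delta>] Sigma_setD(1)[of \<sigma> \<delta>]
      by (auto simp: excesses_def Sigma_set_def)
  next
    fix \<pi> assume \<pi>: "\<pi> \<in> residuals \<delta> n"
    have perm: "is_perm \<pi>" and len: "length \<pi> = n"
      using \<pi> distinct_card[of \<pi>]
      by (auto simp: residuals_def Av_1324_def is_perm_def permutations_of_set_def)
    obtain g \<sigma> where col: "run_collapse g \<pi> \<sigma>" and red: "reduced \<sigma>"
      using obtain_reduced_collapse[OF perm] .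
    interpret run_collapse g \<pi> \<sigma> by (fact col)
    have ell_le: "ell \<sigma> i \<le> card (fibre i)" if "i < length \<sigma>" for i
      using mem_residuals_iff[of \<delta>] \<pi> len n that by simp
    define x where "x = (\<lambda>i\<in>{..<length \<sigma>}. card (fibre i) - ell \<sigma> i)"
    have infl: "\<pi> = inflate \<sigma> (\<lambda>i. ell \<sigma> i + x i)"
      by (rule eq_inflate) (use ell_le in \<open>simp add: x_def\<close>)
    then have "x \<in> excesses \<delta> n \<sigma>"
      using inflate_mem_residuals_iff[OF perm' n, of x \<delta>] \<pi> by (auto simp: excesses_def x_def)
    moreover have "\<sigma> \<in> Sigma_set \<delta>" using Sigma_setI[OF perm' red n, of x \<delta>] \<pi> infl by simp
    ultimately show "\<pi> \<in> (\<lambda>(\<sigma>, x). inflate \<sigma> (\<lambda>i. ell \<sigma> i + x i)) ` (SIGMA \<sigma>:Sigma_set \<delta>. excesses \<delta> n \<sigma>)"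
      using infl by (intro image_eqI[of _ _ "(\<sigma>, x)"]) auto
  qed
qed

section \<open>The length of a reduced permutation is bounded by its defect\<close>

text \<open>
  If \<open>i < j\<close> have the same neighbours, then the entries between them in position are those
  between them in value.  An inversion among these would form a 1324 together with \<open>i\<close> and
  \<open>j\<close>, so they form an increasing run, and the entry following \<open>i\<close> is its successor in
  value.
\<close>

lemma reduced_no_twins:
  assumes perm: "is_perm \<sigma>" and red: "reduced \<sigma>" and av: "avoids_1324 \<sigma>"
    and i: "i < length \<sigma>" and j: "j < length \<sigma>" and eq: "nbrs \<sigma> i = nbrs \<sigma> j"
  shows "i = j"
proof -
  have False if lt: "i < j" and i: "i < length \<sigma>" and j: "j < length \<sigma>" and eq: "nbrs \<sigma> i = nbrs \<sigma> j" for i j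
  proof -
    have ne: "\<sigma> ! a \<noteq> \<sigma> ! b" if "a < length \<sigma>" "b < length \<sigma>" "a \<noteq> b" for a b
      using is_perm_nth_eq_iff[OF perm] that by simp
    have nb: "i \<notin> nbrs \<sigma> j" using eq nbrs_irrefl by blast
    have up: "\<sigma> ! i < \<sigma> ! j" using nb lt i j ne[of i j] by (auto simp: nbrs_iff)
    have same: "k \<in> nbrs \<sigma> i \<longleftrightarrow> k \<in> nbrs \<sigma> j" for k using eq by simp
    \<comment> \<open>Whatever lies between the twins in position lies between them in value, and conversely.\<close>
    have pos: "\<sigma> ! i < \<sigma> ! k \<and> \<sigma> ! k < \<sigma> ! j" if "i < k" "k < j" for k
      using same[of k] that i j up ne[of i k] ne[of k j] by (fastforce simp: nbrs_iff)
    have val: "i < k \<and> k < j" if "k < length \<sigma>" "\<sigma> ! i < \<sigma> ! k" "\<sigma> ! k < \<sigma> ! j" for k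
    proof -
      have "k \<noteq> i" "k \<noteq> j" using that by auto
      then show ?thesis using same[of k] that i j lt by (fastforce simp: nbrs_iff)
    qed
    have incr: "\<sigma> ! a < \<sigma> ! b" if "i \<le> a" "a < b" "b \<le> j" for a b
    proof (rule ccontr)
      assume "\<not> \<sigma> ! a < \<sigma> ! b"
      then have inv: "\<sigma> ! b < \<sigma> ! a" using ne[of a b] that j by simp
      have "a \<noteq> i" using inv pos[of b] that up by (cases "b = j") auto
      moreover have "b \<noteq> j" using inv pos[of a] that up by (cases "a = i") auto
      ultimately have "i < a" "b < j" using that by auto
      then show False using avoidsD[OF av, of i a b j] inv pos[of a] pos[of b] that j by auto
    qed
    have "\<sigma> ! Suc i = \<sigma> ! i + 1"
    proof (rule ccontr)
      assume h: "\<sigma> ! Suc i \<noteq> \<sigma> ! i + 1"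
      have "\<sigma> ! i < \<sigma> ! Suc i" using incr[of i "Suc i"] lt by simp
      then have gap: "\<sigma> ! i + 1 < \<sigma> ! Suc i" using h by simp
      have Sj: "Suc i = j \<or> \<sigma> ! Suc i < \<sigma> ! j" using incr[of "Suc i" j] lt by (cases "Suc i = j") auto
      obtain k where k: "k < length \<sigma>" "\<sigma> ! k = \<sigma> ! i + 1"
        using is_perm_obtain_position[OF perm, of "\<sigma> ! i + 1"] gap
          is_perm_nth_bounds(2)[OF perm, of "Suc i"] lt j by auto
      have "i < k" "k < j" using val[OF k(1)] k(2) gap Sj by auto
      moreover from this have "k \<noteq> Suc i" using k gap by auto
      ultimately show False using incr[of "Suc i" k] k gap by auto
    qed
    then show False using red lt j by (auto simp: reduced_def)
  qed
  then show ?thesis using i j eq by (cases i j rule: linorder_cases) auto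
qed

text \<open>
  The inversion graph of points with coordinates \<open>p\<close> (position) and \<open>v\<close> (value).  In
  these coordinates, taking the inverse of a permutation exchanges \<open>p\<close> and \<open>v\<close>, and taking the
  reverse-complement negates both; either operation preserves avoidance of 1324.
\<close>

definition inverted :: "(nat \<Rightarrow> int) \<Rightarrow> (nat \<Rightarrow> int) \<Rightarrow> nat \<Rightarrow> nat \<Rightarrow> bool" where
  "inverted p v x y \<longleftrightarrow> (p x < p y \<and> v y < v x) \<or> (p y < p x \<and> v x < v y)"

lemma inverted_swap: "inverted v p = inverted p v"
  by (intro ext) (auto simp: inverted_def)

lemma inverted_uminus: "inverted (\<lambda>x. - p x) (\<lambda>x. - v x) = inverted p v"
  by (intro ext) (auto simp: inverted_def)

text \<open>
  A 1324-avoiding set of points without twins, and its extreme points: \<open>f\<close> first, \<open>l\<close>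
  last, \<open>m\<close> smallest, \<open>M\<close> largest.  Only \<open>f\<close> is analysed below; the symmetries
  \<open>swap\<close> and \<open>reverse\<close> carry the results over to the other three.
\<close>

locale avoiding_points =
  fixes p v :: "nat \<Rightarrow> int" and S :: "nat set" and f m l M :: nat
  assumes finite_S: "finite S"
    and inj_p: "inj_on p S" and inj_v: "inj_on v S"
    and avoids: "\<And>a b c d. \<lbrakk>a \<in> S; b \<in> S; c \<in> S; d \<in> S; p a < p b; p b < p c; p c < p d;
      v a < v c; v c < v b; v b < v d\<rbrakk> \<Longrightarrow> False"
    and hubs_in: "f \<in> S" "m \<in> S" "l \<in> S" "M \<in> S"
    and extreme: "\<And>x. x \<in> S \<Longrightarrow> p f \<le> p x" "\<And>x. x \<in> S \<Longrightarrow> v m \<le> v x"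
      "\<And>x. x \<in> S \<Longrightarrow> p x \<le> p l" "\<And>x. x \<in> S \<Longrightarrow> v x \<le> v M"
    and no_twins: "\<And>x y. \<lbrakk>x \<in> S; y \<in> S; \<And>z. z \<in> S \<Longrightarrow> inverted p v x z \<longleftrightarrow> inverted p v y z\<rbrakk> \<Longrightarrow> x = y"
begin

definition hubs :: "nat set" where "hubs = {f, m, l, M}"

definition inner_nbrs :: "nat \<Rightarrow> nat set" where
  "inner_nbrs x = {y \<in> S - hubs. inverted p v x y}"

definition first_only :: "nat set" where
  "first_only = {x \<in> S - hubs. inverted p v x f \<and> (\<forall>h\<in>hubs - {f}. \<not> inverted p v x h)}"

definition left_above :: "nat \<Rightarrow> nat set" where
  "left_above x = {y \<in> S - hubs. p y < p m \<and> v x < v y}"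

definition above_left :: "nat \<Rightarrow> nat set" where
  "above_left x = {y \<in> S - hubs. v l < v y \<and> p y < p x}"

lemma swap: "avoiding_points v p S m f M l"
proof
  show "x = y" if "x \<in> S" "y \<in> S" "\<And>z. z \<in> S \<Longrightarrow> inverted v p x z \<longleftrightarrow> inverted v p y z" for x y
    using no_twins[OF that(1,2)] that(3) unfolding inverted_swap[of v p] by blast
  show False if "a \<in> S" "b \<in> S" "c \<in> S" "d \<in> S" "v a < v b" "v b < v c" "v c < v d"
      "p a < p c" "p c < p b" "p b < p d" for a b c d
    using avoids[of a c b d] that by simp
qed (use finite_S inj_p inj_v hubs_in extreme in auto)

lemma reverse: "avoiding_points (\<lambda>x. - p x) (\<lambda>x. - v x) S l M f m"
proof
  show "x = y" if "x \<in> S" "y \<in> S" "\<And>z. z \<in> S \<Longrightarrow>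
      inverted (\<lambda>x. - p x) (\<lambda>x. - v x) x z \<longleftrightarrow> inverted (\<lambda>x. - p x) (\<lambda>x. - v x) y z" for x y
    using no_twins[OF that(1,2)] that(3) unfolding inverted_uminus by blast
  show False if "a \<in> S" "b \<in> S" "c \<in> S" "d \<in> S" "- p a < - p b" "- p b < - p c" "- p c < - p d"
      "- v a < - v c" "- v c < - v b" "- v b < - v d" for a b c d
    using avoids[of d c b a] that by simp
  show "inj_on (\<lambda>x. - p x) S" "inj_on (\<lambda>x. - v x) S"
    using inj_p inj_v by (auto simp: inj_on_def)
qed (use finite_S hubs_in extreme in auto)

lemma p_neq: "x \<in> S \<Longrightarrow> y \<in> S \<Longrightarrow> x \<noteq> y \<Longrightarrow> p x \<noteq> p y"
  and v_neq: "x \<in> S \<Longrightarrow> y \<in> S \<Longrightarrow> x \<noteq> y \<Longrightarrow> v x \<noteq> v y"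
  using inj_p inj_v by (auto simp: inj_on_def)

lemma inner_extreme:
  assumes "x \<in> S - hubs"
  shows "p f < p x" "v m < v x" "p x < p l" "v x < v M"
  using assms extreme[of x] p_neq[of x f] v_neq[of x m] p_neq[of x l] v_neq[of x M] hubs_in
  by (auto simp: hubs_def)

text \<open>
  A point without hub neighbours has \<open>f\<close> and \<open>m\<close> to the lower left and \<open>l\<close> and
  \<open>M\<close> to the upper right.  Such a point, a neighbour of it and a suitable pair of these hubs
  form a 1324.
\<close>

lemma inverted_hub_exists:
  assumes x: "x \<in> S - hubs" and y: "y \<in> S" "inverted p v x y"
  shows "\<exists>h\<in>hubs. inverted p v x h"
proof (rule ccontr)
  assume none: "\<not> ?thesis"
  then have yi: "y \<in> S - hubs" using y by auto
  have xS: "x \<in> S" "x \<noteq> f" "x \<noteq> m" "x \<noteq> l" "x \<noteq> M" using x by (auto simp: hubs_def)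
  have nf: "\<not> inverted p v x f" "\<not> inverted p v x m" "\<not> inverted p v x l" "\<not> inverted p v x M"
    using none by (auto simp: hubs_def)
  note xe = inner_extreme[OF x] and ye = inner_extreme[OF yi]
  have "v f < v x" using nf(1) xe v_neq[of f x] hubs_in xS by (auto simp: inverted_def)
  moreover have "p m < p x" using nf(2) xe p_neq[of m x] hubs_in xS by (auto simp: inverted_def)
  moreover have "v x < v l" using nf(3) xe v_neq[of l x] hubs_in xS by (auto simp: inverted_def)
  moreover have "p x < p M" using nf(4) xe p_neq[of M x] hubs_in xS by (auto simp: inverted_def)
  ultimately show False
    using y(2) avoids[of f y x M] avoids[of m x y l] hubs_in xS(1) y(1) xe ye
    by (auto simp: inverted_def)
qed

lemma first_onlyD:
  assumes "x \<in> first_only"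
  shows "x \<in> S - hubs" "v x < v f" "p m < p x" "v x < v l" "f \<noteq> M \<Longrightarrow> p x < p M"
proof -
  show x: "x \<in> S - hubs" using assms by (simp add: first_only_def)
  note xe = inner_extreme[OF x]
  have xS: "x \<in> S" "x \<noteq> f" "x \<noteq> m" "x \<noteq> l" "x \<noteq> M" using x by (auto simp: hubs_def)
  have inv: "inverted p v x f" and none: "\<And>h. h \<in> hubs \<Longrightarrow> h \<noteq> f \<Longrightarrow> \<not> inverted p v x h"
    using assms by (auto simp: first_only_def)
  show vf: "v x < v f" using inv xe by (auto simp: inverted_def)
  have "m \<noteq> f" "l \<noteq> f" using vf xe by auto
  then have "\<not> inverted p v x m" "\<not> inverted p v x l" using none by (auto simp: hubs_def)
  then show "p m < p x" "v x < v l"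
    using xe p_neq[of m x] v_neq[of l x] hubs_in xS by (auto simp: inverted_def)
  show "p x < p M" if "f \<noteq> M"
    using none[of M] that xe p_neq[of M x] hubs_in xS by (auto simp: inverted_def hubs_def)
qed

text \<open>
  If \<open>f\<close> is the only hub neighbour of \<open>x\<close>, then \<open>m\<close> is to the lower left and \<open>l\<close>
  to the upper right of \<open>x\<close>.  To avoid the pattern with \<open>m\<close> and \<open>l\<close> around it, an inner
  neighbour must lie to the upper left of \<open>x\<close>, and moreover left of \<open>m\<close> or above
  \<open>l\<close>.
\<close>

lemma inner_nbrs_first_only:
  assumes x: "x \<in> first_only"
  shows "inner_nbrs x = left_above x \<union> above_left x"
proof (intro equalityI subsetI)
  note xD = first_onlyD[OF x] and xe = inner_extreme[OF first_onlyD(1)[OF x]]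
  have xS: "x \<in> S" using xD(1) by simp
  fix y assume "y \<in> inner_nbrs x"
  then have y: "y \<in> S - hubs" "inverted p v x y" by (auto simp: inner_nbrs_def)
  note ye = inner_extreme[OF y(1)]
  have "\<not> (p x < p y \<and> v y < v x)"
    using avoids[of m x y l] hubs_in xS y(1) xD ye by auto
  then have ul: "p y < p x" "v x < v y" using y(2) by (auto simp: inverted_def)
  have "p y < p m \<or> v l < v y"
  proof (rule ccontr)
    assume "\<not> ?thesis"
    then have "p m < p y" "v y < v l"
      using p_neq[of y m] v_neq[of y l] hubs_in y(1) by (auto simp: hubs_def)
    then show False using avoids[of m y x l] hubs_in xS y(1) xD xe ye ul by auto
  qed
  then show "y \<in> left_above x \<union> above_left x"
    using y(1) ul by (auto simp: left_above_def above_left_def)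
qed (use first_onlyD[OF x] in \<open>auto simp: inner_nbrs_def left_above_def above_left_def inverted_def\<close>)

lemma first_only_chain:
  assumes x: "x \<in> first_only" and y: "y \<in> first_only" and px: "p x < p y"
  shows "v x < v y"
proof -
  have "y \<notin> inner_nbrs x"
    unfolding inner_nbrs_first_only[OF x] using first_onlyD[OF y]
    by (auto simp: left_above_def above_left_def)
  then show ?thesis
    using first_onlyD(1)[OF x] first_onlyD(1)[OF y] px v_neq[of x y]
    by (cases "x = y") (auto simp: inner_nbrs_def inverted_def)
qed

text \<open>
  Along the increasing sequence of such points, the neighbours left of \<open>m\<close> can only disappear
  and the neighbours above \<open>l\<close> can only appear.
\<close>

lemma first_only_mono:
  assumes x: "x \<in> first_only" and y: "y \<in> first_only" and px: "p x < p y"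
  shows "left_above y \<subseteq> left_above x" "above_left x \<subseteq> above_left y"
  using first_only_chain[OF assms] px by (auto simp: left_above_def above_left_def)

lemma first_only_eqI:
  assumes x: "x \<in> first_only" and y: "y \<in> first_only" and eq: "inner_nbrs x = inner_nbrs y"
  shows "x = y"
proof (rule no_twins)
  show "x \<in> S" "y \<in> S" using first_onlyD(1) x y by auto
  fix z assume z: "z \<in> S"
  show "inverted p v x z \<longleftrightarrow> inverted p v y z"
  proof (cases "z \<in> hubs")
    case True
    then show ?thesis using x y by (cases "z = f") (auto simp: first_only_def)
  next
    case False
    then show ?thesis using eq z by (auto simp: inner_nbrs_def)
  qed
qed

lemma finite_sets [simp]:
  "finite (left_above x)" "finite (above_left x)" "finite (inner_nbrs x)" "finite first_only"
  using finite_S by (auto simp: left_above_def above_left_def inner_nbrs_def first_only_def)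

text \<open>
  Where the difference is constant, both neighbour sets are constant by monotonicity, and there
  are no twins.
\<close>

lemma inj_on_difference:
  "inj_on (\<lambda>x. int (card (left_above x)) - int (card (above_left x))) first_only"
proof -
  have False if x: "x \<in> first_only" and y: "y \<in> first_only" and px: "p x < p y"
    and eq: "int (card (left_above x)) - int (card (above_left x)) =
      int (card (left_above y)) - int (card (above_left y))" for x y
  proof -
    note mono = first_only_mono[OF x y px]
    have "card (left_above y) \<le> card (left_above x)" "card (above_left x) \<le> card (above_left y)"
      using mono by (auto intro: card_mono)
    then have "card (left_above y) = card (left_above x)" "card (above_left x) = card (above_left y)"
      using eq by linarith+
    then have "left_above y = left_above x" "above_left x = above_left y"
      using card_subset_eq[OF finite_sets(1) mono(1)] card_subset_eq[OF finite_sets(2) mono(2)]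
      by blast+
    then have "x = y" using inner_nbrs_first_only x y by (intro first_only_eqI) auto
    then show False using px by simp
  qed
  then show ?thesis
    using p_neq first_onlyD(1) by (intro inj_onI) (metis DiffE linorder_neqE)
qed

lemma card_first_only_le:
  "card {x \<in> first_only. card (inner_nbrs x) \<le> k} \<le> 2 * k + 1"
proof -
  let ?X = "{x \<in> first_only. card (inner_nbrs x) \<le> k}"
  let ?d = "\<lambda>x. int (card (left_above x)) - int (card (above_left x))"
  have "card ?X = card (?d ` ?X)"
    by (rule card_image[symmetric], rule inj_on_subset[OF inj_on_difference]) auto
  also have "\<dots> \<le> card {- int k..int k}"
  proof (rule card_mono)
    have "card (left_above x) \<le> k \<and> card (above_left x) \<le> k" if "x \<in> ?X" for x
    proof -
      have "left_above x \<subseteq> inner_nbrs x" "above_left x \<subseteq> inner_nbrs x"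
        using inner_nbrs_first_only that by auto
      then have "card (left_above x) \<le> card (inner_nbrs x)" "card (above_left x) \<le> card (inner_nbrs x)"
        by (auto intro: card_mono)
      then show ?thesis using that by auto
    qed
    then show "?d ` ?X \<subseteq> {- int k..int k}" by force
  qed simp
  finally show ?thesis by simp
qed

text \<open>
  If \<open>M\<close> differs from \<open>f\<close>, it lies to the upper right of these points, which forces all
  inner neighbours to be left of \<open>m\<close>.  The neighbourhoods then form a strictly decreasing
  chain, so different points have different numbers of inner neighbours.
\<close>

lemma card_first_only_le_if_distinct:
  assumes "f \<noteq> M"
  shows "card {x \<in> first_only. 1 \<le> card (inner_nbrs x) \<and> card (inner_nbrs x) \<le> k} \<le> k"
proof -
  let ?X = "{x \<in> first_only. 1 \<le> card (inner_nbrs x) \<and> card (inner_nbrs x) \<le> k}"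
  have nbrs: "inner_nbrs x = left_above x" if x: "x \<in> first_only" for x
  proof -
    note xD = first_onlyD[OF x] and xe = inner_extreme[OF first_onlyD(1)[OF x]]
    have "y \<in> left_above x" if y: "y \<in> above_left x" for y
    proof -
      have yS: "y \<in> S - hubs" and vy: "v l < v y" "p y < p x" using y by (auto simp: above_left_def)
      have "\<not> p m < p y"
        using avoids[of m y x M] hubs_in yS vy xD xe inner_extreme[OF yS] assms(1) by auto
      then have "p y < p m" using p_neq[of y m] hubs_in yS by (auto simp: hubs_def)
      then show ?thesis using yS vy xD by (auto simp: left_above_def)
    qed
    then show ?thesis using inner_nbrs_first_only[OF x] by auto
  qed
  have inj: "inj_on (\<lambda>x. card (inner_nbrs x)) first_only"
  proof -
    have False if x: "x \<in> first_only" and y: "y \<in> first_only" and px: "p x < p y"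
      and eq: "card (inner_nbrs x) = card (inner_nbrs y)" for x y
    proof -
      have "inner_nbrs y \<subseteq> inner_nbrs x" using first_only_mono(1)[OF x y px] nbrs x y by simp
      then have "inner_nbrs y = inner_nbrs x" using eq by (intro card_subset_eq) auto
      then have "x = y" using x y by (intro first_only_eqI) auto
      then show False using px by simp
    qed
    then show ?thesis
      using p_neq first_onlyD(1) by (intro inj_onI) (metis DiffE linorder_neqE)
  qed
  have "card ?X = card ((\<lambda>x. card (inner_nbrs x)) ` ?X)"
    by (rule card_image[symmetric], rule inj_on_subset[OF inj]) auto
  also have "\<dots> \<le> card {1..k}"
    by (rule card_mono) auto
  finally show ?thesis by simp
qed

end

lemma avoiding_points_of_perm:
  assumes iav: "indecomposable_avoider \<sigma>" and red: "reduced \<sigma>"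
    and m: "m < length \<sigma>" "\<sigma> ! m = 1" and M: "M < length \<sigma>" "\<sigma> ! M = length \<sigma>"
  shows "avoiding_points int (\<lambda>i. int (\<sigma> ! i)) {..<length \<sigma>} 0 m (length \<sigma> - 1) M"
    and "\<And>x y. x < length \<sigma> \<Longrightarrow> y < length \<sigma> \<Longrightarrow>
      inverted int (\<lambda>i. int (\<sigma> ! i)) x y \<longleftrightarrow> y \<in> nbrs \<sigma> x"
proof -
  have perm: "is_perm \<sigma>" and av: "avoids_1324 \<sigma>" and s2: "2 \<le> length \<sigma>"
    using iav by (auto simp: indecomposable_avoider_def)
  show inv: "inverted int (\<lambda>i. int (\<sigma> ! i)) x y \<longleftrightarrow> y \<in> nbrs \<sigma> x"
    if "x < length \<sigma>" "y < length \<sigma>" for x y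
    using that by (auto simp: inverted_def nbrs_iff)
  show "avoiding_points int (\<lambda>i. int (\<sigma> ! i)) {..<length \<sigma>} 0 m (length \<sigma> - 1) M"
  proof
    show "inj_on (\<lambda>i. int (\<sigma> ! i)) {..<length \<sigma>}"
      using is_perm_nth_eq_iff[OF perm] by (auto simp: inj_on_def)
    show False if "a \<in> {..<length \<sigma>}" "b \<in> {..<length \<sigma>}" "c \<in> {..<length \<sigma>}" "d \<in> {..<length \<sigma>}"
      "int a < int b" "int b < int c" "int c < int d"
      "int (\<sigma> ! a) < int (\<sigma> ! c)" "int (\<sigma> ! c) < int (\<sigma> ! b)" "int (\<sigma> ! b) < int (\<sigma> ! d)" for a b c d
      using avoidsD[OF av, of a b c d] that by simp
    show "x = y" if xy: "x \<in> {..<length \<sigma>}" "y \<in> {..<length \<sigma>}"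
      and same: "\<And>z. z \<in> {..<length \<sigma>} \<Longrightarrow>
        inverted int (\<lambda>i. int (\<sigma> ! i)) x z \<longleftrightarrow> inverted int (\<lambda>i. int (\<sigma> ! i)) y z" for x y
    proof -
      have "nbrs \<sigma> x = nbrs \<sigma> y"
      proof (rule set_eqI)
        fix z show "z \<in> nbrs \<sigma> x \<longleftrightarrow> z \<in> nbrs \<sigma> y"
        proof (cases "z < length \<sigma>")
          case True
          then show ?thesis using same[of z] inv[of x z] inv[of y z] xy by simp
        next
          case False
          then show ?thesis using nbrs_subset by blast
        qed
      qed
      then show ?thesis using reduced_no_twins[OF perm red av] xy by simp
    qed
    show "int (\<sigma> ! m) \<le> int (\<sigma> ! x)" if "x \<in> {..<length \<sigma>}" for x
      using is_perm_nth_bounds(1)[OF perm, of x] that m(2) by simp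
    show "int (\<sigma> ! x) \<le> int (\<sigma> ! M)" if "x \<in> {..<length \<sigma>}" for x
      using is_perm_nth_bounds(2)[OF perm, of x] that M(2) by simp
  qed (use m(1) M(1) s2 in auto)
qed

text \<open>
  Only the graph of \<open>\<sigma>\<close> enters the bound, and not the coordinates; so \<open>f\<close> can be any of the
  four extreme positions, with the coordinates transformed by a symmetry.
\<close>

lemma card_sole_hub_le:
  assumes pts: "avoiding_points p v {..<length \<sigma>} f m l M"
    and inv: "\<And>x y. x < length \<sigma> \<Longrightarrow> y < length \<sigma> \<Longrightarrow> inverted p v x y \<longleftrightarrow> y \<in> nbrs \<sigma> x"
    and I: "I = {f, m, l, M}"
  shows "card {x \<in> {..<length \<sigma>} - I. nbrs \<sigma> x \<inter> I = {f} \<and> 1 \<le> card (nbrs \<sigma> x - I) \<and> card (nbrs \<sigma> x - I) \<le> k}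
      \<le> (if f = M then 2 * k + 1 else k)"
proof -
  interpret avoiding_points p v "{..<length \<sigma>}" f m l M by (fact pts)
  have hubs: "hubs = I" by (simp add: hubs_def I)
  have IS: "I \<subseteq> {..<length \<sigma>}" using hubs_in I by simp
  have inner: "inner_nbrs x = nbrs \<sigma> x - I" if "x < length \<sigma>" for x
    using that inv[of x] nbrs_subset[of \<sigma> x] by (auto simp: inner_nbrs_def hubs)
  have only: "first_only = {x \<in> {..<length \<sigma>} - I. nbrs \<sigma> x \<inter> I = {f}}" (is "_ = ?R")
  proof -
    have "(inverted p v x f \<and> (\<forall>h\<in>I - {f}. \<not> inverted p v x h)) \<longleftrightarrow> nbrs \<sigma> x \<inter> I = {f}"
      if "x < length \<sigma>" for x
    proof -
      have "inverted p v x h \<longleftrightarrow> h \<in> nbrs \<sigma> x" if "h \<in> I" for h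
        using inv[of x h] \<open>x < length \<sigma>\<close> IS that by auto
      moreover have "f \<in> I" using I by simp
      ultimately show ?thesis by auto
    qed
    then show ?thesis by (auto simp: first_only_def hubs)
  qed
  let ?X = "{x \<in> {..<length \<sigma>} - I. nbrs \<sigma> x \<inter> I = {f} \<and> 1 \<le> card (nbrs \<sigma> x - I) \<and> card (nbrs \<sigma> x - I) \<le> k}"
  have X: "?X = {x \<in> first_only. 1 \<le> card (inner_nbrs x) \<and> card (inner_nbrs x) \<le> k}"
    using inner by (auto simp: only)
  show ?thesis
  proof (cases "f = M")
    case True
    have "card ?X \<le> card {x \<in> first_only. card (inner_nbrs x) \<le> k}"
      unfolding X by (rule card_mono) auto
    then show ?thesis using card_first_only_le[of k] True by simp
  next
    case False
    then show ?thesis unfolding X using card_first_only_le_if_distinct[of k] by simp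
  qed
qed

text \<open>
  Write \<open>h x\<close> for the weighted number of hub neighbours of a non-hub \<open>x\<close>, and \<open>d x\<close> for
  the number of its other neighbours.  Twice the number of inversions of \<open>\<sigma>[\<ell>]\<close> is the sum
  of \<open>2 h + d\<close> over the non-hubs plus the contribution \<open>E\<close> of pairs of hubs.  The deficit
  \<open>df x\<close> makes up for \<open>2 h + d\<close> falling short of 5, and the total deficit is bounded by a
  constant.
\<close>

lemma L_total_le:
  assumes iav: "indecomposable_avoider \<sigma>" and red: "reduced \<sigma>"
  shows "int (L_total \<sigma>) \<le> 2 * defect0 \<sigma> + 32"
proof -
  let ?s = "length \<sigma>"
  have perm: "is_perm \<sigma>" and av: "avoids_1324 \<sigma>" and s2: "2 \<le> ?s"
    using iav by (auto simp: indecomposable_avoider_def)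
  obtain m where m: "m < ?s" "\<sigma> ! m = 1" using is_perm_obtain_position[OF perm, of 1] s2 by auto
  obtain M where M: "M < ?s" "\<sigma> ! M = ?s" using is_perm_obtain_position[OF perm, of ?s] s2 by auto
  define l where "l = ?s - 1"
  define I where "I = I_set \<sigma>"
  define R where "R = {..<?s} - I"
  define N where "N x = nbrs \<sigma> x" for x
  define h where "h x = (\<Sum>y\<in>N x \<inter> I. ell \<sigma> y)" for x
  define d where "d x = card (N x - I)" for x
  define only where "only j k = {x \<in> R. N x \<inter> I = {j} \<and> 1 \<le> d x \<and> d x \<le> k}" for j k
  define flat where "flat = {x \<in> R. N x \<subseteq> I \<and> card (N x) \<in> {1, 2}}"
  have I: "I = {0, l, m, M}" unfolding I_def l_def by (rule I_set_eq[OF perm _ m M]) (use s2 in linarith)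
  have finI: "finite I" and IS: "I \<subseteq> {..<?s}" using I m M s2 by (auto simp: l_def)
  have finR: "finite R" by (simp add: R_def)
  have split: "{..<?s} = I \<union> R" "I \<inter> R = {}" using IS by (auto simp: R_def)
  have finN: "finite (N x)" and NS: "N x \<subseteq> {..<?s}" for x using nbrs_subset by (auto simp: N_def)
  have ell1: "ell \<sigma> x = 1" if "x \<notin> I" for x using that by (auto simp: ell_def D_set_def I_def)
  have sumN: "(\<Sum>y\<in>N x. ell \<sigma> y) = h x + d x" for x
  proof -
    have "(\<Sum>y\<in>N x. ell \<sigma> y) = (\<Sum>y\<in>N x \<inter> I. ell \<sigma> y) + (\<Sum>y\<in>N x - I. ell \<sigma> y)"
      by (rule sum.Int_Diff) (rule finN)
    also have "(\<Sum>y\<in>N x - I. ell \<sigma> y) = (\<Sum>y\<in>N x - I. 1)" using ell1 by (intro sum.cong) auto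
    finally show ?thesis by (simp add: h_def d_def)
  qed
  have hd: "2 \<le> h x + d x" if "x < ?s" for x
  proof -
    have "0 \<le> int (\<Sum>y\<in>N x. ell \<sigma> y) - 2"
      using a_coeff_nonneg[OF iav that] by (simp add: a_coeff_def N_def)
    then show ?thesis unfolding sumN by linarith
  qed
  note pts = avoiding_points_of_perm[OF iav red m M, folded l_def]
  have inv_iff: "inverted int (\<lambda>i. int (\<sigma> ! i)) x y \<longleftrightarrow> y \<in> N x" if "x < ?s" "y < ?s" for x y
    using pts(2)[OF that] by (simp add: N_def)
  interpret A: avoiding_points int "\<lambda>i. int (\<sigma> ! i)" "{..<?s}" 0 m l M by (fact pts(1))
  interpret C: avoiding_points "\<lambda>i. - int i" "\<lambda>i. - int (\<sigma> ! i)" "{..<?s}" l M 0 m by (rule A.reverse)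
  have h1: "1 \<le> h x" if x: "x \<in> R" for x
  proof -
    have xs: "x < ?s" using x by (simp add: R_def)
    obtain y where y: "y \<in> N x" using nbrs_nonempty[OF iav xs] by (auto simp: N_def)
    have "A.hubs = I" using I by (auto simp: A.hubs_def)
    moreover have "inverted int (\<lambda>i. int (\<sigma> ! i)) x y" using inv_iff[OF xs, of y] y NS by blast
    ultimately obtain j where j: "j \<in> I" "inverted int (\<lambda>i. int (\<sigma> ! i)) x j"
      using A.inverted_hub_exists[of x y] x y NS by (auto simp: R_def)
    then have "j \<in> N x \<inter> I" using inv_iff[OF xs, of j] IS by auto
    then have "ell \<sigma> j \<le> h x" unfolding h_def by (intro member_le_sum) (use finN in auto)
    then show ?thesis using ell_pos[of \<sigma> j] by simp
  qed
  have m0: "m \<in> N 0" "0 \<noteq> m"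
  proof -
    have "0 < ?s" using s2 by linarith
    then obtain y where y: "y \<in> N 0" using nbrs_nonempty[OF iav] unfolding N_def by blast
    then have "\<sigma> ! y < \<sigma> ! 0" "y < ?s" by (auto simp: N_def nbrs_iff)
    then have "1 < \<sigma> ! 0" using is_perm_nth_bounds(1)[OF perm, of y] by simp
    then show "0 \<noteq> m" using m(2) less_irrefl by metis
    then show "m \<in> N 0" using m \<open>1 < \<sigma> ! 0\<close> by (simp add: N_def nbrs_iff)
  qed
  have Ml: "M \<in> N l" "l \<noteq> M"
  proof -
    have "l < ?s" using s2 unfolding l_def by linarith
    then obtain y where y: "y \<in> N l" using nbrs_nonempty[OF iav] unfolding N_def by blast
    then have "\<sigma> ! l < \<sigma> ! y" "y < ?s" by (auto simp: N_def nbrs_iff l_def)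
    then have less: "\<sigma> ! l < ?s" using is_perm_nth_bounds(2)[OF perm, of y] by simp
    then show "l \<noteq> M" using M(2) less_irrefl by metis
    then have "M < l" using M(1) by (simp add: l_def)
    then show "M \<in> N l" using M less s2 by (simp add: N_def nbrs_iff l_def)
  qed
  have only_le: "card (only 0 k) \<le> (if 0 = M then 2 * k + 1 else k)"
    "card (only m k) \<le> (if m = l then 2 * k + 1 else k)"
    "card (only l k) \<le> (if l = m then 2 * k + 1 else k)"
    "card (only M k) \<le> (if M = 0 then 2 * k + 1 else k)" for k
  proof -
    have inv2: "inverted (\<lambda>i. int (\<sigma> ! i)) int x y \<longleftrightarrow> y \<in> nbrs \<sigma> x"
      "inverted (\<lambda>i. - int i) (\<lambda>i. - int (\<sigma> ! i)) x y \<longleftrightarrow> y \<in> nbrs \<sigma> x"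
      "inverted (\<lambda>i. - int (\<sigma> ! i)) (\<lambda>i. - int i) x y \<longleftrightarrow> y \<in> nbrs \<sigma> x"
      if "x < ?s" "y < ?s" for x y
      using pts(2)[OF that] inverted_uminus[of int "\<lambda>i. int (\<sigma> ! i)"]
        inverted_swap[of "\<lambda>i. int (\<sigma> ! i)" int]
        inverted_swap[of "\<lambda>i. - int (\<sigma> ! i)" "\<lambda>i. - int i"] by simp_all
    show "card (only 0 k) \<le> (if 0 = M then 2 * k + 1 else k)"
      unfolding only_def R_def N_def d_def
      by (rule card_sole_hub_le[OF pts(1) pts(2)]) (auto simp: I)
    show "card (only m k) \<le> (if m = l then 2 * k + 1 else k)"
      unfolding only_def R_def N_def d_def
      by (rule card_sole_hub_le[OF A.swap inv2(1)]) (auto simp: I)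
    show "card (only l k) \<le> (if l = m then 2 * k + 1 else k)"
      unfolding only_def R_def N_def d_def
      by (rule card_sole_hub_le[OF A.reverse inv2(2)]) (auto simp: I)
    show "card (only M k) \<le> (if M = 0 then 2 * k + 1 else k)"
      unfolding only_def R_def N_def d_def
      by (rule card_sole_hub_le[OF C.swap inv2(3)]) (auto simp: I)
  qed
  have flat_le: "card flat \<le> card I + (card I choose 2)"
  proof -
    have "card flat = card (N ` flat)"
      by (rule card_image[symmetric], rule inj_onI)
        (use reduced_no_twins[OF perm red av] in \<open>auto simp: flat_def N_def R_def\<close>)
    also have "\<dots> \<le> card ({B. B \<subseteq> I \<and> card B = 1} \<union> {B. B \<subseteq> I \<and> card B = 2})"
      by (rule card_mono) (use finI in \<open>auto simp: flat_def\<close>)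
    also have "\<dots> \<le> card I + (card I choose 2)"
      using card_Un_le[of "{B. B \<subseteq> I \<and> card B = 1}" "{B. B \<subseteq> I \<and> card B = 2}"]
        n_subsets[OF finI, of 1] n_subsets[OF finI, of 2] by simp
    finally show ?thesis .
  qed
  define ind :: "nat set \<Rightarrow> nat \<Rightarrow> nat" where "ind A x = (if x \<in> A then 1 else 0)" for A x
  \<comment> \<open>A position in \<open>only j 1\<close> is counted twice, because it is also in \<open>only j 2\<close>; its
    contribution 3 is short of 5 by 2.\<close>
  define df where "df x = ind flat x + (\<Sum>j\<in>I. ind (only j 1) x + ind (only j 2) x)" for x
  have local: "5 \<le> 2 * h x + d x + df x" if x: "x \<in> R" for x
  proof -
    have xs: "x < ?s" using x by (simp add: R_def)
    have card_le_h: "card (N x \<inter> I) \<le> h x"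
      unfolding h_def using sum_mono[of "N x \<inter> I" "\<lambda>_. 1" "ell \<sigma>"] ell_pos by simp
    consider "3 \<le> h x" | "h x = 2" "1 \<le> d x" | "h x = 2" "d x = 0" | "h x = 1"
      using h1[OF x] by linarith
    then show ?thesis
    proof cases
      case 3
      then have sub: "N x \<subseteq> I" using finN by (simp add: d_def)
      then have "card (N x) \<le> 2" using card_le_h 3 by (simp add: Int_absorb2)
      moreover have "card (N x) \<noteq> 0" using nbrs_nonempty[OF iav xs] finN by (simp add: N_def)
      ultimately have "x \<in> flat" using x sub by (auto simp: flat_def)
      then show ?thesis using 3 by (simp add: df_def ind_def)
    next
      case 4
      have "card (N x \<inter> I) \<noteq> 0"
      proof
        assume "card (N x \<inter> I) = 0"
        then have "N x \<inter> I = {}" using finN by simp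
        then show False using 4 by (simp add: h_def)
      qed
      then have "card (N x \<inter> I) = 1" using card_le_h 4 by linarith
      then obtain j where j: "N x \<inter> I = {j}" by (auto simp: card_1_singleton_iff)
      then have jI: "j \<in> I" by blast
      have "ind (only j 1) x + ind (only j 2) x \<le> (\<Sum>j\<in>I. ind (only j 1) x + ind (only j 2) x)"
        by (rule member_le_sum[OF jI]) (use finI in auto)
      moreover have "d x \<ge> 3 \<or> d x = 2 \<or> d x = 1" using hd[OF xs] 4 by linarith
      ultimately show ?thesis using 4 j x by (auto simp: df_def ind_def only_def)
    qed auto
  qed
  have sum_ind: "(\<Sum>x\<in>R. ind A x) = card A" if "A \<subseteq> R" for A
    using that finR by (simp add: ind_def sum.If_cases Int_absorb1)
  have sum_df: "(\<Sum>x\<in>R. df x) = card flat + (\<Sum>j\<in>I. card (only j 1) + card (only j 2))"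
  proof -
    have sub: "flat \<subseteq> R" "\<And>j k. only j k \<subseteq> R" by (auto simp: flat_def only_def)
    have "(\<Sum>x\<in>R. df x) = (\<Sum>x\<in>R. ind flat x) +
        (\<Sum>j\<in>I. \<Sum>x\<in>R. ind (only j 1) x + ind (only j 2) x)"
      unfolding df_def sum.distrib[of _ "\<lambda>x. \<Sum>j\<in>I. ind (only j 1) x + ind (only j 2) x"]
      by (subst sum.swap) simp
    then show ?thesis using sub by (simp add: sum.distrib sum_ind)
  qed
  define E where "E = (\<Sum>x\<in>I. \<Sum>y\<in>N x \<inter> I. ell \<sigma> x * ell \<sigma> y)"
  define W where "W = (\<Sum>x\<in>I. ell \<sigma> x)"
  have L: "L_total \<sigma> = card R + W"
  proof -
    have "L_total \<sigma> = (\<Sum>x\<in>I. ell \<sigma> x) + (\<Sum>x\<in>R. ell \<sigma> x)"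
      unfolding L_total_def split(1) by (rule sum.union_disjoint) (use finI finR split in auto)
    also have "(\<Sum>x\<in>R. ell \<sigma> x) = (\<Sum>x\<in>R. 1)" using ell1 by (intro sum.cong) (auto simp: R_def)
    finally show ?thesis by (simp add: W_def)
  qed
  have inversions2: "2 * inversions (inflate \<sigma> (ell \<sigma>)) = (\<Sum>x\<in>R. 2 * h x + d x) + E"
  proof -
    have "2 * inversions (inflate \<sigma> (ell \<sigma>)) = (\<Sum>(x, y)\<in>Inv \<sigma>. ell \<sigma> x * ell \<sigma> y + ell \<sigma> y * ell \<sigma> x)"
      using inversions_inflate[OF perm, of "ell \<sigma>"] ell_pos
      by (simp add: sum_distrib_left case_prod_unfold mult.commute mult_2)
    also have "\<dots> = (\<Sum>x<?s. \<Sum>y\<in>N x. ell \<sigma> x * ell \<sigma> y)"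
      unfolding N_def by (rule sum_nbrs_eq_sum_Inv[symmetric])
    also have "\<dots> = (\<Sum>x\<in>I. \<Sum>y\<in>N x. ell \<sigma> x * ell \<sigma> y) + (\<Sum>x\<in>R. \<Sum>y\<in>N x. ell \<sigma> x * ell \<sigma> y)"
      unfolding split(1) by (rule sum.union_disjoint) (use finI finR split in auto)
    also have "(\<Sum>x\<in>R. \<Sum>y\<in>N x. ell \<sigma> x * ell \<sigma> y) = (\<Sum>x\<in>R. h x + d x)"
      by (rule sum.cong) (use ell1 sumN in \<open>auto simp: R_def\<close>)
    also have "(\<Sum>x\<in>I. \<Sum>y\<in>N x. ell \<sigma> x * ell \<sigma> y) = E + (\<Sum>x\<in>I. \<Sum>y\<in>N x - I. ell \<sigma> x * ell \<sigma> y)"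
      unfolding E_def sum.distrib[symmetric] by (intro sum.cong refl sum.Int_Diff finN)
    also have "(\<Sum>x\<in>I. \<Sum>y\<in>N x - I. ell \<sigma> x * ell \<sigma> y) = (\<Sum>x\<in>I. \<Sum>y | y \<in> R \<and> y \<in> N x. ell \<sigma> x)"
    proof (rule sum.cong[OF refl])
      fix x show "(\<Sum>y\<in>N x - I. ell \<sigma> x * ell \<sigma> y) = (\<Sum>y | y \<in> R \<and> y \<in> N x. ell \<sigma> x)"
        by (rule sum.cong) (use ell1 NS[of x] in \<open>auto simp: R_def\<close>)
    qed
    also have "\<dots> = (\<Sum>y\<in>R. \<Sum>x | x \<in> I \<and> y \<in> N x. ell \<sigma> x)"
      by (rule sum.swap_restrict[OF finI finR])
    also have "\<dots> = (\<Sum>y\<in>R. h y)"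
    proof (rule sum.cong[OF refl])
      fix y have "{x. x \<in> I \<and> y \<in> N x} = N y \<inter> I" using nbrs_sym by (auto simp: N_def)
      then show "(\<Sum>x | x \<in> I \<and> y \<in> N x. ell \<sigma> x) = h y" by (simp add: h_def)
    qed
    finally show ?thesis by (simp add: sum.distrib mult_2)
  qed
  have global: "5 * card R + E \<le> 2 * inversions (inflate \<sigma> (ell \<sigma>)) + (\<Sum>x\<in>R. df x)"
  proof -
    have "(\<Sum>x\<in>R. 5) \<le> (\<Sum>x\<in>R. 2 * h x + d x + df x)" by (rule sum_mono) (rule local)
    then show ?thesis unfolding inversions2 by (simp add: sum.distrib)
  qed
  have core: "int (L_total \<sigma>) \<le> 2 * defect0 \<sigma> + int (\<Sum>x\<in>R. df x) + 5 * int W - int E - 14"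
  proof -
    have "2 * defect0 \<sigma> = 2 * int (inversions (inflate \<sigma> (ell \<sigma>))) - 4 * int (L_total \<sigma>) + 14"
      by (simp add: defect0_def defect_def length_inflate L_total_def)
    then show ?thesis using global L by linarith
  qed
  show ?thesis
  proof (cases "0 = M \<or> l = m")
    case True
    then have cardI: "card I \<le> 3" unfolding I by (auto simp: card_insert_if)
    have "W \<le> (\<Sum>x\<in>I. 2)" unfolding W_def by (rule sum_mono) (rule ell_le_2)
    then have W: "W \<le> 6" using cardI by simp
    have "card flat \<le> 6"
    proof -
      have "card I = 0 \<or> card I = 1 \<or> card I = 2 \<or> card I = 3" using cardI by linarith
      then show ?thesis using flat_le by (auto simp: numeral_2_eq_2 numeral_3_eq_3)
    qed
    \<comment> \<open>Two hubs coincide, say at \<open>k\<close>.  Then every other position is adjacent to \<open>k\<close>, so only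
      \<open>k\<close> can be a sole hub neighbour.\<close>
    moreover have "(\<Sum>j\<in>I. card (only j 1) + card (only j 2)) \<le> 8"
    proof -
      obtain k where k: "k = 0 \<or> k = l" "\<And>x. x \<in> R \<Longrightarrow> k \<in> N x"
      proof (cases "0 = M")
        case True
        have "0 \<in> N x" if x: "x \<in> R" for x
        proof -
          have x': "0 < x" "x < ?s" using x by (auto simp: R_def I)
          have s0: "0 < ?s" using s2 by linarith
          have "\<sigma> ! x \<le> \<sigma> ! 0" "\<sigma> ! x \<noteq> \<sigma> ! 0"
            using is_perm_nth_bounds(2)[OF perm x'(2)] True M(2) is_perm_nth_eq_iff[OF perm x'(2) s0] x'(1)
            by simp_all
          then show ?thesis using x' by (simp add: N_def nbrs_iff)
        qed
        then show ?thesis using that[of 0] by simp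
      next
        case False
        then have lm: "l = m" using \<open>0 = M \<or> l = m\<close> by simp
        have "l \<in> N x" if x: "x \<in> R" for x
        proof -
          have x': "x < l" "x < ?s" using x by (auto simp: R_def I l_def)
          then have "\<sigma> ! l \<le> \<sigma> ! x" "\<sigma> ! x \<noteq> \<sigma> ! l"
            using is_perm_nth_bounds(1)[OF perm x'(2)] lm m is_perm_nth_eq_iff[OF perm x'(2) m(1)]
            by auto
          then show ?thesis using x' lm m(1) by (simp add: N_def nbrs_iff)
        qed
        then show ?thesis using that[of l] by simp
      qed
      have kI: "k \<in> I" using k(1) I by auto
      have "only j i = {}" if "j \<noteq> k" for i j
      proof -
        have "N x \<inter> I \<noteq> {j}" if "x \<in> R" for x
        proof
          assume "N x \<inter> I = {j}"
          moreover have "k \<in> N x \<inter> I" using k(2)[OF that] kI by simp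
          ultimately show False using \<open>j \<noteq> k\<close> by simp
        qed
        then show ?thesis unfolding only_def by blast
      qed
      then have "(\<Sum>j\<in>I. card (only j 1) + card (only j 2)) = (\<Sum>j\<in>{k}. card (only j 1) + card (only j 2))"
        using kI finI by (intro sum.mono_neutral_right) auto
      also have "\<dots> \<le> 8"
        using k(1) only_le(1)[of 1] only_le(1)[of 2] only_le(3)[of 1] only_le(3)[of 2]
        by (auto split: if_splits)
      finally show ?thesis .
    qed
    ultimately show ?thesis using core W sum_df by linarith
  next
    case False
    then have ne: "0 \<noteq> M" "l \<noteq> m" by auto
    have l0: "l \<noteq> 0" using s2 by (simp add: l_def)
    have mM: "m \<noteq> M" using m(2) M(2) s2 by auto
    have sum_I: "(\<Sum>j\<in>I. c j) = c 0 + c m + c l + c M" for c :: "nat \<Rightarrow> nat"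
      using ne l0 mM m0(2) Ml(2) by (simp add: I)
    have "card I = 4" using ne l0 mM m0(2) Ml(2) by (simp add: I)
    then have "card flat \<le> 10" using flat_le by (simp add: numeral_eq_Suc)
    moreover have "(\<Sum>j\<in>I. card (only j 1) + card (only j 2)) \<le> 12"
      unfolding sum_I
      using only_le(1)[of 1] only_le(1)[of 2] only_le(2)[of 1] only_le(2)[of 2]
        only_le(3)[of 1] only_le(3)[of 2] only_le(4)[of 1] only_le(4)[of 2] ne by auto
    \<comment> \<open>With four hubs, the edges between the first and the smallest and between the last and the largest
      entry compensate for the weight of the hubs in \<open>L\<close>.\<close>
    moreover have "5 * W \<le> E + 24"
    proof -
      have bnd: "ell \<sigma> x * ell \<sigma> y \<le> (\<Sum>y\<in>N x \<inter> I. ell \<sigma> x * ell \<sigma> y)" if "y \<in> N x" "y \<in> I" for x y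
        by (rule member_le_sum) (use that finN in auto)
      have "0 \<in> N m" "l \<in> N M" using m0(1) Ml(1) nbrs_sym by (auto simp: N_def)
      then have "E \<ge> ell \<sigma> 0 * ell \<sigma> m + ell \<sigma> m * ell \<sigma> 0 + ell \<sigma> l * ell \<sigma> M + ell \<sigma> M * ell \<sigma> l"
        unfolding E_def sum_I using bnd[OF m0(1)] bnd[OF Ml(1)] bnd[of 0 m] bnd[of l M]
        by (simp add: I add_mono)
      moreover have pair: "5 * (ell \<sigma> x + ell \<sigma> y) \<le> ell \<sigma> x * ell \<sigma> y + ell \<sigma> y * ell \<sigma> x + 12" for x y
        by (simp add: ell_def)
      have "5 * (ell \<sigma> 0 + ell \<sigma> m + ell \<sigma> l + ell \<sigma> M) \<le> ell \<sigma> 0 * ell \<sigma> m + ell \<sigma> m * ell \<sigma> 0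
          + ell \<sigma> l * ell \<sigma> M + ell \<sigma> M * ell \<sigma> l + 24"
        using add_mono[OF pair[of 0 m] pair[of l M]] by simp
      ultimately show ?thesis unfolding W_def sum_I by (rule order.trans[rotated, OF add_right_mono])
    qed
    ultimately show ?thesis using core sum_df by linarith
  qed
qed

section \<open>Counting the inflations of a fixed reduced permutation\<close>

text \<open>
  Every \<open>i \<in> T\<close> contributes at least \<open>x\<^sub>i\<close> to twice the form: through the linear term
  if \<open>a\<^sub>i \<ge> 1\<close>, and otherwise through an edge to a neighbour in the support.  That
  neighbour lies in \<open>T\<close>, since positions of \<open>F\<close> have no neighbours there.
\<close>

lemma triples_sum_le:
  assumes iav: "indecomposable_avoider \<sigma>" and tr: "(T, x, F) \<in> triples \<delta> \<sigma>"
  shows "int (\<Sum>i\<in>T. x i) \<le> 2 * (\<delta> - defect0 \<sigma>)"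
proof -
  let ?s = "length \<sigma>"
  define y where "y = zero_ext T x"
  have T: "T \<subseteq> {..<?s}" and pos: "\<And>i. i \<in> T \<Longrightarrow> 1 \<le> x i"
    and Q: "Q_form \<sigma> y = \<delta> - defect0 \<sigma>"
    and F: "\<And>i. i \<in> F \<Longrightarrow> nbrs \<sigma> i \<inter> (T \<union> F) = {}"
    and act: "\<And>i. i \<in> T \<Longrightarrow> a_coeff \<sigma> i \<ge> 1 \<or> nbrs \<sigma> i \<inter> (T \<union> F) \<noteq> {}"
    using tr by (auto simp: triples_def y_def)
  have each: "int (y i) \<le> 2 * (a_coeff \<sigma> i * int (y i)) + (\<Sum>j\<in>nbrs \<sigma> i. int (y i) * int (y j))"
    if i: "i < ?s" for i
  proof (cases "i \<in> T")
    case True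
    have nonneg: "0 \<le> (\<Sum>j\<in>nbrs \<sigma> i. int (y i) * int (y j))" by (intro sum_nonneg) simp
    have a: "0 \<le> a_coeff \<sigma> i" by (rule a_coeff_nonneg[OF iav i])
    show ?thesis
    proof (cases "a_coeff \<sigma> i \<ge> 1")
      case True
      then have "1 * int (y i) \<le> a_coeff \<sigma> i * int (y i)" by (intro mult_right_mono) auto
      then show ?thesis using nonneg by simp
    next
      case False
      then obtain j where j: "j \<in> nbrs \<sigma> i" "j \<in> T \<union> F" using act[OF True] by blast
      have "j \<notin> F" using F[of j] j True nbrs_sym[of j \<sigma> i] by blast
      then have "1 \<le> y j" using j pos by (simp add: y_def zero_ext_def)
      then have "int (y i) * 1 \<le> int (y i) * int (y j)" by (intro mult_left_mono) auto
      also have "\<dots> \<le> (\<Sum>j\<in>nbrs \<sigma> i. int (y i) * int (y j))"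
        by (rule member_le_sum[OF j(1)]) auto
      also have "\<dots> \<le> 2 * (a_coeff \<sigma> i * int (y i)) + \<dots>" using a by simp
      finally show ?thesis by simp
    qed
  qed (simp add: y_def zero_ext_def)
  have "int (\<Sum>i\<in>T. x i) = (\<Sum>i<?s. int (y i))"
    using T by (simp add: y_def zero_ext_def sum.If_cases Int_absorb1 Int_absorb2 if_distrib[of int])
  also have "\<dots> \<le> (\<Sum>i<?s. 2 * (a_coeff \<sigma> i * int (y i)) + (\<Sum>j\<in>nbrs \<sigma> i. int (y i) * int (y j)))"
    by (intro sum_mono each) simp
  also have "\<dots> = 2 * Q_form \<sigma> y"
    unfolding sum.distrib sum_nbrs_eq_sum_Inv Q_form_def
    by (simp add: sum_distrib_left algebra_simps case_prod_unfold)
  finally show ?thesis using Q by simp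
qed

lemma finite_triples:
  assumes iav: "indecomposable_avoider \<sigma>"
  shows "finite (triples \<delta> \<sigma>)"
proof -
  let ?P = "Pow {..<length \<sigma>}" and ?h = "nat (2 * (\<delta> - defect0 \<sigma>))"
  have "triples \<delta> \<sigma> \<subseteq> ?P \<times> (\<Union>T\<in>?P. \<Pi>\<^sub>E i\<in>T. {1..?h}) \<times> ?P"
  proof
    fix z assume z: "z \<in> triples \<delta> \<sigma>"
    obtain T x F where TxF: "z = (T, x, F)" by (cases z)
    have tr: "(T, x, F) \<in> triples \<delta> \<sigma>" using z TxF by simp
    have T: "T \<subseteq> {..<length \<sigma>}" "F \<subseteq> {..<length \<sigma>}" and x: "x \<in> (\<Pi>\<^sub>E i\<in>T. {1..})"
      using tr by (auto simp: triples_def)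
    have fin: "finite T" using T by (auto intro: finite_subset)
    have "x i \<le> ?h" if "i \<in> T" for i
    proof -
      have "x i \<le> sum x T" using member_le_sum[OF that _ fin, of x] by simp
      then show ?thesis using triples_sum_le[OF iav tr] by linarith
    qed
    then have "x \<in> (\<Pi>\<^sub>E i\<in>T. {1..?h})" using x by (auto simp: PiE_iff)
    then show "z \<in> ?P \<times> (\<Union>T\<in>?P. \<Pi>\<^sub>E i\<in>T. {1..?h}) \<times> ?P"
      unfolding TxF using T by blast
  qed
  moreover have "finite (?P \<times> (\<Union>T\<in>?P. \<Pi>\<^sub>E i\<in>T. {1..?h}) \<times> ?P)"
    by (intro finite_cartesian_product finite_UN_I finite_PiE) (auto intro: finite_subset)
  ultimately show ?thesis by (rule finite_subset)
qed

text \<open>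
  Induction on \<open>F\<close>, choosing the value at one point first; the sum of binomial coefficients is
  the hockey-stick identity.
\<close>

lemma card_compositions:
  assumes "finite F"
  shows "card {z \<in> (\<Pi>\<^sub>E i\<in>F. {1::nat..}). sum z F = N} =
    (if F = {} then (if N = 0 then 1 else 0)
     else if N = 0 then 0 else (N - 1) choose (card F - 1))"
  using assms
proof (induction F arbitrary: N rule: finite_induct)
  case empty
  then show ?case by simp
next
  case (insert a F)
  let ?C = "\<lambda>F N. {z \<in> (\<Pi>\<^sub>E i\<in>F. {1::nat..}). sum z F = N}"
  have fin: "finite (?C F N)" for N
  proof (rule finite_subset)
    show "?C F N \<subseteq> (\<Pi>\<^sub>E i\<in>F. {1..N})"
    proof
      fix z assume z: "z \<in> ?C F N"
      have "z i \<le> N" if "i \<in> F" for i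
        using member_le_sum[OF that _ insert.hyps(1), of z] z by simp
      then show "z \<in> (\<Pi>\<^sub>E i\<in>F. {1..N})" using z by (auto simp: PiE_iff)
    qed
  qed (use insert.hyps in \<open>auto intro: finite_PiE\<close>)
  have "bij_betw (\<lambda>(v, z). z(a := v)) (SIGMA v:{1..N}. ?C F (N - v)) (?C (insert a F) N)"
  proof (rule bij_betw_imageI)
    show "inj_on (\<lambda>(v, z). z(a := v)) (SIGMA v:{1..N}. ?C F (N - v))"
      by (rule inj_on_subset[OF inj_combinator[OF insert.hyps(2), of "\<lambda>_. {1::nat..}"]]) auto
    show "(\<lambda>(v, z). z(a := v)) ` (SIGMA v:{1..N}. ?C F (N - v)) = ?C (insert a F) N"
    proof (intro equalityI subsetI)
      fix y assume "y \<in> (\<lambda>(v, z). z(a := v)) ` (SIGMA v:{1..N}. ?C F (N - v))"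
      then obtain v z where vz: "v \<in> {1..N}" "z \<in> ?C F (N - v)" "y = z(a := v)" by auto
      have "sum (z(a := v)) F = sum z F" using insert.hyps(2) by (intro sum.cong) auto
      then show "y \<in> ?C (insert a F) N"
        using vz insert.hyps by (auto simp: PiE_iff extensional_def)
    next
      fix y assume y: "y \<in> ?C (insert a F) N"
      define z where "z = y(a := undefined)"
      have "sum z F = sum y F" using insert.hyps(2) unfolding z_def by (intro sum.cong) auto
      then have "y a \<in> {1..N}" "z \<in> ?C F (N - y a)"
        using y insert.hyps by (auto simp: z_def PiE_iff extensional_def)
      moreover have "y = z(a := y a)" by (simp add: z_def)
      ultimately show "y \<in> (\<lambda>(v, z). z(a := v)) ` (SIGMA v:{1..N}. ?C F (N - v))"
        by (intro image_eqI[of _ _ "(y a, z)"]) auto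
    qed
  qed
  then have "card (?C (insert a F) N) = card (SIGMA v:{1..N}. ?C F (N - v))"
    by (rule bij_betw_same_card[symmetric])
  also have "\<dots> = (\<Sum>v=1..N. card (?C F (N - v)))"
    by (rule card_SigmaI) (use fin in auto)
  also have "\<dots> = (\<Sum>k<N. card (?C F (N - Suc k)))"
    by (simp add: sum.atLeast1_atMost_eq)
  also have "\<dots> = (\<Sum>w<N. card (?C F w))"
    by (rule sum.nat_diff_reindex)
  also have "\<dots> = (if N = 0 then 0 else (N - 1) choose card F)"
  proof (cases N)
    case (Suc K)
    have "(\<Sum>w<Suc K. card (?C F w)) = card (?C F 0) + (\<Sum>w<K. card (?C F (Suc w)))"
      by (rule sum.lessThan_Suc_shift)
    also have "\<dots> = K choose card F"
    proof (cases "F = {}")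
      case True
      then show ?thesis unfolding insert.IH by simp
    next
      case False
      then obtain f where f: "card F = Suc f" using insert.hyps(1) by (cases "card F") auto
      have "(\<Sum>w<K. w choose f) = K choose Suc f"
        by (cases K) (simp_all add: sum_choose_upper lessThan_Suc_atMost)
      then show ?thesis unfolding insert.IH using False f by simp
    qed
    finally show ?thesis using Suc by simp
  qed simp
  finally show ?case using insert.hyps by simp
qed

lemma card_compositions_eq_binom_term:
  assumes "finite F"
  shows "card {z \<in> (\<Pi>\<^sub>E i\<in>F. {1::nat..}). m + sum z F = n} = binom_term n m (card F)"
proof (cases "m \<le> n")
  case True
  then have "{z \<in> (\<Pi>\<^sub>E i\<in>F. {1::nat..}). m + sum z F = n} =
      {z \<in> (\<Pi>\<^sub>E i\<in>F. {1::nat..}). sum z F = n - m}" by auto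
  then show ?thesis
    using True assms card_compositions[OF assms, of "n - m"] by (auto simp: binom_term_def)
next
  case False
  then have "{z \<in> (\<Pi>\<^sub>E i\<in>F. {1::nat..}). m + sum z F = n} = {}" by auto
  then have "card {z \<in> (\<Pi>\<^sub>E i\<in>F. {1::nat..}). m + sum z F = n} = 0" by (metis card.empty)
  then show ?thesis using False by (simp add: binom_term_def)
qed

lemma Q_form_ignores_free:
  assumes TF: "T \<inter> F = {}"
    and out: "\<And>i. i < length \<sigma> \<Longrightarrow> i \<notin> T \<union> F \<Longrightarrow> y i = 0"
    and free: "\<And>i. i \<in> F \<Longrightarrow> a_coeff \<sigma> i = 0 \<and> nbrs \<sigma> i \<inter> (T \<union> F) = {}"
    and yx: "\<And>i. i \<in> T \<Longrightarrow> y i = x i"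
  shows "Q_form \<sigma> y = Q_form \<sigma> (zero_ext T x)"
proof -
  have linear: "a_coeff \<sigma> i * int (y i) = a_coeff \<sigma> i * int (zero_ext T x i)" if "i < length \<sigma>" for i
  proof (cases "i \<in> F")
    case True
    then show ?thesis using free[of i] by simp
  next
    case False
    then show ?thesis using out[OF that] yx[of i] by (cases "i \<in> T") (auto simp: zero_ext_def)
  qed
  have edge: "int (y i) * int (y j) = int (zero_ext T x i) * int (zero_ext T x j)"
    if ij: "(i, j) \<in> Inv \<sigma>" for i j
  proof -
    have lt: "i < length \<sigma>" "j < length \<sigma>" using ij by (auto simp: Inv_def)
    have nb: "j \<in> nbrs \<sigma> i" "i \<in> nbrs \<sigma> j" using ij by (auto simp: nbrs_def)
    show ?thesis
    proof (cases "i \<in> T \<and> j \<in> T")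
      case False
      have "y i = 0 \<or> y j = 0"
      proof (cases "i \<in> T \<union> F \<and> j \<in> T \<union> F")
        case True
        then have "i \<in> F \<or> j \<in> F" using False by blast
        then show ?thesis
        proof
          assume "i \<in> F"
          from free[OF this] show ?thesis using nb(1) True by blast
        next
          assume "j \<in> F"
          from free[OF this] show ?thesis using nb(2) True by blast
        qed
      next
        case False
        then have "i \<notin> T \<union> F \<or> j \<notin> T \<union> F" by simp
        then show ?thesis using out[OF lt(1)] out[OF lt(2)] by auto
      qed
      then show ?thesis using False by (auto simp: zero_ext_def)
    qed (use yx in \<open>simp add: zero_ext_def\<close>)
  qed
  have "(\<Sum>(i, j)\<in>Inv \<sigma>. int (y i) * int (y j)) =
      (\<Sum>(i, j)\<in>Inv \<sigma>. int (zero_ext T x i) * int (zero_ext T x j))"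
  proof (rule sum.cong[OF refl])
    fix e assume e: "e \<in> Inv \<sigma>"
    obtain i j where ij: "e = (i, j)" by (cases e)
    show "(case e of (i, j) \<Rightarrow> int (y i) * int (y j)) =
        (case e of (i, j) \<Rightarrow> int (zero_ext T x i) * int (zero_ext T x j))"
      using edge[of i j] e unfolding ij by simp
  qed
  moreover have "(\<Sum>i<length \<sigma>. a_coeff \<sigma> i * int (y i)) =
      (\<Sum>i<length \<sigma>. a_coeff \<sigma> i * int (zero_ext T x i))"
    by (rule sum.cong[OF refl]) (rule linear, simp)
  ultimately show ?thesis unfolding Q_form_def by simp
qed

text \<open>
  \<open>F\<close> and \<open>T\<close> can be recovered from \<open>x\<close>: \<open>F\<close> consists of the positions in the
  support with \<open>a\<^sub>i = 0\<close> and no neighbour in the support, and \<open>T\<close> is the rest of the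
  support.  The conditions on triples say precisely that they arise in this way.
\<close>

lemma card_excesses:
  assumes iav: "indecomposable_avoider \<sigma>"
  shows "card (excesses \<delta> n \<sigma>) =
    (\<Sum>(T, x, F)\<in>triples \<delta> \<sigma>. binom_term n (L_total \<sigma> + (\<Sum>i\<in>T. x i)) (card F))"
proof -
  let ?s = "length \<sigma>"
  define Z :: "nat set \<times> (nat \<Rightarrow> nat) \<times> nat set \<Rightarrow> (nat \<Rightarrow> nat) set"
    where "Z = (\<lambda>(T, x, F). {z \<in> (\<Pi>\<^sub>E i\<in>F. {1::nat..}). L_total \<sigma> + (\<Sum>i\<in>T. x i) + sum z F = n})"
  define glue :: "(nat set \<times> (nat \<Rightarrow> nat) \<times> nat set) \<times> (nat \<Rightarrow> nat) \<Rightarrow> nat \<Rightarrow> nat"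
    where "glue = (\<lambda>((T, x, F), z). \<lambda>i\<in>{..<?s}. if i \<in> T then x i else if i \<in> F then z i else 0)"
  define supp where "supp y = {i. i < ?s \<and> 1 \<le> y i}" for y :: "nat \<Rightarrow> nat"
  define free where "free y = {i \<in> supp y. a_coeff \<sigma> i = 0 \<and> nbrs \<sigma> i \<inter> supp y = {}}" for y
  define cut where "cut y = ((supp y - free y, restrict y (supp y - free y), free y), restrict y (free y))"
    for y
  have total: "(\<Sum>i<?s. y i) = (\<Sum>i\<in>T. x i) + sum z F"
    if "T \<subseteq> {..<?s}" "F \<subseteq> {..<?s} - T" "\<And>i. i < ?s \<Longrightarrow> i \<notin> T \<union> F \<Longrightarrow> y i = 0"
      "\<And>i. i \<in> T \<Longrightarrow> y i = x i" "\<And>i. i \<in> F \<Longrightarrow> y i = z i" for T F and x y z :: "nat \<Rightarrow> nat"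
  proof -
    have fin: "finite T" "finite F" using that(1,2) by (auto intro: finite_subset)
    have "(\<Sum>i<?s. y i) = (\<Sum>i\<in>T \<union> F. y i)"
      using that(1-3) by (intro sum.mono_neutral_right) auto
    also have "\<dots> = (\<Sum>i\<in>T. y i) + (\<Sum>i\<in>F. y i)"
      using fin that(2) by (intro sum.union_disjoint) auto
    finally show ?thesis using that(4,5) by simp
  qed
  have "bij_betw glue (SIGMA tr:triples \<delta> \<sigma>. Z tr) (excesses \<delta> n \<sigma>)"
  proof (rule bij_betw_byWitness[where f' = cut])
    show "\<forall>w\<in>SIGMA tr:triples \<delta> \<sigma>. Z tr. cut (glue w) = w"
    proof
      fix w assume w: "w \<in> (SIGMA tr:triples \<delta> \<sigma>. Z tr)"
      obtain T x F z where w_eq: "w = ((T, x, F), z)" by (metis surj_pair)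
      have tr: "(T, x, F) \<in> triples \<delta> \<sigma>" and z: "z \<in> (\<Pi>\<^sub>E i\<in>F. {1::nat..})"
        using w by (auto simp: w_eq Z_def)
      have T: "T \<subseteq> {..<?s}" and F: "F \<subseteq> {..<?s} - T" and x: "x \<in> (\<Pi>\<^sub>E i\<in>T. {1..})"
        and Fp: "\<And>i. i \<in> F \<Longrightarrow> a_coeff \<sigma> i = 0 \<and> nbrs \<sigma> i \<inter> (T \<union> F) = {}"
        and Tp: "\<And>i. i \<in> T \<Longrightarrow> a_coeff \<sigma> i \<ge> 1 \<or> nbrs \<sigma> i \<inter> (T \<union> F) \<noteq> {}"
        using tr by (auto simp: triples_def)
      let ?y = "glue w"
      have y: "?y i = (if i \<in> T then x i else if i \<in> F then z i else 0)" if "i < ?s" for i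
        using that by (simp add: glue_def w_eq)
      have supp: "supp ?y = T \<union> F"
      proof (intro set_eqI)
        fix i show "i \<in> supp ?y \<longleftrightarrow> i \<in> T \<union> F"
          using y[of i] T F x z
          by (cases "i \<in> T"; cases "i \<in> F") (auto simp: supp_def PiE_iff)
      qed
      have free: "free ?y = F"
      proof (intro set_eqI)
        fix i show "i \<in> free ?y \<longleftrightarrow> i \<in> F"
          using Fp[of i] Tp[of i] by (auto simp: free_def supp)
      qed
      have TT: "supp ?y - F = T" using supp F by auto
      have "restrict ?y T = x"
      proof
        fix i show "restrict ?y T i = x i"
          using y[of i] T x by (cases "i \<in> T") (auto simp: PiE_iff extensional_def)
      qed
      moreover have "restrict ?y F = z"
      proof
        fix i show "restrict ?y F i = z i"
          using y[of i] F z by (cases "i \<in> F") (auto simp: PiE_iff extensional_def)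
      qed
      ultimately have "cut ?y = ((T, x, F), z)" by (simp add: cut_def TT free)
      then show "cut ?y = w" by (rule trans[OF _ w_eq[symmetric]])
    qed
    have facts: "supp y - free y \<subseteq> {..<?s}" "free y \<subseteq> {..<?s} - (supp y - free y)"
      "(supp y - free y) \<union> free y = supp y" for y
      by (auto simp: supp_def free_def)
    show "\<forall>y\<in>excesses \<delta> n \<sigma>. glue (cut y) = y"
    proof
      fix y assume "y \<in> excesses \<delta> n \<sigma>"
      then have y: "y \<in> (\<Pi>\<^sub>E i\<in>{..<?s}. UNIV)" by (simp add: excesses_def)
      show "glue (cut y) = y"
      proof
        fix i show "glue (cut y) i = y i"
          using y by (auto simp: glue_def cut_def free_def supp_def PiE_iff extensional_def)
      qed
    qed
    show "glue ` (SIGMA tr:triples \<delta> \<sigma>. Z tr) \<subseteq> excesses \<delta> n \<sigma>"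
    proof
      fix y assume "y \<in> glue ` (SIGMA tr:triples \<delta> \<sigma>. Z tr)"
      then obtain w where w: "w \<in> (SIGMA tr:triples \<delta> \<sigma>. Z tr)" "y = glue w" by blast
      obtain T x F z where w_eq: "w = ((T, x, F), z)" by (metis surj_pair)
      have tr: "(T, x, F) \<in> triples \<delta> \<sigma>"
        and z: "L_total \<sigma> + (\<Sum>i\<in>T. x i) + sum z F = n"
        using w by (auto simp: w_eq Z_def)
      have T: "T \<subseteq> {..<?s}" and F: "F \<subseteq> {..<?s} - T"
        and Q: "Q_form \<sigma> (zero_ext T x) = \<delta> - defect0 \<sigma>"
        and Fp: "\<And>i. i \<in> F \<Longrightarrow> a_coeff \<sigma> i = 0 \<and> nbrs \<sigma> i \<inter> (T \<union> F) = {}"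
        using tr by (auto simp: triples_def)
      have y: "y i = (if i \<in> T then x i else if i \<in> F then z i else 0)" if "i < ?s" for i
        using that by (simp add: glue_def w_eq w(2))
      have out: "y i = 0" if "i < ?s" "i \<notin> T \<union> F" for i using y[OF that(1)] that(2) by simp
      have yT: "y i = x i" if "i \<in> T" for i using y[of i] that T by auto
      have yF: "y i = z i" if "i \<in> F" for i using y[of i] that F by auto
      have "Q_form \<sigma> y = Q_form \<sigma> (zero_ext T x)"
        by (rule Q_form_ignores_free[of T F]) (use F out Fp yT in auto)
      moreover have "(\<Sum>i<?s. y i) = (\<Sum>i\<in>T. x i) + sum z F"
        by (rule total[OF T F out yT yF])
      moreover have "y \<in> (\<Pi>\<^sub>E i\<in>{..<?s}. UNIV)" by (simp add: glue_def w_eq w(2))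
      ultimately show "y \<in> excesses \<delta> n \<sigma>" using Q z by (simp add: excesses_def)
    qed
    show "cut ` excesses \<delta> n \<sigma> \<subseteq> (SIGMA tr:triples \<delta> \<sigma>. Z tr)"
    proof
      fix w assume "w \<in> cut ` excesses \<delta> n \<sigma>"
      then obtain y where y: "y \<in> excesses \<delta> n \<sigma>" and w: "w = cut y" by blast
      define F where "F = free y"
      define T where "T = supp y - F"
      have T: "T \<subseteq> {..<?s}" and F: "F \<subseteq> {..<?s} - T" and TF: "T \<union> F = supp y"
        using facts[of y] by (auto simp: T_def F_def)
      have w_eq: "w = ((T, restrict y T, F), restrict y F)" by (simp add: w cut_def T_def F_def)
      have out: "y i = 0" if "i < ?s" "i \<notin> T \<union> F" for i using that by (simp add: TF supp_def)
      have Fp: "a_coeff \<sigma> i = 0 \<and> nbrs \<sigma> i \<inter> (T \<union> F) = {}" if "i \<in> F" for i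
        using that by (simp add: TF) (simp add: F_def free_def)
      have Tp: "a_coeff \<sigma> i \<ge> 1 \<or> nbrs \<sigma> i \<inter> (T \<union> F) \<noteq> {}" if i: "i \<in> T" for i
      proof -
        have "i \<in> supp y" "i \<notin> free y" using i by (auto simp: T_def F_def)
        then have "a_coeff \<sigma> i \<noteq> 0 \<or> nbrs \<sigma> i \<inter> (T \<union> F) \<noteq> {}" unfolding TF by (auto simp: free_def)
        then show ?thesis using a_coeff_nonneg[OF iav, of i] T i by force
      qed
      have "Q_form \<sigma> y = Q_form \<sigma> (zero_ext T (restrict y T))"
        by (rule Q_form_ignores_free[of T F]) (use F out Fp in auto)
      moreover have pos: "1 \<le> y i" if "i \<in> T \<union> F" for i using that unfolding TF by (simp add: supp_def)
      ultimately have "(T, restrict y T, F) \<in> triples \<delta> \<sigma>"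
        using y T F Fp Tp by (auto simp: triples_def excesses_def)
      moreover have "(\<Sum>i<?s. y i) = (\<Sum>i\<in>T. restrict y T i) + sum (restrict y F) F"
        by (rule total[OF T F out]) auto
      then have "restrict y F \<in> Z (T, restrict y T, F)"
        using y pos by (auto simp: Z_def excesses_def)
      ultimately show "w \<in> (SIGMA tr:triples \<delta> \<sigma>. Z tr)" by (simp add: w_eq)
    qed
  qed
  then have "card (excesses \<delta> n \<sigma>) = card (SIGMA tr:triples \<delta> \<sigma>. Z tr)"
    by (rule bij_betw_same_card[symmetric])
  have finF: "finite F" if "(T, x, F) \<in> triples \<delta> \<sigma>" for T x F
    using that by (auto simp: triples_def intro: finite_subset)
  have finZ: "finite (Z tr)" if "tr \<in> triples \<delta> \<sigma>" for tr
  proof -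
    obtain T x F where tr: "tr = (T, x, F)" by (cases tr)
    have "Z tr \<subseteq> (\<Pi>\<^sub>E i\<in>F. {1..n})"
    proof
      fix z assume z: "z \<in> Z tr"
      have "z i \<le> n" if "i \<in> F" for i
      proof -
        have "z i \<le> sum z F" using member_le_sum[OF that, of z] finF[of T x F] \<open>tr \<in> triples \<delta> \<sigma>\<close> tr by simp
        then show ?thesis using z by (auto simp: Z_def tr)
      qed
      then show "z \<in> (\<Pi>\<^sub>E i\<in>F. {1..n})" using z by (auto simp: Z_def tr PiE_iff)
    qed
    moreover have "finite (\<Pi>\<^sub>E i\<in>F. {1..n})"
      using finF[of T x F] that tr by (intro finite_PiE) auto
    ultimately show ?thesis by (rule finite_subset)
  qed
  have "card (SIGMA tr:triples \<delta> \<sigma>. Z tr) = (\<Sum>tr\<in>triples \<delta> \<sigma>. card (Z tr))"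
    by (rule card_SigmaI) (use finite_triples[OF iav] finZ in auto)
  also have "\<dots> = (\<Sum>(T, x, F)\<in>triples \<delta> \<sigma>. binom_term n (L_total \<sigma> + (\<Sum>i\<in>T. x i)) (card F))"
  proof (rule sum.cong[OF refl])
    fix tr assume mem: "tr \<in> triples \<delta> \<sigma>"
    obtain T x F where tr: "tr = (T, x, F)" by (cases tr)
    have "finite F" using finF mem unfolding tr .
    from card_compositions_eq_binom_term[OF this, of "L_total \<sigma> + (\<Sum>i\<in>T. x i)" n]
    show "card (Z tr) = (case tr of (T, x, F) \<Rightarrow> binom_term n (L_total \<sigma> + (\<Sum>i\<in>T. x i)) (card F))"
      unfolding tr Z_def by simp
  qed
  finally show ?thesis using \<open>card (excesses \<delta> n \<sigma>) = _\<close> by simp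
qed

section \<open>Finitely many reduced permutations\<close>

lemma finite_bounded_perms: "finite {\<sigma>. is_perm \<sigma> \<and> length \<sigma> \<le> K}"
proof (rule finite_subset)
  show "{\<sigma>. is_perm \<sigma> \<and> length \<sigma> \<le> K} \<subseteq> {xs. set xs \<subseteq> {..K} \<and> length xs \<le> K}"
    by (auto dest: is_permD(2))
qed (rule finite_lists_length_le, simp)

lemma length_le_L_total: "length \<sigma> \<le> L_total \<sigma>"
  using sum_mono[of "{..<length \<sigma>}" "\<lambda>_. 1" "ell \<sigma>"] ell_pos by (simp add: L_total_def)

lemma Q_form_nonneg:
  assumes "indecomposable_avoider \<sigma>"
  shows "0 \<le> Q_form \<sigma> x"
  unfolding Q_form_def using a_coeff_nonneg[OF assms]
  by (intro add_nonneg_nonneg sum_nonneg) (auto simp: case_prod_unfold)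

text \<open>
  \<open>Q\<close> takes only nonnegative values.
\<close>

lemma defect0_le:
  assumes "\<sigma> \<in> Sigma_set \<delta>"
  shows "defect0 \<sigma> \<le> \<delta>"
proof -
  obtain b n where b: "\<And>i. i < length \<sigma> \<Longrightarrow> 1 \<le> b i" "3 \<le> n" "inflate \<sigma> b \<in> residuals \<delta> n"
    using assms by (auto simp: Sigma_set_def)
  have perm: "is_perm \<sigma>" and iav: "indecomposable_avoider \<sigma>"
    using assms Sigma_setD(1) by (auto simp: Sigma_set_def)
  have ell: "\<And>i. i < length \<sigma> \<Longrightarrow> ell \<sigma> i \<le> b i" and def: "defect (inflate \<sigma> b) = \<delta>"
    using mem_residuals_inflate_iff[OF perm b(1,2)] b(3) by auto
  have "inflate \<sigma> b = inflate \<sigma> (\<lambda>i. ell \<sigma> i + (b i - ell \<sigma> i))"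
    by (rule inflate_cong) (use ell in simp)
  then show ?thesis
    using def defect_inflate[OF perm, of "\<lambda>i. b i - ell \<sigma> i"]
      Q_form_nonneg[OF iav, of "\<lambda>i. b i - ell \<sigma> i"] by presburger
qed

section \<open>A reduced permutation occurring for every defect\<close>

text \<open>
  Its inversion graph is the path with vertices 0, 2, 1, 4, 3 in this order, and it has
  \<open>\<delta>\<^sub>0 = 1\<close>.  Only the vertex 1 has a nonzero coefficient.
\<close>

definition base_perm :: "nat list" where "base_perm = [2, 4, 1, 5, 3]"

lemma length_base_perm: "length base_perm = 5"
  by (simp add: base_perm_def)

lemma base_perm_nth:
  "base_perm ! 0 = 2" "base_perm ! Suc 0 = 4" "base_perm ! 2 = 1" "base_perm ! 3 = 5" "base_perm ! 4 = 3"
  by (simp_all add: base_perm_def)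

lemma less_5_iff: "i < 5 \<longleftrightarrow> i = 0 \<or> i = Suc 0 \<or> i = 2 \<or> i = 3 \<or> i = (4::nat)"
  by auto

lemma Inv_base_perm: "Inv base_perm = {(0, 2), (Suc 0, 2), (Suc 0, 4), (3, 4)}"
proof -
  have "(i, j) \<in> Inv base_perm \<longleftrightarrow> (i, j) \<in> {(0, 2), (Suc 0, 2), (Suc 0, 4), (3, 4)}" for i j
  proof (cases "i < 5 \<and> j < 5")
    case True
    then have "i = 0 \<or> i = Suc 0 \<or> i = 2 \<or> i = 3 \<or> i = 4" "j = 0 \<or> j = Suc 0 \<or> j = 2 \<or> j = 3 \<or> j = 4"
      by (simp_all add: less_5_iff)
    then show ?thesis
      by (elim disjE) (simp_all add: Inv_def length_base_perm base_perm_nth)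
  next
    case False
    then show ?thesis by (auto simp: Inv_def length_base_perm)
  qed
  then show ?thesis by (intro set_eqI) (simp only: split_paired_all)
qed

lemma is_perm_base_perm: "is_perm base_perm"
  by (rule is_permI) (auto simp: base_perm_def)

lemma nbrs_base_perm:
  "nbrs base_perm 0 = {2}" "nbrs base_perm (Suc 0) = {2, 4}" "nbrs base_perm 2 = {0, Suc 0}"
  "nbrs base_perm 3 = {4}" "nbrs base_perm 4 = {Suc 0, 3}"
  unfolding nbrs_def Inv_base_perm by auto

lemma standardize_eq_filter:
  assumes "distinct w"
  shows "standardize w = map (\<lambda>x. length (filter (\<lambda>y. y \<le> x) w)) w"
  unfolding standardize_def
proof (rule map_cong[OF refl])
  fix x
  have "card {y \<in> set w. y \<le> x} = card (set (filter (\<lambda>y. y \<le> x) w))" by simp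
  then show "card {y \<in> set w. y \<le> x} = length (filter (\<lambda>y. y \<le> x) w)"
    using distinct_card[OF distinct_filter[OF assms]] by metis
qed

lemma decomposable_iff_list:
  "decomposable w \<longleftrightarrow> (\<exists>j\<in>set [1..<length w]. set (take j w) = set [1..<Suc j])"
  unfolding decomposable_def by (auto simp: atLeastLessThanSuc_atLeastAtMost simp del: upt_Suc)

lemma indecomposable_examples:
  "indecomposable [2, 4, 1, 5, 3]" "indecomposable [3, 1, 4, 2]" "indecomposable [2, 4, 1, 3]"
  unfolding decomposable_iff_list by code_simp+

lemma base_perm_avoider: "indecomposable_avoider base_perm"
proof -
  have "avoids_1324 base_perm"
    unfolding avoids_1324_def
  proof (intro notI, elim exE conjE)
    fix a b c d assume h: "a < b" "b < c" "c < d" "d < length base_perm"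
      "base_perm ! a < base_perm ! c" "base_perm ! c < base_perm ! b" "base_perm ! b < base_perm ! d"
    have "(b, c) \<in> Inv base_perm" using h by (simp add: Inv_def)
    then have "b = Suc 0" "c = 2" using h(1,3,4) by (auto simp: Inv_base_perm length_base_perm)
    then show False using h(1,5) by (simp add: base_perm_nth)
  qed
  then show ?thesis using is_perm_base_perm indecomposable_examples(1)
    by (simp add: indecomposable_avoider_def length_base_perm) (simp add: base_perm_def)
qed

lemma D_set_base_perm: "D_set base_perm = {2, 4}"
proof -
  have I: "I_set base_perm = {0, 2, 3, 4}"
    using I_set_eq[OF is_perm_base_perm, of 2 3] by (auto simp: length_base_perm base_perm_nth)
  have "2 \<in> D_set base_perm" "4 \<in> D_set base_perm"
    using sole_nbr_in_D_set[OF base_perm_avoider, of 0 2] sole_nbr_in_D_set[OF base_perm_avoider, of 3 4]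
    by (simp_all add: nbrs_base_perm length_base_perm)
  moreover have "0 \<notin> D_set base_perm" "3 \<notin> D_set base_perm"
  proof -
    have "standardize [4, 1, 5, 3] = [3, 1, 4, 2]" "standardize [2, 4, 1, 3] = [2, 4, 1, 3]"
      by (simp_all add: standardize_eq_filter)
    then have "del_entry base_perm 2 = [3, 1, 4, 2]" "del_entry base_perm 5 = [2, 4, 1, 3]"
      by (simp_all add: del_entry_def base_perm_def)
    then have "indecomposable (del_entry base_perm 2)" "indecomposable (del_entry base_perm 5)"
      using indecomposable_examples(2,3) by simp_all
    then show "0 \<notin> D_set base_perm" "3 \<notin> D_set base_perm"
      by (simp_all add: D_set_def base_perm_nth length_base_perm)
  qed
  moreover have "i \<in> {0, 2, 3, 4}" if "i \<in> D_set base_perm" for i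
    using that unfolding I[symmetric] by (simp add: D_set_def)
  ultimately have "i \<in> D_set base_perm \<longleftrightarrow> i \<in> {2, 4}" for i by (metis insert_iff singleton_iff)
  then show ?thesis by (rule set_eqI)
qed

lemma ell_base_perm: "ell base_perm i = (if i = 2 \<or> i = 4 then 2 else 1)"
  by (auto simp: ell_def D_set_base_perm)

lemma a_coeff_base_perm:
  "a_coeff base_perm 0 = 0" "a_coeff base_perm (Suc 0) = 2" "a_coeff base_perm 2 = 0"
  "a_coeff base_perm 3 = 0" "a_coeff base_perm 4 = 0"
  by (simp_all add: a_coeff_def nbrs_base_perm ell_base_perm)

lemma lessThan_5: "{..<5} = {0, Suc 0, 2, 3, 4}"
  by auto

lemma defect0_base_perm: "defect0 base_perm = 1"
proof -
  have "inversions (inflate base_perm (ell base_perm)) = 8"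
    using inversions_inflate[OF is_perm_base_perm, of "ell base_perm"] ell_pos
    by (simp add: Inv_base_perm ell_base_perm)
  moreover have "length (inflate base_perm (ell base_perm)) = 7"
    by (simp add: length_inflate length_base_perm lessThan_5 ell_base_perm)
  ultimately show ?thesis by (simp add: defect0_def defect_def)
qed

lemma Q_form_base_perm:
  "Q_form base_perm x = 2 * int (x (Suc 0)) + int (x 0) * int (x 2) + int (x (Suc 0)) * int (x 2)
    + int (x (Suc 0)) * int (x 4) + int (x 3) * int (x 4)"
  unfolding Q_form_def Inv_base_perm length_base_perm lessThan_5 by (simp add: a_coeff_base_perm)

text \<open>
  In the path of \<open>base_perm\<close>, giving \<open>\<delta> - 1\<close> to position 0 and 1 to its neighbour 2
  contributes \<open>\<delta> - 1\<close> to the form, and the far end 3 remains free.  For \<open>\<delta> = 1\<close>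
  nothing has to be contributed and \<open>T\<close> is empty.
\<close>

lemma exists_triple_with_free_position:
  assumes "1 \<le> \<delta>"
  shows "\<exists>\<sigma>\<in>Sigma_set \<delta>. \<exists>T x F. (T, x, F) \<in> triples \<delta> \<sigma> \<and> F \<noteq> {}"
proof -
  define T :: "nat set" where "T = (if \<delta> = 1 then {} else {0, 2})"
  define x where "x = (\<lambda>i\<in>T. if i = 0 then nat (\<delta> - 1) else 1)"
  have ze: "zero_ext T x i = (if \<delta> = 1 then 0 else if i = 0 then nat (\<delta> - 1) else if i = 2 then 1 else 0)" for i
    by (simp add: zero_ext_def x_def T_def)
  have Q: "Q_form base_perm (zero_ext T x) = \<delta> - defect0 base_perm"
    using assms by (simp add: Q_form_base_perm ze defect0_base_perm)
  have "base_perm \<in> Sigma_set \<delta>"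
  proof (rule Sigma_setI[OF is_perm_base_perm])
    show "reduced base_perm"
      unfolding reduced_def
    proof (intro allI impI)
      fix i assume "Suc i < length base_perm"
      then have "i = 0 \<or> i = 1 \<or> i = 2 \<or> i = 3" by (auto simp: length_base_perm)
      then show "base_perm ! Suc i \<noteq> base_perm ! i + 1" by (auto simp: base_perm_def)
    qed
    have "3 \<le> L_total base_perm" using length_le_L_total[of base_perm] by (simp add: length_base_perm)
    then show n: "3 \<le> L_total base_perm + (\<Sum>i<length base_perm. zero_ext T x i)" by simp
    show "inflate base_perm (\<lambda>i. ell base_perm i + zero_ext T x i) \<in>
        residuals \<delta> (L_total base_perm + (\<Sum>i<length base_perm. zero_ext T x i))"
      using inflate_mem_residuals_iff[OF is_perm_base_perm n, of "zero_ext T x" \<delta>] base_perm_avoider Q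
      by blast
  qed
  moreover have "(T, x, {3}) \<in> triples \<delta> base_perm"
    using Q assms
    by (auto simp: triples_def T_def x_def a_coeff_base_perm nbrs_base_perm length_base_perm split: if_splits)
  ultimately show ?thesis by blast
qed

section \<open>The counting polynomial\<close>

text \<open>
  The polynomial \<open>(X - m - 1) choose k\<close>.
\<close>

definition binomial_poly :: "nat \<Rightarrow> nat \<Rightarrow> rat poly" where
  "binomial_poly m k = smult (1 / fact k) (\<Prod>i<k. [:- of_nat (m + 1 + i), 1:])"

lemma poly_binomial_poly:
  assumes "m + 1 \<le> n"
  shows "poly (binomial_poly m k) (of_nat n) = of_nat ((n - m - 1) choose k)"
proof -
  have "of_nat (n - m - 1) = (of_nat n - of_nat m - 1 :: rat)"
    using assms by (simp add: of_nat_diff)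
  then have "(\<Prod>i<k. of_nat n - of_nat (m + 1 + i) :: rat) = (\<Prod>i<k. of_nat (n - m - 1) - of_nat i)"
    by (intro prod.cong) (auto simp: algebra_simps)
  moreover have "poly (binomial_poly m k) (of_nat n) = (\<Prod>i<k. of_nat n - of_nat (m + 1 + i)) / fact k"
    by (simp add: binomial_poly_def poly_prod algebra_simps)
  ultimately show ?thesis
    by (simp only: binomial_gbinomial gbinomial_prod_rev lessThan_atLeast0)
qed

lemma lead_coeff_binomial_poly: "lead_coeff (binomial_poly m k) = 1 / fact k"
  by (simp add: binomial_poly_def lead_coeff_prod)

lemma degree_binomial_poly: "degree (binomial_poly m k) = k"
  by (simp add: binomial_poly_def degree_prod_eq_sum_degree)

lemma degree_sum_pos_lead_coeff:
  fixes q :: "'a \<Rightarrow> rat poly"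
  assumes fin: "finite Z" and z0: "z0 \<in> Z" "degree (q z0) = d"
    and le: "\<And>z. z \<in> Z \<Longrightarrow> degree (q z) \<le> d" and pos: "\<And>z. z \<in> Z \<Longrightarrow> 0 < lead_coeff (q z)"
  shows "degree (\<Sum>z\<in>Z. q z) = d"
proof (rule antisym)
  show "degree (\<Sum>z\<in>Z. q z) \<le> d" by (rule degree_sum_le[OF fin le])
  have nonneg: "0 \<le> coeff (q z) d" if "z \<in> Z" for z
    using le[OF that] pos[OF that] by (cases "degree (q z) = d") (auto simp: coeff_eq_0)
  have "0 < coeff (q z0) d" using pos[OF z0(1)] z0(2) by simp
  also have "\<dots> \<le> (\<Sum>z\<in>Z. coeff (q z) d)" by (rule member_le_sum[OF z0(1)]) (use nonneg fin in auto)
  finally have "coeff (\<Sum>z\<in>Z. q z) d \<noteq> 0" by (simp add: coeff_sum)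
  then show "d \<le> degree (\<Sum>z\<in>Z. q z)" by (rule le_degree)
qed

lemma Sigma_set_L_total_le:
  assumes "\<sigma> \<in> Sigma_set \<delta>"
  shows "int (L_total \<sigma>) \<le> 2 * defect0 \<sigma> + 32"
  using L_total_le Sigma_setD[OF assms] by blast

lemma finite_Sigma_set: "finite (Sigma_set \<delta>)"
proof (rule finite_subset)
  show "Sigma_set \<delta> \<subseteq> {\<sigma>. is_perm \<sigma> \<and> length \<sigma> \<le> nat (2 * \<delta> + 32)}"
  proof
    fix \<sigma> assume \<sigma>: "\<sigma> \<in> Sigma_set \<delta>"
    then have "int (length \<sigma>) \<le> 2 * \<delta> + 32"
      using Sigma_set_L_total_le[OF \<sigma>] defect0_le[OF \<sigma>] length_le_L_total[of \<sigma>] by linarith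
    then show "\<sigma> \<in> {\<sigma>. is_perm \<sigma> \<and> length \<sigma> \<le> nat (2 * \<delta> + 32)}"
      using \<sigma> by (auto simp: Sigma_set_def)
  qed
qed (rule finite_bounded_perms)

lemma card_residuals:
  assumes n: "3 \<le> n"
  shows "card (residuals \<delta> n) = (\<Sum>\<sigma>\<in>Sigma_set \<delta>. \<Sum>(T, x, F)\<in>triples \<delta> \<sigma>.
    binom_term n (L_total \<sigma> + (\<Sum>i\<in>T. x i)) (card F))"
proof -
  have finex: "finite (excesses \<delta> n \<sigma>)" for \<sigma>
  proof (rule finite_subset)
    show "excesses \<delta> n \<sigma> \<subseteq> (\<Pi>\<^sub>E i\<in>{..<length \<sigma>}. {..n})"
    proof
      fix x assume x: "x \<in> excesses \<delta> n \<sigma>"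
      have "x i \<le> n" if "i < length \<sigma>" for i
        using member_le_sum[of i "{..<length \<sigma>}" x] that x by (simp add: excesses_def)
      then show "x \<in> (\<Pi>\<^sub>E i\<in>{..<length \<sigma>}. {..n})" using x by (auto simp: excesses_def PiE_iff)
    qed
  qed (auto intro: finite_PiE)
  have "card (residuals \<delta> n) = card (SIGMA \<sigma>:Sigma_set \<delta>. excesses \<delta> n \<sigma>)"
    using bij_betw_same_card[OF bij_betw_residuals[OF n]] by simp
  also have "\<dots> = (\<Sum>\<sigma>\<in>Sigma_set \<delta>. card (excesses \<delta> n \<sigma>))"
    by (rule card_SigmaI) (use finite_Sigma_set finex in auto)
  also have "\<dots> = (\<Sum>\<sigma>\<in>Sigma_set \<delta>. \<Sum>(T, x, F)\<in>triples \<delta> \<sigma>.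
      binom_term n (L_total \<sigma> + (\<Sum>i\<in>T. x i)) (card F))"
    by (intro sum.cong refl card_excesses Sigma_setD)
  finally show ?thesis .
qed

lemma binom_term_eq_poly:
  assumes "m + 1 \<le> n"
  shows "of_nat (binom_term n m f) = poly (if f = 0 then 0 else binomial_poly m (f - 1)) (of_nat n :: rat)"
  using assms poly_binomial_poly[OF assms, of "f - 1"] by (auto simp: binom_term_def)

text \<open>
  From \<open>n > L + t\<close> on, the terms with \<open>F = {}\<close> vanish and the others are binomial
  polynomials of degree \<open>|F| - 1\<close>.  Their leading coefficients are positive, so nothing
  cancels.
\<close>

lemma residuals_polynomial:
  assumes \<delta>: "1 \<le> \<delta>"
  shows "\<exists>p :: rat poly.
    (\<forall>n. int n \<ge> 8 * \<delta> + 30 \<longrightarrow> of_nat (card (residuals \<delta> n)) = poly p (of_nat n)) \<and>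
    int (degree p) =
      int (Max {card F | \<sigma> T x F. \<sigma> \<in> Sigma_set \<delta> \<and> (T, x, F) \<in> triples \<delta> \<sigma>}) - 1"
proof -
  define Z where "Z = (SIGMA \<sigma>:Sigma_set \<delta>. triples \<delta> \<sigma>)"
  define m where "m = (\<lambda>(\<sigma>, T, x :: nat \<Rightarrow> nat, F :: nat set). L_total \<sigma> + (\<Sum>i\<in>T. x i))"
  define f where "f = (\<lambda>(\<sigma> :: nat list, T :: nat set, x :: nat \<Rightarrow> nat, F :: nat set). card F)"
  define q where "q z = (if f z = 0 then 0 else binomial_poly (m z) (f z - 1))" for z
  define p where "p = (\<Sum>z\<in>Z. q z)"
  have fintr: "finite (triples \<delta> \<sigma>)" if "\<sigma> \<in> Sigma_set \<delta>" for \<sigma>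
    by (rule finite_triples[OF Sigma_setD(1)[OF that]])
  have finZ: "finite Z" unfolding Z_def using finite_Sigma_set fintr by (rule finite_SigmaI)
  have m_le: "int (m z) \<le> 8 * \<delta> + 29" if "z \<in> Z" for z
  proof -
    obtain \<sigma> T x F where z: "z = (\<sigma>, T, x, F)" by (cases z)
    have \<sigma>: "\<sigma> \<in> Sigma_set \<delta>" and tr: "(T, x, F) \<in> triples \<delta> \<sigma>" using that by (auto simp: Z_def z)
    have "int (m z) = int (L_total \<sigma>) + int (\<Sum>i\<in>T. x i)" by (simp add: m_def z)
    then show ?thesis
      using Sigma_set_L_total_le[OF \<sigma>] triples_sum_le[OF Sigma_setD(1)[OF \<sigma>] tr] \<delta> by presburger
  qed
  have eval: "of_nat (card (residuals \<delta> n)) = poly p (of_nat n)" if n: "int n \<ge> 8 * \<delta> + 30" for n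
  proof -
    have "card (residuals \<delta> n) = (\<Sum>\<sigma>\<in>Sigma_set \<delta>. \<Sum>tr\<in>triples \<delta> \<sigma>. binom_term n (m (\<sigma>, tr)) (f (\<sigma>, tr)))"
      using card_residuals[of n \<delta>] n \<delta> by (simp add: m_def f_def case_prod_unfold)
    also have "\<dots> = (\<Sum>z\<in>Z. binom_term n (m z) (f z))"
      unfolding Z_def using finite_Sigma_set fintr by (subst sum.Sigma) auto
    finally have "of_nat (card (residuals \<delta> n)) = (\<Sum>z\<in>Z. of_nat (binom_term n (m z) (f z)) :: rat)"
      by simp
    also have "\<dots> = (\<Sum>z\<in>Z. poly (q z) (of_nat n))"
    proof (rule sum.cong[OF refl])
      fix z assume "z \<in> Z"
      then have "m z + 1 \<le> n" using m_le[of z] n by linarith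
      then show "of_nat (binom_term n (m z) (f z)) = poly (q z) (of_nat n)"
        unfolding q_def by (rule binom_term_eq_poly)
    qed
    finally show ?thesis by (simp add: p_def poly_sum)
  qed
  define d where "d = Max (f ` Z)"
  have img: "{card F | \<sigma> T x F. \<sigma> \<in> Sigma_set \<delta> \<and> (T, x, F) \<in> triples \<delta> \<sigma>} = f ` Z"
    by (force simp: f_def Z_def image_iff)
  obtain z1 where z1: "z1 \<in> Z" "0 < f z1"
  proof -
    obtain \<sigma> T x F where "\<sigma> \<in> Sigma_set \<delta>" "(T, x, F) \<in> triples \<delta> \<sigma>" "F \<noteq> {}"
      using exists_triple_with_free_position[OF \<delta>] by blast
    moreover from this(2) have "finite F" by (auto simp: triples_def intro: finite_subset)
    ultimately show ?thesis using that[of "(\<sigma>, T, x, F)"] by (simp add: Z_def f_def card_gt_0_iff)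
  qed
  have f_le: "f z \<le> d" if "z \<in> Z" for z using finZ that by (simp add: d_def)
  have "d \<in> f ` Z" unfolding d_def by (rule Max_in) (use finZ z1 in auto)
  then obtain z0 where z0: "z0 \<in> Z" "f z0 = d" by auto
  have d: "0 < d" using f_le[OF z1(1)] z1(2) by simp
  have "p = (\<Sum>z\<in>{z \<in> Z. f z \<noteq> 0}. q z)"
    unfolding p_def by (rule sum.mono_neutral_right) (use finZ in \<open>auto simp: q_def\<close>)
  moreover have "degree (\<Sum>z\<in>{z \<in> Z. f z \<noteq> 0}. q z) = d - 1"
  proof (rule degree_sum_pos_lead_coeff)
    show "degree (q z) \<le> d - 1" if "z \<in> {z \<in> Z. f z \<noteq> 0}" for z
      using that f_le[of z] by (simp add: q_def degree_binomial_poly diff_le_mono)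
    show "0 < lead_coeff (q z)" if "z \<in> {z \<in> Z. f z \<noteq> 0}" for z
      using that by (simp add: q_def lead_coeff_binomial_poly)
    show "z0 \<in> {z \<in> Z. f z \<noteq> 0}" "degree (q z0) = d - 1"
      using z0 d by (simp_all add: q_def degree_binomial_poly)
  qed (use finZ in simp)
  ultimately have "int (degree p) = int d - 1" using d by simp
  then show ?thesis using eval img d_def by metis
qed

theorem theorem6p4:
  fixes \<delta> :: int
  assumes "\<delta> \<ge> 1"
  shows
    "finite (Sigma_set \<delta>)
     \<and> (\<forall>\<sigma>\<in>Sigma_set \<delta>. finite (triples \<delta> \<sigma>) \<and>
          (\<forall>(T, x, F)\<in>triples \<delta> \<sigma>. int (\<Sum>i\<in>T. x i) \<le> 2 * (\<delta> - defect0 \<sigma>)))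
     \<and> (\<forall>n\<ge>3. card (residuals \<delta> n) =
          (\<Sum>\<sigma>\<in>Sigma_set \<delta>. \<Sum>(T, x, F)\<in>triples \<delta> \<sigma>.
             binom_term n (L_total \<sigma> + (\<Sum>i\<in>T. x i)) (card F)))
     \<and> (\<exists>(n1 :: int) (p :: rat poly).
          n1 \<le> 8 * \<delta> + 30
          \<and> (\<forall>n. int n \<ge> n1 \<longrightarrow> of_nat (card (residuals \<delta> n)) = poly p (of_nat n))
          \<and> int (degree p) =
              int (Max {card F | \<sigma> T x F. \<sigma> \<in> Sigma_set \<delta> \<and> (T, x, F) \<in> triples \<delta> \<sigma>}) - 1)"
proof (intro conjI)
  show "finite (Sigma_set \<delta>)" by (rule finite_Sigma_set)
  show "\<forall>\<sigma>\<in>Sigma_set \<delta>. finite (triples \<delta> \<sigma>) \<and>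
      (\<forall>(T, x, F)\<in>triples \<delta> \<sigma>. int (\<Sum>i\<in>T. x i) \<le> 2 * (\<delta> - defect0 \<sigma>))"
  proof (intro ballI conjI)
    fix \<sigma> assume \<sigma>: "\<sigma> \<in> Sigma_set \<delta>"
    note iav = Sigma_setD(1)[OF \<sigma>]
    show "finite (triples \<delta> \<sigma>)" by (rule finite_triples[OF iav])
    fix tr assume tr: "tr \<in> triples \<delta> \<sigma>"
    obtain T x F where eq: "tr = (T, x, F)" by (cases tr)
    show "case tr of (T, x, F) \<Rightarrow> int (\<Sum>i\<in>T. x i) \<le> 2 * (\<delta> - defect0 \<sigma>)"
      using triples_sum_le[OF iav tr[unfolded eq]] unfolding eq by simp
  qed
  show "\<forall>n\<ge>3. card (residuals \<delta> n) =
      (\<Sum>\<sigma>\<in>Sigma_set \<delta>. \<Sum>(T, x, F)\<in>triples \<delta> \<sigma>.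
         binom_term n (L_total \<sigma> + (\<Sum>i\<in>T. x i)) (card F))"
    using card_residuals by blast
  obtain p :: "rat poly" where
    "\<forall>n. int n \<ge> 8 * \<delta> + 30 \<longrightarrow> of_nat (card (residuals \<delta> n)) = poly p (of_nat n)"
    "int (degree p) =
      int (Max {card F | \<sigma> T x F. \<sigma> \<in> Sigma_set \<delta> \<and> (T, x, F) \<in> triples \<delta> \<sigma>}) - 1"
    using residuals_polynomial[OF assms] by blast
  then show "\<exists>(n1 :: int) (p :: rat poly).
      n1 \<le> 8 * \<delta> + 30
      \<and> (\<forall>n. int n \<ge> n1 \<longrightarrow> of_nat (card (residuals \<delta> n)) = poly p (of_nat n))
      \<and> int (degree p) =
          int (Max {card F | \<sigma> T x F. \<sigma> \<in> Sigma_set \<delta> \<and> (T, x, F) \<in> triples \<delta> \<sigma>}) - 1"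
    by (intro exI[of _ "8 * \<delta> + 30"] exI[of _ p] conjI) auto
qed

end
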